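(* Let $f$ be a meromorphic function on $\mathbb{C}$, let $A\subset\mathbb{C}$ be finite and let $G\subset\mathbb{C}$, such that the following three conditions hold. (a) There exists $\epsilon>0$ such that the map $$\overline{s}:G\to A\cup\{0\},\qquad z\mapsto\begin{cases} s & \text{if } s\in A \text{ and } |f(z)-s|\le\exp(-|z|^{\epsilon}),\\ 0 & \text{if } |f(z)|\ge\exp(|z|^{\epsilon}),\end{cases}$$ is well defined, and there are $\delta_1,\delta_2\in\mathbb{R}$ such that for all $z\in G$ $$|z|^{\delta_1}\le\left|\frac{f'(z)}{f(z)-\overline{s}(z)}\right|\le|z|^{\delta_2}.$$ (b) There exist $B>1$ and $\beta\in(-\infty,1)$ such that for every measurable $D\subset\{z:\operatorname{dist}(z,\mathbb{C}\setminus G)\le 2|z|^{-\delta_1}\}$ $$\operatorname{meas}(D)\le B\,\operatorname{diam}(D)\,\sup_{z\in D}|z|^{\beta}.$$ (c) For every $s\in A$ we have $f^m(s)\to\infty$ as $m\to\infty$, and there is some $\tau>\beta$ such that $B\left(f^m(s),2|f^m(s)|^{\tau}\right)\subset G$ for all $s\in A$ and all but finitely many $m\in\mathbb{N}$. Then the set $T(f):=\{z:\omega(z)\subset\overline{O^+(A)}\}$ has positive Lebesgue measure. Furthermore, there exists $M>0$ such that for any square $T_0\subset\{z:\operatorname{dist}(z,\mathbb{C}\setminus G)>|z|^{-\delta_1}\}$ with $M_0:=\inf_{z\in T_0}|z|>M$ and $\operatorname{diam}(T_0)\ge M_0^{-\delta_2}$, $$\frac{\operatorname{meas}(T(f)\cap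 T_0)}{\operatorname{meas}(T_0)}\ge 1-\exp\left(-\eta M_0^{\epsilon}\right),$$ where $\eta:=\dfrac{\tau-\beta}{\max\{1,2-2\tau\}}>0$.
   Context: $f^m$ denotes the $m$-th iterate of $f$; $\operatorname{meas}$ is Lebesgue measure, $\operatorname{dist}$ Euclidean distance and $\operatorname{diam}$ Euclidean diameter in $\mathbb{C}$; $B(z,r)$ is the open disc of centre $z$ and radius $r$. "$\overline{s}$ is well defined" means that each $z\in G$ satisfies at least one of the listed conditions and that the value assigned is unique. $O^+(A)=\{f^m(s):s\in A,\ m\ge 0\}$, and $\overline{O^+(A)}$ is its closure in $\hat{\mathbb{C}}$. For $A\ne\emptyset$, under condition (c), this equals $O^+(A)\cup\{\infty\}$; in the case $A=\emptyset$, $\overline{O^+(A)}$ is understood as $\{\infty\}$. $\omega(z)\subset\hat{\mathbb{C}}$ is the set of accumulation points in $\hat{\mathbb{C}}$ of the sequence $(f^n(z))_n$, and $T(f)$ consists of points $z\in\mathbb{C}$ all of whose iterates $f^n(z)$ are defined.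
   Formalization: When A is empty, τ<1 is additionally required, since (c) then puts no constraint on τ and the density bound can fail (e.g. f = sin with τ−β>1); for nonempty A nothing is added, τ<1 being proved from (a) and (c). *)

theory Defs
  imports "HOL-Complex_Analysis.Complex_Analysis"
begin

text \<open>
  A meromorphic function on the plane is a function \<open>f :: complex \<Rightarrow> complex\<close> with
  \<open>f nicely_meromorphic_on UNIV\<close>. The value of such an \<open>f\<close> at a pole is the dummy value \<open>0\<close>, so
  poles are excluded explicitly wherever the value of \<open>f\<close> matters.
\<close>

text \<open>
  Powers \<open>x\<^sup>a\<close> of a number \<open>x \<ge> 0\<close> with values in \<open>[0, \<infinity>]\<close>. At \<open>x = 0\<close> the library's \<open>powr\<close> is
  \<open>0\<close> for every exponent; here \<open>0\<^sup>0 = 1\<close> and \<open>0\<^sup>a = \<infinity>\<close> for \<open>a < 0\<close>.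
\<close>
definition epowr :: "real \<Rightarrow> real \<Rightarrow> ennreal" where
  "epowr x a = (if x = 0 then (if a < 0 then top else if a = 0 then 1 else 0) else ennreal (x powr a))"

text \<open>
  Unlike \<open>infdist\<close> and \<open>diameter\<close>, the distance to the empty set and the diameter of an unbounded
  set are \<open>\<infinity>\<close> here, not \<open>0\<close>.
\<close>
definition edist_set :: "'a::metric_space \<Rightarrow> 'a set \<Rightarrow> ennreal" where
  "edist_set z S = (INF w\<in>S. ennreal (dist z w))"

definition ediam :: "'a::metric_space set \<Rightarrow> ennreal" where
  "ediam D = (SUP z\<in>D. SUP w\<in>D. ennreal (dist z w))"

text \<open>
  \<open>sbar_value f A \<epsilon> z v\<close>: one of the two conditions in the definition of \<open>sbar\<close> holds at \<open>z\<close> and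
  assigns the value \<open>v\<close>. The two conditions may overlap, so \<open>sbar\<close> is meaningful only on sets where
  \<open>sbar_well_defined\<close> holds.
\<close>
definition sbar_value ::
    "(complex \<Rightarrow> complex) \<Rightarrow> complex set \<Rightarrow> real \<Rightarrow> complex \<Rightarrow> complex \<Rightarrow> bool" where
  "sbar_value f A \<epsilon> z v \<longleftrightarrow>
     (v \<in> A \<and> cmod (f z - v) \<le> exp (- (cmod z powr \<epsilon>))) \<or>
     (v = 0 \<and> cmod (f z) \<ge> exp (cmod z powr \<epsilon>))"

definition sbar_well_defined ::
    "(complex \<Rightarrow> complex) \<Rightarrow> complex set \<Rightarrow> real \<Rightarrow> complex set \<Rightarrow> bool" where
  "sbar_well_defined f A \<epsilon> G \<longleftrightarrow> (\<forall>z\<in>G. \<exists>!v. sbar_value f A \<epsilon> z v)"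

definition sbar :: "(complex \<Rightarrow> complex) \<Rightarrow> complex set \<Rightarrow> real \<Rightarrow> complex \<Rightarrow> complex" where
  "sbar f A \<epsilon> z = (THE v. sbar_value f A \<epsilon> z v)"

text \<open>
  All iterates of \<open>f\<close> at \<open>z\<close> are defined (as points of the plane): the orbit never meets a pole.
\<close>
definition iterates_defined :: "(complex \<Rightarrow> complex) \<Rightarrow> complex \<Rightarrow> bool" where
  "iterates_defined f z \<longleftrightarrow> (\<forall>n. \<not> is_pole f ((f ^^ n) z))"

text \<open>The Riemann sphere; \<open>Some z\<close> is the finite point \<open>z\<close> and \<open>None\<close> is the point at infinity.\<close>
definition riemann_sphere :: "complex option topology" where
  "riemann_sphere = Alexandroff_compactification euclidean"

text \<open>
  Accumulation points of the orbit as a sequence, not of its set of values: a point which is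
  visited infinitely often is an accumulation point.
\<close>
definition omega_limit :: "(complex \<Rightarrow> complex) \<Rightarrow> complex \<Rightarrow> complex option set" where
  "omega_limit f z =
     {p \<in> topspace riemann_sphere.
        \<forall>U. openin riemann_sphere U \<and> p \<in> U \<longrightarrow>
            (\<exists>\<^sub>F n in sequentially. Some ((f ^^ n) z) \<in> U)}"

text \<open>Only used for sets \<open>A\<close> of points all of whose iterates are defined.\<close>
definition forward_orbit :: "(complex \<Rightarrow> complex) \<Rightarrow> complex set \<Rightarrow> complex set" where
  "forward_orbit f A = {(f ^^ m) s | m s. s \<in> A}"

text \<open>For \<open>A = {}\<close> the closure is by convention the point at infinity.\<close>
definition orbit_closure :: "(complex \<Rightarrow> complex) \<Rightarrow> complex set \<Rightarrow> complex option set" where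
  "orbit_closure f A =
     (if A = {} then {None} else riemann_sphere closure_of (Some ` forward_orbit f A))"

definition T_set :: "(complex \<Rightarrow> complex) \<Rightarrow> complex set \<Rightarrow> complex set" where
  "T_set f A = {z. iterates_defined f z \<and> omega_limit f z \<subseteq> orbit_closure f A}"

text \<open>Closed nondegenerate squares in arbitrary position; \<open>u\<close> is the direction of a side.\<close>
definition is_square :: "complex set \<Rightarrow> bool" where
  "is_square Q \<longleftrightarrow>
     (\<exists>c u r. cmod u = 1 \<and> r > 0 \<and>
        Q = {c + u * Complex x y | x y. \<bar>x\<bar> \<le> r \<and> \<bar>y\<bar> \<le> r})"

end

theory Submission
  imports Defs "HOL-Real_Asymp.Real_Asymp"
begin

text \<open>
  Call \<open>z\<close> good if a disc about \<open>z\<close> of radius \<open>\<bar>z\<bar>\<^sup>-\<^sup>L\<^sup>0\<close> lies in \<open>G\<close>. On this disc \<open>f - p\<close> has no zeros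
  and a logarithmic derivative of size between two powers of \<open>\<bar>z\<bar>\<close>, where \<open>p = 0\<close> if \<open>f\<close> is large
  and \<open>p = s \<in> A\<close> if \<open>f\<close> is close to \<open>s\<close>. In the second case follow the orbit of \<open>s\<close> until the
  first time \<open>m\<close> at which the distance to \<open>w = f\<^sup>m(s)\<close> exceeds \<open>\<bar>w\<bar>\<^sup>-\<^sup>K\<close>; before that time \<open>f\<close> is
  nearly linear along the orbit, so that \<open>f\<^sup>m\<^sup>+\<^sup>1 - w\<close> still has no zeros and a logarithmic derivative of
  polynomial size. Hence an iterate \<open>f\<^sup>k\<close> maps a small disc about \<open>z\<close> with bounded distortion onto
  a large near-disc about \<open>f\<^sup>k(z)\<close>. By (b), and since \<open>\<tau> > \<beta>\<close>, the points of the image that are not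
  good have density at most \<open>exp (- \<eta>\<^sub>1 \<bar>z\<bar>\<^sup>\<epsilon>)\<close> with \<open>\<eta>\<^sub>1 > \<eta>\<close>, up to polynomial factors. Covering the
  good points by discs and iterating, the densities lost form a rapidly convergent series, because
  the moduli at least double in each passage. A point that survives all passages shadows longer
  and longer parts of the orbits of \<open>A\<close>, or escapes, and so belongs to \<open>T(f)\<close>.
\<close>

text \<open>Everything is decided at the escape time \<open>m\<close>, by the distance
  \<open>d\<close> from the orbit point \<open>w\<close>. The derivative bound along the orbit gives
  \<open>d \<le> C0 exp (-|z|^\<epsilon>) |w|^(1+\<gamma>)\<close>. If
  \<open>d \<le> |w|^\<tau>\<close>, the disc of (c) about \<open>w\<close> contains the relevant
  image disc and nothing is lost. Otherwise the two bounds force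
  \<open>|w|^(1+\<gamma>-\<tau>) \<ge> exp (|z|^\<epsilon>) / C0\<close>, while (b) bounds the lost
  proportion, up to constants and powers of \<open>|z|\<close>, by
  \<open>|w|^\<beta> / d < |w|^(\<beta>-\<tau>)\<close>. Hence the exponent
  \<open>(\<tau>-\<beta>)/(1+\<gamma>-\<tau>)\<close>: every \<open>\<gamma>\<close> strictly
  between 0 and \<open>1-\<tau>\<close> makes it exceed \<open>(\<tau>-\<beta>)/(2-2\<tau>)\<close>,
  and the strict gap pays for all powers of \<open>|z|\<close> and all covering constants. The
  length of a passage has no bound and depends on the point, and points of \<open>A\<close> may be
  critical for an iterate. The first is met by quantifying over passage times, the second by working
  with the quotient \<open>(f^m)' u (u - s) / (f^m u - f^m s)\<close>, which stays bounded above and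
  below near \<open>s\<close> where the derivative alone need not.\<close>

section \<open>Covering and distortion\<close>

text \<open>
  Vitali coverings replace tilings by squares: the radii may vary from point to point, at the price
  of a constant factor.
\<close>

lemma measure_le_of_disjoint_cballs:
  fixes S U :: "'a::euclidean_space set" and F :: "'b::euclidean_space set"
    and Q :: "'a \<Rightarrow> 'b set"
  assumes r: "\<And>x. x \<in> S \<Longrightarrow> 0 < r x \<and> r x \<le> b"
    and sub: "\<And>x. x \<in> S \<Longrightarrow> cball x (r x) \<subseteq> U" and U: "U \<in> lmeasurable"
    and Q: "\<And>x. x \<in> S \<Longrightarrow> Q x \<in> lmeasurable"
    and le: "\<And>x. x \<in> S \<Longrightarrow> measure lebesgue (Q x) \<le> c * measure lebesgue (cball x (r x))"
    and c: "c \<ge> 0"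
    and F: "F \<in> sets lebesgue"
    and cover: "\<And>C. C \<subseteq> S \<Longrightarrow> S \<subseteq> (\<Union>x\<in>C. cball x (5 * r x)) \<Longrightarrow> F \<subseteq> (\<Union>x\<in>C. Q x)"
  shows "F \<in> lmeasurable" "measure lebesgue F \<le> c * measure lebesgue U"
proof -
  have S: "S \<subseteq> (\<Union>x\<in>S. cball x (r x))"
    using r by fastforce
  obtain C where C: "countable C" "C \<subseteq> S"
    "pairwise (\<lambda>i j. disjnt (cball i (r i)) (cball j (r j))) C"
    "S \<subseteq> (\<Union>i\<in>C. cball i (5 * r i))"
    by (rule Vitali_covering_lemma_cballs[OF S r])
  have fin: "measure lebesgue (\<Union>x\<in>I. Q x) \<le> c * measure lebesgue U" if I: "I \<subseteq> C" "finite I" for I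
  proof -
    have "measure lebesgue (\<Union>x\<in>I. Q x) \<le> (\<Sum>x\<in>I. measure lebesgue (Q x))"
      by (rule measure_UNION_le) (use I C Q in auto)
    also have "\<dots> \<le> (\<Sum>x\<in>I. c * measure lebesgue (cball x (r x)))"
      by (rule sum_mono) (use I C le in auto)
    also have "\<dots> = c * (\<Sum>x\<in>I. measure lebesgue (cball x (r x)))"
      by (simp add: sum_distrib_left)
    also have "(\<Sum>x\<in>I. measure lebesgue (cball x (r x))) = measure lebesgue (\<Union>x\<in>I. cball x (r x))"
      by (rule measure_UNION'[symmetric]) (use I C in \<open>auto intro: pairwise_subset\<close>)
    also have "c * \<dots> \<le> c * measure lebesgue U"
    proof (intro mult_left_mono measure_mono_fmeasurable c U)
      show "(\<Union>x\<in>I. cball x (r x)) \<subseteq> U"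
        using I C sub by blast
      show "(\<Union>x\<in>I. cball x (r x)) \<in> sets lebesgue"
        using I by (intro sets.finite_UN) auto
    qed
    finally show ?thesis .
  qed
  have Q': "\<And>i. i \<in> C \<Longrightarrow> Q i \<in> lmeasurable"
    using C Q by auto
  have UQ: "(\<Union>x\<in>C. Q x) \<in> lmeasurable" "measure lebesgue (\<Union>x\<in>C. Q x) \<le> c * measure lebesgue U"
    using fmeasurable_UN_bound[OF C(1) Q' fin] measure_UN_bound[OF C(1) Q' fin] by auto
  have sub: "F \<subseteq> (\<Union>x\<in>C. Q x)"
    by (rule cover[OF C(2) C(4)])
  show "F \<in> lmeasurable"
    using UQ(1) sub F by (rule fmeasurableI2)
  show "measure lebesgue F \<le> c * measure lebesgue U"
    using measure_mono_fmeasurable[OF sub F UQ(1)] UQ(2) by linarith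
qed

lemma measure_cball_complex:
  assumes "r \<ge> 0" shows "measure lborel (cball (z::complex) r) = pi * r\<^sup>2"
  using content_cball[OF assms, of z] by (simp add: unit_ball_vol_2)

text \<open>The Vitali balls of radius \<open>r x / 5\<close> are disjoint and lie in
  \<open>U\<close>; their fivefold enlargements are the balls of \<open>dens\<close> and cover
  \<open>E\<close>. The area factor 5^2 is the constant 25. Centres range over \<open>E\<close>
  itself, so a density bound at the points of the lost set suffices.\<close>

lemma measure_le_of_local_density:
  fixes E U :: "complex set"
  assumes E: "E \<in> sets lebesgue" and U: "U \<in> lmeasurable"
    and r: "\<And>x. x \<in> E \<Longrightarrow> 0 < r x \<and> r x \<le> b"
    and sub: "\<And>x. x \<in> E \<Longrightarrow> cball x (r x) \<subseteq> U"
    and dens: "\<And>x. x \<in> E \<Longrightarrow>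
      measure lebesgue (E \<inter> cball x (r x)) \<le> p * measure lebesgue (cball x (r x))"
    and p: "p \<ge> 0"
  shows "measure lebesgue E \<le> 25 * p * measure lebesgue U"
proof (rule measure_le_of_disjoint_cballs(2)[where S = E and r = "\<lambda>x. r x / 5" and b = "b/5"
      and Q = "\<lambda>x. E \<inter> cball x (r x)"])
  show "cball x (r x / 5) \<subseteq> U" if "x \<in> E" for x
    using r[OF that] sub[OF that] subset_cball[of "r x / 5" "r x" x] by force
  show "measure lebesgue (E \<inter> cball x (r x)) \<le> 25 * p * measure lebesgue (cball x (r x / 5))"
    if "x \<in> E" for x
    using dens[OF that] r[OF that] by (simp add: measure_cball_complex power_divide)
  show "E \<inter> cball x (r x) \<in> lmeasurable" for x
    using E fmeasurable_Int_fmeasurable[of "cball x (r x)" lebesgue E] by (simp add: Int_commute)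
qed (use assms in auto)

text \<open>Instead of a change of variables, \<open>N\<close> is covered by Vitali balls inside an
  open set of almost the same measure. The points of \<open>E\<close> sent into a ball of radius
  \<open>5 * r x\<close> have mutual distance at most \<open>10 * r x / a\<close>, hence lie in a
  disc of that radius about any one of them; the area ratio is (10/a)^2.\<close>

lemma measure_le_of_expanding_map:
  fixes \<phi> :: "complex \<Rightarrow> complex"
  assumes E: "E \<in> sets lebesgue" and N: "N \<in> lmeasurable" and im: "\<phi> ` E \<subseteq> N"
    and a: "a > 0"
    and exp: "\<And>x y. x \<in> E \<Longrightarrow> y \<in> E \<Longrightarrow> cmod (\<phi> x - \<phi> y) \<ge> a * cmod (x - y)"
  shows "measure lebesgue E \<le> 100 / a\<^sup>2 * measure lebesgue N"
proof (rule field_le_epsilon)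
  fix e :: real assume e: "e > 0"
  \<comment> \<open>The excess is chosen so that the factor \<open>100 / a\<^sup>2\<close> turns it
    into \<open>e\<close>.\<close>
  have "\<exists>U. open U \<and> N \<subseteq> U \<and> U \<in> lmeasurable \<and> measure lebesgue U \<le> measure lebesgue N + e * a\<^sup>2 / 100"
  proof -
    have "e * a\<^sup>2 / 100 > 0"
      using e a by simp
    then obtain U where "open U" "N \<subseteq> U" and d: "U - N \<in> lmeasurable" "emeasure lebesgue (U - N) < ennreal (e * a\<^sup>2 / 100)"
      using sets_lebesgue_outer_open[OF fmeasurableD[OF N]] by metis
    moreover have "measure lebesgue (U - N) \<le> e * a\<^sup>2 / 100"
      using d e a by (simp add: emeasure_eq_measure2 ennreal_less_iff)
    moreover have Ueq: "U = (U - N) \<union> N"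
      using \<open>N \<subseteq> U\<close> by blast
    moreover have "U \<in> lmeasurable"
      using d(1) N Ueq by (metis fmeasurable.Un)
    moreover have "measure lebesgue U \<le> measure lebesgue (U - N) + measure lebesgue N"
      using d(1) N Ueq by (metis fmeasurableD measure_Un_le)
    ultimately show ?thesis
      by (intro exI[of _ U]) auto
  qed
  then obtain U where U: "open U" "N \<subseteq> U" "U \<in> lmeasurable" "measure lebesgue U \<le> measure lebesgue N + e * a\<^sup>2 / 100"
    by blast
  have "\<forall>x\<in>N. \<exists>r. 0 < r \<and> r \<le> 1 \<and> cball x r \<subseteq> U"
  proof
    fix x assume "x \<in> N"
    then obtain r where "r > 0" "cball x r \<subseteq> U"
      using U open_contains_cball by blast
    then show "\<exists>r. 0 < r \<and> r \<le> 1 \<and> cball x r \<subseteq> U"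
      by (intro exI[of _ "min r 1"]) (auto simp: subset_eq)
  qed
  then obtain r where r: "\<And>x. x \<in> N \<Longrightarrow> 0 < r x \<and> r x \<le> 1 \<and> cball x (r x) \<subseteq> U"
    by metis
  define Q where "Q x = (if \<exists>y\<in>E. \<phi> y \<in> cball x (5 * r x)
      then cball (SOME y. y \<in> E \<and> \<phi> y \<in> cball x (5 * r x)) (10 * r x / a) else {})" for x
  have Qm: "Q x \<in> lmeasurable" for x
    by (simp add: Q_def)
  have "measure lebesgue E \<le> 100 / a\<^sup>2 * measure lebesgue U"
  proof (rule measure_le_of_disjoint_cballs(2)[where S = N and r = r and b = 1 and Q = Q])
    show "measure lebesgue (Q x) \<le> 100 / a\<^sup>2 * measure lebesgue (cball x (r x))" if "x \<in> N" for x
      using r[OF that] a by (auto simp: Q_def measure_cball_complex power_divide power_mult_distrib mult_ac)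
    show "E \<subseteq> (\<Union>x\<in>C. Q x)" if C: "C \<subseteq> N" "N \<subseteq> (\<Union>x\<in>C. cball x (5 * r x))" for C
    proof
      fix y assume y: "y \<in> E"
      then obtain x where x: "x \<in> C" "\<phi> y \<in> cball x (5 * r x)"
        using im C(2) by fastforce
      define y' where "y' = (SOME y. y \<in> E \<and> \<phi> y \<in> cball x (5 * r x))"
      have y': "y' \<in> E \<and> \<phi> y' \<in> cball x (5 * r x)"
        unfolding y'_def by (rule someI[of _ y]) (use x y in auto)
      have "a * cmod (y' - y) \<le> cmod (\<phi> y' - \<phi> y)"
        using exp y y' by blast
      also have "\<dots> \<le> dist (\<phi> y') x + dist x (\<phi> y)"
        by (metis dist_norm dist_triangle)
      also have "\<dots> \<le> 10 * r x"
        using x(2) y' by (simp add: dist_commute)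
      finally have "dist y' y \<le> 10 * r x / a"
        using a by (simp add: dist_norm field_simps)
      then have "y \<in> Q x"
        unfolding Q_def y'_def[symmetric] using x y by auto
      then show "y \<in> (\<Union>x\<in>C. Q x)"
        using x by blast
    qed
  qed (use assms r U Qm in auto)
  also have "\<dots> \<le> 100 / a\<^sup>2 * (measure lebesgue N + e * a\<^sup>2 / 100)"
    by (intro mult_left_mono U) auto
  also have "\<dots> = 100 / a\<^sup>2 * measure lebesgue N + e"
    using a by (simp add: field_simps)
  finally show "measure lebesgue E \<le> 100 / a\<^sup>2 * measure lebesgue N + e" .
qed


lemma norm_exp_minus_one_le:
  fixes t :: complex
  assumes "cmod t \<le> 1/2" shows "cmod (exp t - 1) \<le> 2 * cmod t"
proof -
  have "cmod (exp t - exp 0) \<le> 2 * cmod (t - 0)"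
  proof (rule field_differentiable_bound[where S = "cball 0 (1/2)" and f' = exp])
    fix z :: complex assume "z \<in> cball 0 (1/2)"
    then have "cmod z \<le> 1/2"
      by simp
    then have "exp (cmod z) \<le> 1 + 2 * (1/2)"
      using exp_bound_lemma[of "cmod z"] by simp
    then show "cmod (exp z) \<le> 2"
      using norm_exp[of z] by linarith
  qed (use assms in \<open>auto intro!: derivative_eq_intros\<close>)
  then show ?thesis
    by simp
qed

text \<open>On the disc \<open>F = exp h\<close> with \<open>h' = F'/F = g\<close>, and
  \<open>R * u \<le> 1/2\<close> keeps \<open>h x - h z\<close> where the exponential is nearly
  linear; this controls \<open>F x / F z\<close>. For the derivative, \<open>F' = g F\<close>, so
  \<open>F' x / F' z = (1 + a) (1 + b)\<close> with \<open>a\<close>, \<open>b\<close> the relative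
  changes of \<open>F\<close> and \<open>g\<close>. Cauchy's inequality on discs of radius
  \<open>R/4\<close> bounds \<open>g'\<close> by \<open>4u/R\<close>, and the lower bound
  \<open>l\<close> makes this relative to \<open>g z\<close>.\<close>

lemma log_derivative_distortion:
  fixes F :: "complex \<Rightarrow> complex"
  assumes hol: "F holomorphic_on ball z R" and nz: "\<And>x. x \<in> ball z R \<Longrightarrow> F x \<noteq> 0"
    and lower: "\<And>x. x \<in> ball z R \<Longrightarrow> l \<le> cmod (deriv F x / F x)"
    and upper: "\<And>x. x \<in> ball z R \<Longrightarrow> cmod (deriv F x / F x) \<le> u"
    and l: "l > 0" and R: "R > 0" "R * u \<le> 1/2"
  shows log_derivative_distortion_value:
      "\<And>x. x \<in> ball z R \<Longrightarrow> cmod (F x - F z) \<le> 2 * u * cmod (x - z) * cmod (F z)"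
    and log_derivative_distortion_deriv:
      "\<And>x. cmod (x - z) \<le> R / 2 \<Longrightarrow>
        cmod (deriv F x - deriv F z) \<le> 16 * u / (R * l) * cmod (x - z) * cmod (deriv F z)"
proof -
  define g where "g x = deriv F x / F x" for x
  have zin: "z \<in> ball z R"
    using R by simp
  have u: "u > 0" "l \<le> u"
    using lower[OF zin] upper[OF zin] l by linarith+
  obtain h where h: "h holomorphic_on ball z R" "\<And>x. x \<in> ball z R \<Longrightarrow> exp (h x) = F x"
    using holomorphic_logarithm_exists[OF convex_ball open_ball hol nz zin] by blast
  have dh: "(h has_field_derivative g x) (at x)" if x: "x \<in> ball z R" for x
  proof -
    have dh: "(h has_field_derivative deriv h x) (at x)"
      using h(1) x holomorphic_derivI open_ball by blast
    have "((\<lambda>x. exp (h x)) has_field_derivative exp (h x) * deriv h x) (at x)"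
      by (rule derivative_eq_intros dh refl)+
    then have "(F has_field_derivative exp (h x) * deriv h x) (at x)"
      by (rule has_field_derivative_transform_within_open[of _ _ _ "ball z R"]) (use h(2) x in auto)
    then have "deriv F x = F x * deriv h x"
      using h(2)[OF x] by (simp add: DERIV_imp_deriv)
    then have "deriv h x = g x"
      using nz[OF x] by (simp add: g_def)
    then show ?thesis
      using dh by simp
  qed
  have *: "cmod (h x - h z) \<le> u * cmod (x - z)" if x: "x \<in> ball z R" for x
    by (rule field_differentiable_bound[where S = "ball z R" and f' = g])
      (use dh upper x zin in \<open>auto simp: g_def intro: has_field_derivative_at_within\<close>)
  have ratio: "cmod (F x / F z - 1) \<le> 2 * u * cmod (x - z)" if x: "x \<in> ball z R" for x
  proof -
    have "u * cmod (x - z) \<le> R * u"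
      using x u by (simp add: dist_norm norm_minus_commute mult.commute)
    then have "cmod (h x - h z) \<le> 1/2"
      using *[OF x] R by linarith
    from norm_exp_minus_one_le[OF this] *[OF x] have "cmod (exp (h x - h z) - 1) \<le> 2 * u * cmod (x - z)"
      by linarith
    then show ?thesis
      by (simp only: exp_diff h(2)[OF x] h(2)[OF zin])
  qed
  show A: "cmod (F x - F z) \<le> 2 * u * cmod (x - z) * cmod (F z)" if x: "x \<in> ball z R" for x
  proof -
    have "F x - F z = (F x / F z - 1) * F z"
      using nz[OF zin] by (simp add: field_simps)
    then show ?thesis
      using ratio[OF x] by (metis mult_right_mono norm_ge_zero norm_mult)
  qed
  have holg: "g holomorphic_on ball z R"
    unfolding g_def using hol nz by (intro holomorphic_intros holomorphic_deriv) auto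
  have dg: "cmod (deriv g x) \<le> 4 * u / R" if x: "x \<in> cball z (R/2)" for x
  proof -
    have sub: "cball x (R/4) \<subseteq> ball z R"
    proof
      fix y assume "y \<in> cball x (R/4)"
      then show "y \<in> ball z R"
        using x R dist_triangle[of z y x] by simp
    qed
    have "cmod ((deriv ^^ 1) g x) \<le> fact 1 * u / (R/4) ^ 1"
    proof (rule Cauchy_inequality)
      show "g holomorphic_on ball x (R/4)"
        by (rule holomorphic_on_subset[OF holg]) (use sub ball_subset_cball in blast)
      show "continuous_on (cball x (R/4)) g"
        by (rule holomorphic_on_imp_continuous_on, rule holomorphic_on_subset[OF holg sub])
      show "cmod (g y) \<le> u" if "cmod (x - y) = R/4" for y
      proof -
        have "y \<in> cball x (R/4)"
          using that by (simp add: dist_norm)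
        then show ?thesis
          using upper sub by (auto simp: g_def)
      qed
    qed (use R in auto)
    then show ?thesis
      by (simp add: mult.commute)
  qed
  show "cmod (deriv F x - deriv F z) \<le> 16 * u / (R * l) * cmod (x - z) * cmod (deriv F z)"
    if x: "cmod (x - z) \<le> R / 2" for x
  proof -
    have xb: "x \<in> ball z R"
      using x R by (simp add: dist_norm norm_minus_commute)
    have gz: "cmod (g z) \<ge> l" "g z \<noteq> 0" "F z \<noteq> 0"
      using lower[OF zin] l nz[OF zin] by (auto simp: g_def)
    have "cmod (g x - g z) \<le> 4 * u / R * cmod (x - z)"
    proof (rule field_differentiable_bound[where S = "cball z (R/2)" and f' = "deriv g"])
      fix y assume y: "y \<in> cball z (R/2)"
      then have "y \<in> ball z R"
        using R by auto
      then show "(g has_field_derivative deriv g y) (at y within cball z (R/2))"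
        using holg has_field_derivative_at_within holomorphic_derivI open_ball by blast
    qed (use x dg R in \<open>auto simp: dist_norm norm_minus_commute\<close>)
    define b where "b = g x / g z - 1"
    define a where "a = F x / F z - 1"
    have "cmod b = cmod (g x - g z) / cmod (g z)"
      using gz by (simp add: b_def divide_simps flip: norm_divide)
    also have "\<dots> \<le> (4 * u / R * cmod (x - z)) / l"
      by (rule frac_le) (use \<open>cmod (g x - g z) \<le> _\<close> gz l u R in auto)
    finally have b: "cmod b \<le> 4 * u / (R * l) * cmod (x - z)"
      by (simp add: field_simps)
    have a: "cmod a \<le> 2 * u * cmod (x - z)"
      using ratio[OF xb] by (simp add: a_def)
    \<comment> \<open>\<open>R * l \<le> 1\<close> weakens the bound on \<open>a\<close> to the
      shape of the bound on \<open>b\<close>.\<close>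
    have "R * l \<le> R * u"
      using u R by simp
    then have "R * l \<le> 1"
      using R by linarith
    moreover have "R * l > 0"
      using R l by simp
    ultimately have Rl: "R * l \<le> 1" "R * l > 0"
      by blast+
    then have "1 \<le> 1 / (R * l)"
      by (simp add: divide_simps)
    then have "2 * u * cmod (x - z) * 1 \<le> 2 * u * cmod (x - z) * (1 / (R * l))"
      using u by (intro mult_left_mono) auto
    then have a': "cmod a \<le> 2 * u / (R * l) * cmod (x - z)"
      using a by (simp add: field_simps)
    have "u * cmod (x - z) \<le> u * R"
      using x u R by (intro mult_left_mono) auto
    then have "cmod a \<le> 1"
      using a R by (simp add: mult.commute mult.left_commute)
    have "deriv F x / deriv F z - 1 = a + b + a * b"
      using gz nz[OF xb] by (simp add: a_def b_def g_def field_simps)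
    then have "cmod (deriv F x / deriv F z - 1) \<le> cmod a + cmod b + cmod a * cmod b"
      by (metis norm_mult norm_triangle_ineq norm_triangle_le add_mono order_refl)
    also have "\<dots> \<le> cmod a + cmod b + 1 * cmod b"
      using \<open>cmod a \<le> 1\<close> by (intro add_left_mono mult_right_mono) auto
    also have "\<dots> \<le> 16 * u / (R * l) * cmod (x - z)"
    proof -
      define t where "t = u / (R * l) * cmod (x - z)"
      have "0 \<le> t" "cmod a \<le> 2 * t" "cmod b \<le> 4 * t"
        using u Rl a' b by (auto simp: t_def)
      then have "cmod a + cmod b + 1 * cmod b \<le> 16 * t"
        by linarith
      then show ?thesis
        by (simp add: t_def)
    qed
    finally have "cmod (deriv F x / deriv F z - 1) \<le> 16 * u / (R * l) * cmod (x - z)" .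
    moreover have "deriv F x - deriv F z = (deriv F x / deriv F z - 1) * deriv F z"
      using gz by (simp add: g_def field_simps)
    ultimately show ?thesis
      by (metis mult_right_mono norm_ge_zero norm_mult)
  qed
qed

text \<open>Mean value inequality for \<open>\<phi> x - a * x\<close>. For \<open>k < |a|\<close> it
  gives injectivity and expansion at rate \<open>|a| - k\<close>, in place of a univalence
  argument.\<close>

lemma nearly_linear:
  fixes \<phi> :: "complex \<Rightarrow> complex"
  assumes "convex S" and "\<And>x. x \<in> S \<Longrightarrow> (\<phi> has_field_derivative \<phi>' x) (at x within S)"
    and "\<And>x. x \<in> S \<Longrightarrow> cmod (\<phi>' x - a) \<le> k" and "x \<in> S" "y \<in> S"
  shows "cmod (\<phi> x - \<phi> y - a * (x - y)) \<le> k * cmod (x - y)"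
proof -
  have "cmod ((\<phi> x - a * x) - (\<phi> y - a * y)) \<le> k * cmod (x - y)"
    by (rule field_differentiable_bound[where S = S and f' = "\<lambda>x. \<phi>' x - a"])
      (use assms in \<open>auto intro!: derivative_eq_intros\<close>)
  then show ?thesis
    by (simp add: algebra_simps)
qed

section \<open>Points shadowing the orbits of \<open>A\<close>\<close>

text \<open>A description of \<open>T(f)\<close> by inequalities, without the sphere: one parameter
  \<open>Q\<close> measures nearness to infinity and to the finite orbit points. In this form Borel
  measurability can be read off.\<close>

definition shadowing :: "(complex \<Rightarrow> complex) \<Rightarrow> complex set \<Rightarrow> complex \<Rightarrow> bool" where
  "shadowing f A x \<longleftrightarrow> iterates_defined f x \<and>
     (\<forall>Q>0. \<forall>\<^sub>F n in sequentially.
        cmod ((f ^^ n) x) > Q \<or> (\<exists>p\<in>forward_orbit f A. dist ((f ^^ n) x) p < 1 / Q))"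

text \<open>If an orbit fails the condition for some \<open>Q\<close> infinitely often, it visits
  infinitely often a compact set at distance at least \<open>1 / Q\<close> from the orbits of
  \<open>A\<close>, and a limit point there contradicts the inclusion. Conversely infinity is in the
  closure because the orbits of \<open>A\<close> escape, and a finite point outside it has a
  neighbourhood free of orbit points.\<close>

lemma T_set_eq_shadowing:
  assumes "\<And>s. s \<in> A \<Longrightarrow> filterlim (\<lambda>m. (f ^^ m) s) at_infinity sequentially"
  shows "T_set f A = {x. shadowing f A x}"
proof (intro set_eqI iffI; clarify?)
  fix x assume "x \<in> T_set f A"
  then have x: "iterates_defined f x" "omega_limit f x \<subseteq> orbit_closure f A"
    by (auto simp: T_set_def)
  have "\<forall>\<^sub>F n in sequentially. cmod ((f ^^ n) x) > Q \<or> (\<exists>p\<in>forward_orbit f A. dist ((f ^^ n) x) p < 1 / Q)"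
    if Q: "Q > 0" for Q
  proof (rule ccontr)
    define C where "C = {w. cmod w \<le> Q \<and> (\<forall>p\<in>forward_orbit f A. dist w p \<ge> 1 / Q)}"
    assume "\<not> ?thesis"
    then have fr: "\<exists>\<^sub>F n in sequentially. (f ^^ n) x \<in> C"
      unfolding frequently_def
      by (rule contrapos_nn) (erule eventually_mono, auto simp: C_def not_le)
    have "C = cball 0 Q \<inter> (\<Inter>p\<in>forward_orbit f A. - ball p (1 / Q))"
      by (auto simp: C_def dist_commute not_less)
    then have "compact C"
      by (metis closed_Compl closed_INT compact_Int_closed compact_cball open_ball)
    have "\<exists>r::nat\<Rightarrow>nat. strict_mono r \<and> (\<forall>n. (f ^^ r n) x \<in> C)"
    proof -
      have "infinite {n. (f ^^ n) x \<in> C}"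
        using fr by (simp add: frequently_cofinite[symmetric] cofinite_eq_sequentially)
      then show ?thesis
        by (intro exI[of _ "enumerate {n. (f ^^ n) x \<in> C}"])
          (use enumerate_in_set strict_mono_enumerate in fastforce)
    qed
    then obtain r :: "nat \<Rightarrow> nat" where r: "strict_mono r" "\<And>n. (f ^^ r n) x \<in> C"
      by blast
    obtain l q where l: "l \<in> C" "strict_mono q" "((\<lambda>n. (f ^^ r n) x) \<circ> q) \<longlonglongrightarrow> l"
      using \<open>compact C\<close> r(2) unfolding compact_def by metis
    have "Some l \<in> omega_limit f x"
      unfolding omega_limit_def
    proof (safe)
      show "Some l \<in> topspace riemann_sphere"
        by (simp add: riemann_sphere_def)
      fix U assume U: "openin riemann_sphere U" "Some l \<in> U"
      have "open {w. Some w \<in> U}"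
      proof -
        have "openin euclidean {w \<in> topspace euclidean. Some w \<in> U}"
          using continuous_map_Some U(1) unfolding riemann_sphere_def by (rule openin_continuous_map_preimage)
        then show ?thesis
          by simp
      qed
      then have "\<forall>\<^sub>F n in sequentially. Some ((f ^^ r (q n)) x) \<in> U"
        using topological_tendstoD[OF l(3)] U(2) by fastforce
      then obtain N where N: "\<And>n. n \<ge> N \<Longrightarrow> Some ((f ^^ r (q n)) x) \<in> U"
        by (auto simp: eventually_sequentially)
      show "\<exists>\<^sub>F n in sequentially. Some ((f ^^ n) x) \<in> U"
        unfolding frequently_sequentially
      proof (intro allI)
        fix m
        have "max m N \<le> r (q (max m N))"
          using seq_suble[OF strict_mono_compose[OF r(1) l(2)]] by (simp add: o_def)
        then show "\<exists>n\<ge>m. Some ((f ^^ n) x) \<in> U"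
          using N[of "max m N"] by (intro exI[of _ "r (q (max m N))"]) auto
      qed
    qed
    then have *: "A \<noteq> {}" "Some l \<in> riemann_sphere closure_of (Some ` forward_orbit f A)"
      using x(2) by (auto simp: orbit_closure_def split: if_splits)
    have "openin riemann_sphere (Some ` ball l (1 / Q))"
      by (simp add: riemann_sphere_def)
    moreover have "Some l \<in> Some ` ball l (1 / Q)"
      using Q by simp
    ultimately obtain p where "p \<in> forward_orbit f A" "Some p \<in> Some ` ball l (1 / Q)"
      using *(2) unfolding in_closure_of by blast
    then show False
      using l(1) by (auto simp: C_def)
  qed
  then show "shadowing f A x"
    using x by (simp add: shadowing_def)
next
  fix x assume "shadowing f A x"
  then have x: "iterates_defined f x" "\<And>Q. Q > 0 \<Longrightarrow> \<forall>\<^sub>F n in sequentially.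
        cmod ((f ^^ n) x) > Q \<or> (\<exists>p\<in>forward_orbit f A. dist ((f ^^ n) x) p < 1 / Q)"
    by (auto simp: shadowing_def)
  have None_in: "None \<in> orbit_closure f A"
  proof (cases "A = {}")
    case False
    then obtain s where s: "s \<in> A"
      by blast
    have "None \<in> riemann_sphere closure_of (Some ` forward_orbit f A)"
      unfolding in_closure_of
    proof (intro conjI allI impI)
      show "None \<in> topspace riemann_sphere"
        by (simp add: riemann_sphere_def)
      fix U assume U: "None \<in> U \<and> openin riemann_sphere U"
      then obtain C where C: "compact C" "U = insert None (Some ` (- C))"
        by (auto simp: riemann_sphere_def openin_Alexandroff_compactification Compl_eq_Diff_UNIV)
      obtain b where b: "\<And>w. w \<in> C \<Longrightarrow> cmod w \<le> b"
        using C(1) compact_imp_bounded bounded_iff by metis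
      have "\<forall>\<^sub>F m in sequentially. cmod ((f ^^ m) s) > b"
        using filterlim_at_infinity_imp_norm_at_top[OF assms[OF s]] by (simp add: filterlim_at_top_dense)
      then obtain m where "cmod ((f ^^ m) s) > b"
        by (auto simp: eventually_sequentially)
      then have "(f ^^ m) s \<notin> C"
        using b by fastforce
      then show "\<exists>y. y \<in> Some ` forward_orbit f A \<and> y \<in> U"
        using C s by (intro exI[of _ "Some ((f ^^ m) s)"]) (auto simp: forward_orbit_def)
    qed
    then show ?thesis
      using False by (simp add: orbit_closure_def)
  qed (simp add: orbit_closure_def)
  have "p \<in> orbit_closure f A" if p: "p \<in> omega_limit f x" for p
  proof (cases p)
    case (Some w)
    show ?thesis
    proof (rule ccontr)
      assume np: "p \<notin> orbit_closure f A"
      have "\<exists>e>0. \<forall>q\<in>forward_orbit f A. dist w q \<ge> e"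
      proof (cases "A = {}")
        case True
        then show ?thesis
          by (auto simp: forward_orbit_def intro: exI[of _ 1])
      next
        case False
        then have "p \<notin> riemann_sphere closure_of (Some ` forward_orbit f A)"
          using np by (simp add: orbit_closure_def)
        then obtain U where U: "openin riemann_sphere U" "Some w \<in> U" "U \<inter> Some ` forward_orbit f A = {}"
          by (auto simp: in_closure_of Some riemann_sphere_def)
        have "openin euclidean {w \<in> topspace euclidean. Some w \<in> U}"
          using continuous_map_Some U(1) unfolding riemann_sphere_def by (rule openin_continuous_map_preimage)
        then have "open {w. Some w \<in> U}"
          by simp
        then obtain e where "e > 0" "ball w e \<subseteq> {w. Some w \<in> U}"
          using U(2) open_contains_ball by blast
        then show ?thesis
          using U(3) by (intro exI[of _ e]) (force simp: not_less[symmetric])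
      qed
      then obtain e where e: "e > 0" "\<And>q. q \<in> forward_orbit f A \<Longrightarrow> dist w q \<ge> e"
        by blast
      \<comment> \<open>Within distance 1 of \<open>w\<close> the first alternative for
        \<open>Q\<close> fails, and within \<open>e / 2\<close> the second would place an orbit
        point at distance less than \<open>e / 2 + 1 / Q \<le> e\<close> from
        \<open>w\<close>.\<close>
      define Q where "Q = max (cmod w + 1) (2 / e)"
      have "Q \<ge> cmod w + 1" "Q \<ge> 2 / e"
        by (simp_all add: Q_def)
      moreover from this have "Q > 0"
        using norm_ge_zero[of w] by linarith
      ultimately have Q: "Q > 0" "Q \<ge> cmod w + 1" "1 / Q \<le> e / 2"
        using e by (auto simp: field_simps)
      have "openin riemann_sphere (Some ` ball w (min 1 (e / 2)))"
        by (simp add: riemann_sphere_def)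
      then have "\<exists>\<^sub>F n in sequentially. Some ((f ^^ n) x) \<in> Some ` ball w (min 1 (e / 2))"
        using p Some e(1) unfolding omega_limit_def by auto
      then have "\<exists>\<^sub>F n in sequentially. dist w ((f ^^ n) x) < min 1 (e / 2)"
        by (rule frequently_elim1) auto
      from frequently_eventually_conj[OF this x(2)[OF Q(1)]]
      obtain n where n: "dist w ((f ^^ n) x) < min 1 (e / 2)"
        "cmod ((f ^^ n) x) > Q \<or> (\<exists>p\<in>forward_orbit f A. dist ((f ^^ n) x) p < 1 / Q)"
        using frequently_ex by blast
      have "cmod ((f ^^ n) x) \<le> cmod w + dist w ((f ^^ n) x)"
        by (metis dist_norm norm_minus_commute norm_triangle_sub)
      then have "\<not> cmod ((f ^^ n) x) > Q"
        using n(1) Q by simp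
      then obtain q where "q \<in> forward_orbit f A" "dist ((f ^^ n) x) q < 1 / Q"
        using n(2) by blast
      then show False
        using e(2)[of q] n(1) Q(3) dist_triangle[of w q "(f ^^ n) x"] by simp
    qed
  qed (use None_in in simp)
  then show "x \<in> T_set f A"
    using x(1) by (auto simp: T_set_def)
qed

section \<open>Iterates away from the poles and Borel measurability\<close>

definition regular_upto :: "(complex \<Rightarrow> complex) \<Rightarrow> nat \<Rightarrow> complex set" where
  "regular_upto f n = {x. \<forall>i<n. \<not> is_pole f ((f ^^ i) x)}"

lemma regular_upto_Suc: "regular_upto f (Suc n) = {x \<in> regular_upto f n. \<not> is_pole f ((f ^^ n) x)}"
  by (auto simp: regular_upto_def less_Suc_eq)

context
  fixes f :: "complex \<Rightarrow> complex"
  assumes mero: "f nicely_meromorphic_on UNIV"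
begin

lemma open_nonpoles: "open {x. \<not> is_pole f x}"
proof -
  have "f meromorphic_on UNIV"
    using mero by (simp add: nicely_meromorphic_on_def)
  then have "{z. is_pole f z} sparse_in UNIV"
    by (meson UNIV_I meromorphic_on_isolated_singularity meromorphic_on_meromorphic_at not_islimpt_poles
        sparse_in_open open_UNIV)
  then have "open (UNIV - {z. is_pole f z})"
    by (rule open_diff_sparse_pts[OF open_UNIV])
  then show ?thesis
    by (simp add: set_diff_eq)
qed

lemma holomorphic_on_nonpoles: "f holomorphic_on {x. \<not> is_pole f x}"
proof (rule analytic_imp_holomorphic)
  show "f analytic_on {x. \<not> is_pole f x}"
    using nicely_meromorphic_on_imp_analytic_at[OF mero] analytic_on_analytic_at by blast
qed

lemma regular_upto_props:
  "open (regular_upto f n)" "(f ^^ n) holomorphic_on regular_upto f n"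
proof (induction n)
  case 0
  show "open (regular_upto f 0)" "(f ^^ 0) holomorphic_on regular_upto f 0"
    by (auto simp: regular_upto_def id_def)
next
  case (Suc n)
  have eq: "regular_upto f (Suc n) = regular_upto f n \<inter> (f ^^ n) -` {x. \<not> is_pole f x}"
    by (auto simp: regular_upto_Suc)
  show "open (regular_upto f (Suc n))"
    unfolding eq
    by (rule continuous_open_preimage[OF holomorphic_on_imp_continuous_on[OF Suc(2)] Suc(1) open_nonpoles])
  have "(f \<circ> (f ^^ n)) holomorphic_on regular_upto f (Suc n)"
    by (rule holomorphic_on_compose_gen[OF holomorphic_on_subset[OF Suc(2)] holomorphic_on_nonpoles])
      (auto simp: eq)
  then show "(f ^^ Suc n) holomorphic_on regular_upto f (Suc n)"
    by simp
qed

text \<open>At a pole a nicely meromorphic function has the value 0, so \<open>f\<close> is a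
  continuous function on an open set, extended by zero.\<close>

lemma borel_measurable_nicely_meromorphic: "f \<in> borel_measurable borel"
proof -
  have "f x = indicator {x. \<not> is_pole f x} x *\<^sub>R f x" for x
  proof (cases "is_pole f x")
    case True
    then have "f x = 0"
      using mero UNIV_I not_tendsto_and_filterlim_at_infinity[of "at x" f "f x"]
      unfolding nicely_meromorphic_on_def is_pole_def by force
    then show ?thesis
      by simp
  qed simp
  then have eq: "f = (\<lambda>x. indicator {x. \<not> is_pole f x} x *\<^sub>R f x)"
    by blast
  show ?thesis
    by (subst eq, rule borel_measurable_continuous_on_indicator)
      (use open_nonpoles holomorphic_on_nonpoles holomorphic_on_imp_continuous_on in auto)
qed

lemma borel_measurable_iterate: "(f ^^ n) \<in> borel_measurable borel"
  by (rule measurable_compose_n[OF borel_measurable_nicely_meromorphic])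

lemma borel_regular_upto: "regular_upto f n \<in> sets borel"
  using regular_upto_props(1) by simp

text \<open>The condition is monotone in \<open>Q\<close>, so the integers \<open>Suc k\<close>
  suffice; for each of them and each time the set is the preimage of an open set under a Borel
  iterate.\<close>

lemma borel_shadowing: "{x. shadowing f A x} \<in> sets borel"
proof -
  define B where "B Q n = {x. cmod ((f ^^ n) x) > real (Suc Q) \<or>
      (\<exists>p\<in>forward_orbit f A. dist ((f ^^ n) x) p < 1 / real (Suc Q))}" for Q n
  have 1: "B Q n \<in> sets borel" for Q n
  proof -
    have "open ({w. cmod w > real (Suc Q)} \<union> (\<Union>p\<in>forward_orbit f A. ball p (1 / real (Suc Q))))" (is "open ?O")
      by (intro open_Un open_UN ballI open_ball open_Collect_less continuous_intros)
    then have "(f ^^ n) -` ?O \<inter> space borel \<in> sets borel"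
      using borel_measurable_iterate by (intro measurable_sets[of _ borel borel]) auto
    moreover have "(f ^^ n) -` ?O \<inter> space borel = B Q n"
      by (auto simp: B_def dist_commute)
    ultimately show ?thesis
      by simp
  qed
  have 2: "{x. iterates_defined f x} = (\<Inter>n. regular_upto f n)"
    by (auto simp: iterates_defined_def regular_upto_def)
  have "{x. shadowing f A x} = {x. iterates_defined f x} \<inter> (\<Inter>Q. \<Union>N. \<Inter>n\<in>{N..}. B Q n)"
  proof (intro set_eqI iffI)
    fix x assume "x \<in> {x. shadowing f A x}"
    then have x: "iterates_defined f x" "\<And>Q. Q > 0 \<Longrightarrow> \<forall>\<^sub>F n in sequentially. x \<in> {x. cmod ((f ^^ n) x) > Q \<or>
        (\<exists>p\<in>forward_orbit f A. dist ((f ^^ n) x) p < 1 / Q)}"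
      by (auto simp: shadowing_def)
    have "\<exists>N. \<forall>n\<ge>N. x \<in> B Q n" for Q
      using x(2)[of "real (Suc Q)"] unfolding eventually_sequentially B_def by simp
    then show "x \<in> {x. iterates_defined f x} \<inter> (\<Inter>Q. \<Union>N. \<Inter>n\<in>{N..}. B Q n)"
      using x(1) by (simp only: Int_iff mem_Collect_eq INT_iff UN_iff atLeast_iff UNIV_I simp_thms Ball_def Bex_def)
  next
    fix x assume "x \<in> {x. iterates_defined f x} \<inter> (\<Inter>Q. \<Union>N. \<Inter>n\<in>{N..}. B Q n)"
    then have x: "iterates_defined f x" "\<And>Q. \<exists>N. \<forall>n\<ge>N. x \<in> B Q n"
      by (simp_all only: Int_iff mem_Collect_eq INT_iff UN_iff atLeast_iff UNIV_I simp_thms Ball_def Bex_def)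
    have "\<exists>N. \<forall>n\<ge>N. cmod ((f ^^ n) x) > Q \<or> (\<exists>p\<in>forward_orbit f A. dist ((f ^^ n) x) p < 1 / Q)" if Q: "Q > 0" for Q
    proof -
      obtain k :: nat where k: "real k \<ge> Q"
        using real_arch_simple by blast
      obtain N where N: "\<And>n. n \<ge> N \<Longrightarrow> x \<in> B k n"
        using x(2) by blast
      have "1 / real (Suc k) \<le> 1 / Q"
        using k Q by (intro divide_left_mono) auto
      have "cmod ((f ^^ n) x) > Q \<or> (\<exists>p\<in>forward_orbit f A. dist ((f ^^ n) x) p < 1 / Q)" if "n \<ge> N" for n
      proof -
        have "cmod ((f ^^ n) x) > real (Suc k) \<or> (\<exists>p\<in>forward_orbit f A. dist ((f ^^ n) x) p < 1 / real (Suc k))"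
          using N[OF that] by (simp only: B_def mem_Collect_eq)
        then show ?thesis
          using k \<open>1 / real (Suc k) \<le> 1 / Q\<close> less_le_trans by fastforce
      qed
      then show ?thesis
        by blast
    qed
    then show "x \<in> {x. shadowing f A x}"
      using x(1) by (simp add: shadowing_def eventually_sequentially)
  qed
  also have "\<dots> \<in> sets borel"
  proof (rule sets.Int)
    show "{x. iterates_defined f x} \<in> sets borel"
      unfolding 2 using borel_regular_upto by (intro sets.countable_INT) auto
    have "(\<Inter>n\<in>{N..}. B Q n) \<in> sets borel" for Q N
      using 1 by (intro sets.countable_INT'') auto
    then have "(\<Union>N. \<Inter>n\<in>{N..}. B Q n) \<in> sets borel" for Q
      by (intro sets.countable_UN image_subsetI) blast
    then show "(\<Inter>Q. \<Union>N. \<Inter>n\<in>{N..}. B Q n) \<in> sets borel"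
      by (intro sets.countable_INT image_subsetI) blast+
  qed
  finally show ?thesis .
qed

end

text \<open>
  In a passage of time \<open>k > 1\<close> the point \<open>f x\<close> is close to some \<open>s \<in> A\<close> and follows its orbit up to time
  \<open>k - 2\<close>. The first \<open>m0\<close> steps need no condition, by continuity of the iterates at \<open>s\<close>.
\<close>

definition passage ::
    "(complex \<Rightarrow> complex) \<Rightarrow> complex set \<Rightarrow> real \<Rightarrow> nat \<Rightarrow> real \<Rightarrow> complex \<Rightarrow> nat \<Rightarrow> bool" where
  "passage f A \<epsilon> m0 K x k \<longleftrightarrow>
     k \<ge> 1 \<and> x \<in> regular_upto f k \<and> cmod ((f ^^ k) x) \<ge> 2 * cmod x \<and>
     (k = 1 \<or> (\<exists>s\<in>A. cmod (f x - s) \<le> exp (- (cmod x powr \<epsilon>)) \<and>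
       (\<forall>j. m0 \<le> j \<and> Suc j < k \<longrightarrow>
          cmod ((f ^^ j) (f x) - (f ^^ j) s) \<le> 2 * cmod ((f ^^ j) s) powr - K)))"

text \<open>The passage times are quantified at each point rather than chosen by a function, so the
  sets are Borel as countable unions and decrease with the stage. The price is that membership in
  all of them does not at once provide a single infinite chain of passages;
  \<open>shadowing_of_survivors\<close> settles this.\<close>

primrec survivors ::
    "(complex \<Rightarrow> complex) \<Rightarrow> complex set \<Rightarrow> real \<Rightarrow> nat \<Rightarrow> real \<Rightarrow> nat \<Rightarrow> complex set" where
  "survivors f A \<epsilon> m0 K 0 = UNIV"
| "survivors f A \<epsilon> m0 K (Suc n) =
     {x. \<exists>k. passage f A \<epsilon> m0 K x k \<and> (f ^^ k) x \<in> survivors f A \<epsilon> m0 K n}"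

lemma survivors_Suc_subset: "survivors f A \<epsilon> m0 K (Suc n) \<subseteq> survivors f A \<epsilon> m0 K n"
  by (induction n) auto

lemma decseq_survivors: "decseq (survivors f A \<epsilon> m0 K)"
  using survivors_Suc_subset by (rule decseq_SucI)

locale shadow_setting =
  fixes f :: "complex \<Rightarrow> complex" and A :: "complex set" and \<epsilon> :: real
  assumes mero: "f nicely_meromorphic_on UNIV"
    and finA: "finite A"
    and eps: "\<epsilon> > 0"
    and iter_A: "\<And>s. s \<in> A \<Longrightarrow> iterates_defined f s"
    and escape_A: "\<And>s. s \<in> A \<Longrightarrow> filterlim (\<lambda>m. (f ^^ m) s) at_infinity sequentially"
begin

lemma escape_norm: "s \<in> A \<Longrightarrow> filterlim (\<lambda>m. cmod ((f ^^ m) s)) at_top sequentially"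
  by (rule filterlim_at_infinity_imp_norm_at_top[OF escape_A])

lemma borel_passage: "{x. passage f A \<epsilon> m0 K x k} \<in> sets borel"
proof -
  note [measurable] = borel_measurable_nicely_meromorphic[OF mero] borel_measurable_iterate[OF mero]
    borel_regular_upto[OF mero]
  define C where "C s = {x. cmod (f x - s) \<le> exp (- (cmod x powr \<epsilon>)) \<and>
       (\<forall>j\<in>{m0..<k-1}. cmod ((f ^^ j) (f x) - (f ^^ j) s) \<le> 2 * cmod ((f ^^ j) s) powr - K)}" for s
  have C: "C s \<in> sets borel" for s
  proof -
    have "(\<lambda>x. (f ^^ j) (f x)) \<in> borel_measurable borel" for j
      using measurable_compose[OF borel_measurable_nicely_meromorphic[OF mero] borel_measurable_iterate[OF mero]] .
    note [measurable] = this
    have "C s = {x. cmod (f x - s) \<le> exp (- (cmod x powr \<epsilon>))} \<inter>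
       (\<Inter>j\<in>{m0..<k-1}. {x. cmod ((f ^^ j) (f x) - (f ^^ j) s) \<le> 2 * cmod ((f ^^ j) s) powr - K})"
      by (auto simp: C_def)
    also have "\<dots> \<in> sets borel"
      by (intro sets.Int sets.countable_INT'') (measurable, auto)
    finally show ?thesis .
  qed
  have D: "{x. cmod ((f ^^ k) x) \<ge> 2 * cmod x} \<in> sets borel"
    by measurable
  have "{x. passage f A \<epsilon> m0 K x k} = (if k \<ge> 1 then regular_upto f k \<inter> {x. cmod ((f ^^ k) x) \<ge> 2 * cmod x} \<inter>
      (if k = 1 then UNIV else (\<Union>s\<in>A. C s)) else {})"
    by (auto simp: passage_def C_def Ball_def less_diff_conv)
  also have "\<dots> \<in> sets borel"
    using C D finA borel_regular_upto[OF mero] by (auto intro!: sets.Int sets.finite_UN)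
  finally show ?thesis .
qed

lemma borel_survivors: "survivors f A \<epsilon> m0 K n \<in> sets borel"
proof (induction n)
  case (Suc n)
  have "survivors f A \<epsilon> m0 K (Suc n) = (\<Union>k. {x. passage f A \<epsilon> m0 K x k} \<inter> ((f ^^ k) -` survivors f A \<epsilon> m0 K n \<inter> space borel))"
    by auto
  also have "\<dots> \<in> sets borel"
    by (intro sets.countable_UN image_subsetI sets.Int borel_passage measurable_sets[OF borel_measurable_iterate[OF mero]] Suc)
  finally show ?case .
qed simp

definition near_limit :: "real \<Rightarrow> complex \<Rightarrow> bool" where
  "near_limit Q w \<longleftrightarrow> cmod w > Q \<or> (\<exists>p\<in>forward_orbit f A. dist w p < 1 / Q)"

lemma shadowing_iff:
  "shadowing f A x \<longleftrightarrow> iterates_defined f x \<and> (\<forall>Q>0. \<forall>\<^sub>F n in sequentially. near_limit Q ((f ^^ n) x))"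
  by (simp add: shadowing_def near_limit_def)

lemma eventually_tolerance:
  assumes "s \<in> A" "Q > 0" "K > 0"
  shows "\<forall>\<^sub>F j in sequentially. 2 * cmod ((f ^^ j) s) powr - K < 1 / Q"
proof -
  have "((\<lambda>t::real. 2 * t powr - K) \<longlongrightarrow> 0) at_top"
    using assms by real_asymp
  then have "\<forall>\<^sub>F t::real in at_top. 2 * t powr - K < 1 / Q"
    using assms by (intro order_tendstoD) auto
  then show ?thesis
    using escape_norm[OF assms(1)] by (rule eventually_compose_filterlim)
qed

lemma near_limit_orbit:
  assumes "s \<in> A" "dist w ((f ^^ j) s) < 1 / Q"
  shows "near_limit Q w"
  using assms unfolding near_limit_def forward_orbit_def by blast

text \<open>Three ranges of time: at time 0 the point itself is large; for finitely many early times
  the iterates are continuous at \<open>s\<close> and \<open>f x\<close> is exponentially close to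
  \<open>s\<close>; afterwards the tolerance \<open>2 |f^j s|^(-K)\<close> is below
  \<open>1 / Q\<close>, since the orbit of \<open>s\<close> escapes. The cut between the last two
  does not depend on \<open>k\<close>, so \<open>R\<close> is uniform.\<close>

lemma passage_near_limit:
  assumes Q: "Q > 0" and K: "K > 0"
  shows "\<exists>R. \<forall>x k i. passage f A \<epsilon> m0 K x k \<longrightarrow> cmod x \<ge> R \<longrightarrow> i < k \<longrightarrow> near_limit Q ((f ^^ i) x)"
proof -
  have "\<forall>s\<in>A. \<exists>j0. \<forall>j\<ge>j0. 2 * cmod ((f ^^ j) s) powr - K < 1 / Q"
    using eventually_tolerance[OF _ Q K] by (auto simp: eventually_sequentially)
  then obtain j0 where j0: "\<And>s j. s \<in> A \<Longrightarrow> j \<ge> j0 s \<Longrightarrow> 2 * cmod ((f ^^ j) s) powr - K < 1 / Q"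
    by metis
  have "\<exists>d>0. \<forall>u. dist u s < d \<longrightarrow> (\<forall>j\<in>{..<max m0 (j0 s)}. dist ((f ^^ j) u) ((f ^^ j) s) < 1 / Q)" if s: "s \<in> A" for s
  proof -
    have "\<forall>\<^sub>F u in nhds s. dist ((f ^^ j) u) ((f ^^ j) s) < 1 / Q" for j
    proof -
      have sr: "s \<in> regular_upto f j"
        using iter_A[OF s] by (simp add: regular_upto_def iterates_defined_def)
      have "isCont (f ^^ j) s"
        using continuous_on_interior[OF holomorphic_on_imp_continuous_on[OF regular_upto_props(2)[OF mero]]]
          sr interior_open[OF regular_upto_props(1)[OF mero]] by blast
      then have "((f ^^ j) \<longlongrightarrow> (f ^^ j) s) (nhds s)"
        by (simp add: isCont_def tendsto_at_iff_tendsto_nhds)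
      then show ?thesis
        using Q by (intro tendstoD) auto
    qed
    then have "\<forall>\<^sub>F u in nhds s. \<forall>j\<in>{..<max m0 (j0 s)}. dist ((f ^^ j) u) ((f ^^ j) s) < 1 / Q"
      by (intro eventually_ball_finite) auto
    then show ?thesis
      by (simp add: eventually_nhds_metric)
  qed
  then obtain d where d: "\<And>s. s \<in> A \<Longrightarrow> d s > 0"
    "\<And>s u j. s \<in> A \<Longrightarrow> dist u s < d s \<Longrightarrow> j < max m0 (j0 s) \<Longrightarrow> dist ((f ^^ j) u) ((f ^^ j) s) < 1 / Q"
    by (metis lessThan_iff)
  have "((\<lambda>t::real. exp (- (t powr \<epsilon>))) \<longlongrightarrow> 0) at_top"
    using eps by real_asymp
  then have "\<forall>\<^sub>F t::real in at_top. \<forall>s\<in>A. exp (- (t powr \<epsilon>)) < d s"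
    using finA d(1) by (intro eventually_ball_finite) (auto intro: order_tendstoD)
  then obtain R0 where R0: "\<And>t s. t \<ge> R0 \<Longrightarrow> s \<in> A \<Longrightarrow> exp (- (t powr \<epsilon>)) < d s"
    by (auto simp: eventually_at_top_linorder)
  show ?thesis
  proof (intro exI[of _ "max R0 (Q + 1)"] allI impI)
    fix x k i assume p: "passage f A \<epsilon> m0 K x k" and x: "max R0 (Q + 1) \<le> cmod x" and i: "i < k"
    show "near_limit Q ((f ^^ i) x)"
    proof (cases i)
      case 0
      then show ?thesis
        using x by (simp add: near_limit_def)
    next
      case (Suc j)
      then obtain s where s: "s \<in> A" "cmod (f x - s) \<le> exp (- (cmod x powr \<epsilon>))"
        "\<And>j. m0 \<le> j \<Longrightarrow> Suc j < k \<Longrightarrow> cmod ((f ^^ j) (f x) - (f ^^ j) s) \<le> 2 * cmod ((f ^^ j) s) powr - K"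
        using p i by (auto simp: passage_def)
      have eq: "(f ^^ i) x = (f ^^ j) (f x)"
        by (simp add: Suc funpow_swap1)
      show ?thesis
      proof (cases "j < max m0 (j0 s)")
        case True
        have "dist (f x) s < d s"
          using s(2) R0[of "cmod x" s] s(1) x by (simp add: dist_norm)
        then show ?thesis
          unfolding eq using d(2) s(1) True near_limit_orbit by blast
      next
        case False
        then have "cmod ((f ^^ j) (f x) - (f ^^ j) s) < 1 / Q"
          using s(3)[of j] j0[OF s(1), of j] i Suc by fastforce
        then show ?thesis
          unfolding eq using near_limit_orbit[OF s(1), of _ j] by (simp add: dist_norm)
      qed
    qed
  qed
qed

text \<open>Pigeonhole: \<open>A\<close> is finite, so one \<open>s\<close> serves infinitely many
  passage times, and a passage of time \<open>k\<close> controls every \<open>j\<close> with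
  \<open>m0 \<le> j\<close> and \<open>Suc j < k\<close>. The time 1 is set apart since it need not
  carry an \<open>s\<close>.\<close>

lemma shadowing_of_infinite_passages:
  assumes K: "K > 0" and inf: "infinite {k. passage f A \<epsilon> m0 K x k}"
  shows "shadowing f A x"
proof -
  have large: "\<exists>k>n. passage f A \<epsilon> m0 K x k" for n
    using inf by (simp add: infinite_nat_iff_unbounded)
  have it: "iterates_defined f x"
    unfolding iterates_defined_def
  proof
    fix n
    obtain k where "k > n" "passage f A \<epsilon> m0 K x k"
      using large by blast
    then show "\<not> is_pole f ((f ^^ n) x)"
      by (auto simp: passage_def regular_upto_def)
  qed
  define Z where "Z s = {k. \<forall>j. m0 \<le> j \<and> Suc j < k \<longrightarrow>
          cmod ((f ^^ j) (f x) - (f ^^ j) s) \<le> 2 * cmod ((f ^^ j) s) powr - K}" for s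
  have "{k. passage f A \<epsilon> m0 K x k} \<subseteq> insert 1 (\<Union>s\<in>A. Z s)"
    by (auto simp: passage_def Z_def)
  then have "infinite (insert 1 (\<Union>s\<in>A. Z s))"
    using inf infinite_super by blast
  then obtain s where s: "s \<in> A" "infinite (Z s)"
    using finA by auto
  have close: "cmod ((f ^^ j) (f x) - (f ^^ j) s) \<le> 2 * cmod ((f ^^ j) s) powr - K" if "j \<ge> m0" for j
  proof -
    obtain k where "k > Suc j" "k \<in> Z s"
      using s(2) by (auto simp: infinite_nat_iff_unbounded)
    then show ?thesis
      using that by (auto simp: Z_def)
  qed
  have "\<forall>\<^sub>F n in sequentially. near_limit Q ((f ^^ n) x)" if Q: "Q > 0" for Q
  proof -
    have "\<forall>\<^sub>F j in sequentially. near_limit Q ((f ^^ Suc j) x)"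
      using eventually_tolerance[OF s(1) Q K] eventually_ge_at_top[of m0]
    proof eventually_elim
      case (elim j)
      have "cmod ((f ^^ j) (f x) - (f ^^ j) s) < 1 / Q"
        using close[OF elim(2)] elim(1) by linarith
      then show ?case
        using near_limit_orbit[OF s(1), of _ j] by (simp add: dist_norm funpow_swap1)
    qed
    then show ?thesis
      using eventually_sequentially_Suc[of "\<lambda>n. near_limit Q ((f ^^ n) x)"] by blast
  qed
  then show ?thesis
    using it by (simp add: shadowing_iff)
qed

lemma shadowing_pullback:
  assumes "x \<in> regular_upto f k" "shadowing f A ((f ^^ k) x)"
  shows "shadowing f A x"
proof -
  have "iterates_defined f x"
    unfolding iterates_defined_def
  proof
    fix n show "\<not> is_pole f ((f ^^ n) x)"
    proof (cases "n < k")
      case True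
      then show ?thesis
        using assms(1) by (simp add: regular_upto_def)
    next
      case False
      then have "(f ^^ n) x = (f ^^ (n - k)) ((f ^^ k) x)"
        using funpow_add[of "n - k" k f] by (simp add: fun_eq_iff)
      then show ?thesis
        using assms(2) by (simp add: shadowing_def iterates_defined_def)
    qed
  qed
  moreover have "\<forall>\<^sub>F n in sequentially. near_limit Q ((f ^^ n) x)" if Q: "Q > 0" for Q
  proof -
    have "\<forall>\<^sub>F n in sequentially. near_limit Q ((f ^^ n) ((f ^^ k) x))"
      using assms(2) Q by (simp add: shadowing_iff)
    then have "\<forall>\<^sub>F n in sequentially. near_limit Q ((f ^^ (n + k)) x)"
      by (simp add: funpow_add)
    then show ?thesis
      by (simp only: eventually_sequentially_seg[of "\<lambda>n. near_limit Q ((f ^^ n) x)"])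
  qed
  ultimately show ?thesis
    by (simp add: shadowing_iff)
qed

text \<open>
  A point with infinitely many passage times follows one orbit of \<open>A\<close> forever. If there are only finitely
  many, then one of them leads again to a point of all the sets \<open>survivors\<close>.
\<close>

lemma shadowing_of_survivors:
  assumes K: "K > 0" and x: "cmod x \<ge> 1" "\<And>n. x \<in> survivors f A \<epsilon> m0 K n"
  shows "shadowing f A x"
proof (rule ccontr)
  assume neg: "\<not> shadowing f A x"
  let ?S = "survivors f A \<epsilon> m0 K" and ?P = "passage f A \<epsilon> m0 K"
  have step: "\<exists>k. ?P y k \<and> (\<forall>n. (f ^^ k) y \<in> ?S n)" if y: "\<forall>n. y \<in> ?S n" "\<not> shadowing f A y" for y
  proof (rule ccontr)
    assume no: "\<nexists>k. ?P y k \<and> (\<forall>n. (f ^^ k) y \<in> ?S n)"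
    have fin: "finite {k. ?P y k}"
      using shadowing_of_infinite_passages[OF K] y by blast
    have "\<forall>k\<in>{k. ?P y k}. \<exists>n. (f ^^ k) y \<notin> ?S n"
      using no by blast
    then obtain N where N: "\<And>k. ?P y k \<Longrightarrow> (f ^^ k) y \<notin> ?S (N k)"
      by (metis mem_Collect_eq)
    \<comment> \<open>The finitely many passages have a common bound \<open>b\<close> for the stages
      at which their endpoints drop out; a passage witnessing stage \<open>Suc b\<close> ends in
      stage \<open>b\<close>, a contradiction.\<close>
    obtain b where b: "\<And>k. ?P y k \<Longrightarrow> N k \<le> b"
      using finite_imageI[OF fin, of N] by (auto simp: finite_nat_set_iff_bounded_le)
    have "y \<in> ?S (Suc b)"
      using y by blast
    then obtain k where "?P y k" "(f ^^ k) y \<in> ?S b"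
      by auto
    then show False
      using N b decseqD[OF decseq_survivors] by blast
  qed
  \<comment> \<open>Failure to shadow is carried along the chain by
    \<open>shadowing_pullback\<close>, which is what lets \<open>step\<close> be applied again. The
    moduli double, so late starting points are as large as \<open>passage_near_limit\<close>
    requires.\<close>
  have "\<exists>y. \<forall>n. ((\<forall>i. y n \<in> ?S i) \<and> \<not> shadowing f A (y n) \<and> cmod (y n) \<ge> 2 ^ n \<and> (n = 0 \<longrightarrow> y n = x)) \<and>
      (\<exists>k. ?P (y n) k \<and> y (Suc n) = (f ^^ k) (y n))"
  proof (rule dependent_nat_choice)
    show "\<exists>y. (\<forall>i. y \<in> ?S i) \<and> \<not> shadowing f A y \<and> cmod y \<ge> 2 ^ 0 \<and> (0 = (0::nat) \<longrightarrow> y = x)"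
      using x neg by auto
  next
    fix y and n :: nat
    assume y: "(\<forall>i. y \<in> ?S i) \<and> \<not> shadowing f A y \<and> cmod y \<ge> 2 ^ n \<and> (n = 0 \<longrightarrow> y = x)"
    then obtain k where k: "?P y k" "\<forall>n. (f ^^ k) y \<in> ?S n"
      using step by blast
    then have "\<not> shadowing f A ((f ^^ k) y)"
      using y shadowing_pullback by (auto simp: passage_def)
    moreover have "cmod ((f ^^ k) y) \<ge> 2 ^ Suc n"
      using k(1) y by (auto simp: passage_def)
    ultimately show "\<exists>y'. ((\<forall>i. y' \<in> ?S i) \<and> \<not> shadowing f A y' \<and> cmod y' \<ge> 2 ^ Suc n \<and> (Suc n = 0 \<longrightarrow> y' = x)) \<and>
        (\<exists>k. ?P y k \<and> y' = (f ^^ k) y)"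
      using k by blast
  qed
  then obtain y where y: "y 0 = x" "\<And>n. cmod (y n) \<ge> 2 ^ n"
    "\<forall>n. \<exists>k. ?P (y n) k \<and> y (Suc n) = (f ^^ k) (y n)"
    by blast
  then obtain k where k: "\<And>n. ?P (y n) (k n)" "\<And>n. y (Suc n) = (f ^^ k n) (y n)"
    by metis
  define t where "t n = sum k {..<n}" for n
  have t_Suc: "t (Suc n) = t n + k n" for n
    by (simp add: t_def)
  have k1: "k n \<ge> 1" for n
    using k(1)[of n] by (simp add: passage_def)
  have ft: "(f ^^ t n) x = y n" for n
  proof (induction n)
    case (Suc n)
    then show ?case
      by (simp add: t_Suc k(2) funpow_add add.commute[of "t n"])
  qed (simp add: y t_def)
  have t_mono: "t m \<le> t n" if "m \<le> n" for m n
    unfolding t_def by (rule sum_mono2) (use that in auto)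
  have t_ge: "n \<le> t n" for n
  proof (induction n)
    case (Suc n)
    then show ?case
      using k1[of n] by (simp add: t_Suc)
  qed simp
  have locate: "\<exists>n. l \<le> n \<and> t n \<le> i \<and> i < t (Suc n)" if "t l \<le> i" for l i
  proof -
    define n where "n = (LEAST n. i < t (Suc n))"
    have n: "i < t (Suc n)"
      unfolding n_def by (rule LeastI[of _ i]) (use t_ge[of "Suc i"] in simp)
    have "t n \<le> i"
    proof (cases n)
      case (Suc m)
      then have "\<not> i < t (Suc m)"
        using not_less_Least[of m "\<lambda>n. i < t (Suc n)"] by (simp add: n_def)
      then show ?thesis
        by (simp add: Suc)
    qed (simp add: t_def)
    moreover have "l \<le> n"
    proof (rule ccontr)
      assume "\<not> l \<le> n"
      then have "t (Suc n) \<le> t l"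
        by (intro t_mono) auto
      then show False
        using n that by simp
    qed
    ultimately show ?thesis
      using n by blast
  qed
  have split: "(f ^^ i) x = (f ^^ (i - t n)) (y n)" if "t n \<le> i" for i n
  proof -
    have "(f ^^ (i - t n)) (y n) = (f ^^ ((i - t n) + t n)) x"
      by (simp only: funpow_add comp_apply ft)
    then show ?thesis
      using that by simp
  qed
  have "iterates_defined f x"
    unfolding iterates_defined_def
  proof
    fix i
    obtain n where n: "t n \<le> i" "i < t (Suc n)"
      using locate[of 0 i] by (auto simp: t_def)
    then have "i - t n < k n"
      by (simp add: t_Suc)
    then show "\<not> is_pole f ((f ^^ i) x)"
      using k(1)[of n] unfolding split[OF n(1)] by (auto simp: passage_def regular_upto_def)
  qed
  moreover have "\<forall>\<^sub>F n in sequentially. near_limit Q ((f ^^ n) x)" if Q: "Q > 0" for Q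
  proof -
    obtain R where R: "\<And>x k i. ?P x k \<Longrightarrow> cmod x \<ge> R \<Longrightarrow> i < k \<Longrightarrow> near_limit Q ((f ^^ i) x)"
      using passage_near_limit[OF Q K] by blast
    obtain l where l: "R < 2 ^ l"
      using real_arch_pow[of 2 R] by auto
    have "near_limit Q ((f ^^ i) x)" if i: "i \<ge> t l" for i
    proof -
      obtain n where n: "l \<le> n" "t n \<le> i" "i < t (Suc n)"
        using locate[OF i] by blast
      have "(2::real) ^ l \<le> 2 ^ n"
        using n(1) by simp
      then have "cmod (y n) \<ge> R"
        using y(2)[of n] l by linarith
      then show ?thesis
        unfolding split[OF n(2)] using R[OF k(1)] n by (simp add: t_Suc)
    qed
    then show ?thesis
      by (auto simp: eventually_sequentially)
  qed
  ultimately show False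
    using neg by (simp add: shadowing_iff)
qed

end

section \<open>Branches of \<open>f\<close> on \<open>G\<close>\<close>

locale escape_setting = shadow_setting f A \<epsilon>
  for f :: "complex \<Rightarrow> complex" and A :: "complex set" and \<epsilon> :: real +
  fixes G :: "complex set" and \<delta>1 \<delta>2 B \<beta> \<tau> :: real
  assumes G_no_poles: "\<And>z. z \<in> G \<Longrightarrow> \<not> is_pole f z"
    and sbar_wd: "sbar_well_defined f A \<epsilon> G"
    and quotient_defined: "\<And>z. z \<in> G \<Longrightarrow> f z \<noteq> sbar f A \<epsilon> z"
    and quotient_lower: "\<And>z. z \<in> G \<Longrightarrow>
          epowr (cmod z) \<delta>1 \<le> ennreal (cmod (deriv f z / (f z - sbar f A \<epsilon> z)))"
    and quotient_upper: "\<And>z. z \<in> G \<Longrightarrow>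
          ennreal (cmod (deriv f z / (f z - sbar f A \<epsilon> z))) \<le> epowr (cmod z) \<delta>2"
    and B: "B > 1"
    and beta: "\<beta> < 1"
    and meas_D: "\<And>D. D \<in> sets lebesgue \<Longrightarrow>
          D \<subseteq> {z. edist_set z (- G) \<le> 2 * epowr (cmod z) (- \<delta>1)} \<Longrightarrow>
          emeasure lebesgue D \<le> ennreal B * ediam D * (SUP z\<in>D. epowr (cmod z) \<beta>)"
    and tau: "\<tau> > \<beta>"
    and discs: "\<And>s. s \<in> A \<Longrightarrow>
          \<forall>\<^sub>F m in sequentially. ball ((f ^^ m) s) (2 * cmod ((f ^^ m) s) powr \<tau>) \<subseteq> G"
    and tau_empty: "A = {} \<Longrightarrow> \<tau> < 1"
begin

lemma holomorphic_on_G: "S \<subseteq> G \<Longrightarrow> f holomorphic_on S"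
  by (rule holomorphic_on_subset[OF holomorphic_on_nonpoles[OF mero]]) (use G_no_poles in auto)

lemma sbar_value_unique:
  "z \<in> G \<Longrightarrow> sbar_value f A \<epsilon> z v \<Longrightarrow> sbar_value f A \<epsilon> z v' \<Longrightarrow> v = v'"
  using sbar_wd by (auto simp: sbar_well_defined_def)

lemma sbar_eq: "z \<in> G \<Longrightarrow> sbar_value f A \<epsilon> z v \<Longrightarrow> sbar f A \<epsilon> z = v"
  unfolding sbar_def using sbar_value_unique by (intro the_equality) blast+

lemma quotient_bounds:
  assumes "z \<in> G" "z \<noteq> 0"
  shows "cmod z powr \<delta>1 \<le> cmod (deriv f z / (f z - sbar f A \<epsilon> z))"
    "cmod (deriv f z / (f z - sbar f A \<epsilon> z)) \<le> cmod z powr \<delta>2"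
  using quotient_lower[OF assms(1)] quotient_upper[OF assms(1)] assms(2)
  by (auto simp: epowr_def ennreal_le_iff)

text \<open>The branches are finitely many relatively closed subsets that cover \<open>S\<close> and
  are pairwise disjoint, so a connected \<open>S\<close> lies in one. The index \<open>None\<close>
  is the branch where \<open>f\<close> is large; it is kept apart from \<open>Some 0\<close>, since
  both give the value 0 when 0 belongs to \<open>A\<close>.\<close>

lemma constant_branch:
  assumes S: "S \<subseteq> G" "connected S" "z \<in> S" "0 \<notin> S"
  shows "(\<forall>x\<in>S. cmod (f x) \<ge> exp (cmod x powr \<epsilon>) \<and> sbar f A \<epsilon> x = 0) \<or>
    (\<exists>s\<in>A. \<forall>x\<in>S. cmod (f x - s) \<le> exp (- (cmod x powr \<epsilon>)) \<and> sbar f A \<epsilon> x = s)"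
proof -
  define cls where "cls i = (case i of None \<Rightarrow> {x\<in>S. cmod (f x) \<ge> exp (cmod x powr \<epsilon>)}
     | Some s \<Rightarrow> {x\<in>S. cmod (f x - s) \<le> exp (- (cmod x powr \<epsilon>))})" for i
  define val where "val i = (case i of None \<Rightarrow> 0 | Some s \<Rightarrow> s)" for i :: "complex option"
  define I where "I = insert None (Some ` A)"
  have sv: "sbar_value f A \<epsilon> x (val i)" if "i \<in> I" "x \<in> cls i" for i x
    using that by (auto simp: I_def cls_def val_def sbar_value_def)
  have contf: "continuous_on S f"
    using holomorphic_on_G[OF S(1)] by (rule holomorphic_on_imp_continuous_on)
  have clo: "closedin (top_of_set S) (cls i)" for i
  proof (cases i)
    case None
    have "continuous_on S (\<lambda>x. cmod (f x) - exp (cmod x powr \<epsilon>))"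
      using contf eps by (intro continuous_intros continuous_on_powr') auto
    from continuous_closedin_preimage[OF this, of "{0..}"]
    have "closedin (top_of_set S) (S \<inter> (\<lambda>x. cmod (f x) - exp (cmod x powr \<epsilon>)) -` {0..})"
      by simp
    moreover have "S \<inter> (\<lambda>x. cmod (f x) - exp (cmod x powr \<epsilon>)) -` {0..} = cls i"
      by (auto simp: None cls_def)
    ultimately show ?thesis
      by simp
  next
    case (Some s)
    have "continuous_on S (\<lambda>x. exp (- (cmod x powr \<epsilon>)) - cmod (f x - s))"
      using contf eps by (intro continuous_intros continuous_on_powr') auto
    from continuous_closedin_preimage[OF this, of "{0..}"]
    have "closedin (top_of_set S) (S \<inter> (\<lambda>x. exp (- (cmod x powr \<epsilon>)) - cmod (f x - s)) -` {0..})"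
      by simp
    moreover have "S \<inter> (\<lambda>x. exp (- (cmod x powr \<epsilon>)) - cmod (f x - s)) -` {0..} = cls i"
      by (auto simp: Some cls_def)
    ultimately show ?thesis
      by simp
  qed
  have cover: "\<exists>i\<in>I. x \<in> cls i" if xS: "x \<in> S" for x
  proof -
    have "\<exists>!v. sbar_value f A \<epsilon> x v"
      using sbar_wd S(1) xS by (auto simp: sbar_well_defined_def)
    then obtain v where "sbar_value f A \<epsilon> x v"
      by blast
    then show ?thesis
      using xS by (auto simp: sbar_value_def I_def cls_def)
  qed
  have disj: "i = j" if ij: "i \<in> I" "j \<in> I" "x \<in> cls i" "x \<in> cls j" for i j x
  proof -
    have x: "x \<in> S" "x \<in> G" "x \<noteq> 0"
      using ij S by (auto simp: cls_def split: option.splits)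
    have v: "val i = val j"
      using sbar_value_unique[OF x(2) sv[OF ij(1,3)] sv[OF ij(2,4)]] .
    \<comment> \<open>At \<open>x = 0\<close> both inequalities could hold, with
      \<open>|f x| = 1\<close>; a positive power makes them contradictory.\<close>
    have "cmod x powr \<epsilon> > 0"
      using x by simp
    then have "\<not> (exp (cmod x powr \<epsilon>) \<le> cmod (f x) \<and> cmod (f x) \<le> exp (- (cmod x powr \<epsilon>)))"
      by (smt (verit) exp_less_mono)
    then show ?thesis
      using v ij(3,4) by (auto simp: cls_def val_def split: option.splits)
  qed
  obtain i where i: "i \<in> I" "z \<in> cls i"
    using cover S(3) by blast
  have "closedin (top_of_set S) (\<Union>j\<in>I - {i}. cls j)"
    using finA clo by (intro closedin_Union) (auto simp: I_def)
  moreover have "cls i \<union> (\<Union>j\<in>I - {i}. cls j) = S"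
  proof
    show "cls i \<union> (\<Union>j\<in>I - {i}. cls j) \<subseteq> S"
      by (auto simp: cls_def split: option.splits)
    show "S \<subseteq> cls i \<union> (\<Union>j\<in>I - {i}. cls j)"
    proof
      fix x assume "x \<in> S"
      then obtain j where "j \<in> I" "x \<in> cls j"
        using cover by blast
      then show "x \<in> cls i \<union> (\<Union>j\<in>I - {i}. cls j)"
        by (cases "j = i") auto
    qed
  qed
  moreover have "cls i \<inter> (\<Union>j\<in>I - {i}. cls j) = {}"
    using disj i(1) by blast
  moreover have "cls i \<noteq> {}"
    using i(2) by blast
  ultimately have "(\<Union>j\<in>I - {i}. cls j) = {}"
    using S(2) clo[of i] unfolding connected_closedin_eq by blast
  then have all: "x \<in> cls i" if "x \<in> S" for x
    using cover that i(1) by blast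
  have sb: "sbar f A \<epsilon> x = val i" if "x \<in> S" for x
    using sbar_eq sv[OF i(1) all[OF that]] that S(1) by blast
  show ?thesis
  proof (cases i)
    case None
    then show ?thesis
      using all sb by (auto simp: cls_def val_def)
  next
    case (Some s)
    then have "s \<in> A"
      using i(1) by (auto simp: I_def)
    then show ?thesis
      using all sb Some by (auto simp: cls_def val_def)
  qed
qed

text \<open>If \<open>\<tau> \<ge> 1\<close>, the discs of (c) exhaust the plane, so
  \<open>G\<close> is everything and \<open>f\<close> is entire with a single branch outside the
  unit disc. Escaping orbits show that it is the large branch, so \<open>f\<close> has a pole at
  infinity and is a polynomial, which cannot grow like \<open>exp (|z|^\<epsilon>)\<close>.\<close>

lemma tau_less_1: "\<tau> < 1"
proof (rule ccontr)
  assume "\<not> \<tau> < 1"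
  then have \<tau>1: "\<tau> \<ge> 1" and "A \<noteq> {}"
    using tau_empty by auto
  then obtain s where s: "s \<in> A"
    by blast
  have large: "\<forall>\<^sub>F m in sequentially. cmod ((f ^^ m) s) > b" for b
    using escape_norm[OF s] by (simp add: filterlim_at_top_dense)
  have G: "x \<in> G" for x
  proof -
    have "\<forall>\<^sub>F m in sequentially. x \<in> G"
      using discs[OF s] large[of "cmod x + 1"]
    proof eventually_elim
      case (elim m)
      let ?w = "(f ^^ m) s"
      have "cmod ?w \<ge> 1"
        using elim(2) norm_ge_zero[of x] by linarith
      then have "cmod ?w powr 1 \<le> cmod ?w powr \<tau>"
        using \<tau>1 by (intro powr_mono) auto
      moreover have "dist ?w x \<le> cmod ?w + cmod x"
        by (simp add: dist_norm norm_triangle_ineq4)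
      ultimately have "x \<in> ball ?w (2 * cmod ?w powr \<tau>)"
        using elim(2) \<open>cmod ?w \<ge> 1\<close> by simp
      then show ?case
        using elim(1) by blast
    qed
    then show ?thesis
      by simp
  qed
  have hol: "f holomorphic_on UNIV"
    by (rule holomorphic_on_G) (use G in auto)
  have conn: "connected (- ball (0::complex) 1)"
    by (rule connected_complement_bounded_convex) auto
  have big: "cmod (f x) \<ge> exp (cmod x powr \<epsilon>)" if "cmod x \<ge> 1" for x
  proof -
    obtain b where b: "\<And>s'. s' \<in> A \<Longrightarrow> cmod s' \<le> b"
      using finite_imp_bounded[OF finA] bounded_iff by metis
    \<comment> \<open>A point of the orbit whose image is farther than 1 from all of
      \<open>A\<close> decides the branch on the whole connected set.\<close>
    have "\<forall>\<^sub>F m in sequentially. cmod ((f ^^ m) s) > 1 \<and> cmod ((f ^^ Suc m) s) > b + 1"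
      using large[of 1] large[of "b + 1"] eventually_sequentially_Suc[of "\<lambda>m. cmod ((f ^^ m) s) > b + 1"]
      by (simp add: eventually_conj_iff)
    then obtain m where m: "cmod ((f ^^ m) s) > 1" "cmod (f ((f ^^ m) s)) > b + 1"
      by (auto simp: eventually_sequentially)
    have "\<not> cmod (f ((f ^^ m) s) - s') \<le> exp (- (cmod ((f ^^ m) s) powr \<epsilon>))" if "s' \<in> A" for s'
    proof -
      have "exp (- (cmod ((f ^^ m) s) powr \<epsilon>)) \<le> 1"
        by simp
      then show ?thesis
        using m(2) b[OF that] norm_triangle_ineq2[of "f ((f ^^ m) s)" s'] by linarith
    qed
    moreover have "(f ^^ m) s \<in> - ball 0 1"
      using m(1) by simp
    ultimately show ?thesis
      using constant_branch[OF _ conn, of "(f ^^ m) s"] G that by fastforce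
  qed
  have "filterlim f at_infinity at_infinity"
  proof (rule filterlim_norm_at_top_imp_at_infinity, rule filterlim_at_top_mono)
    have "filterlim (\<lambda>t::real. exp (t powr \<epsilon>)) at_top at_top"
      using eps by real_asymp
    then show "filterlim (\<lambda>x. exp (cmod x powr \<epsilon>)) at_top at_infinity"
      by (rule filterlim_compose) (rule filterlim_norm_at_top)
    show "\<forall>\<^sub>F x in at_infinity. exp (cmod x powr \<epsilon>) \<le> cmod (f x)"
      using big eventually_at_infinity by blast
  qed
  then have "((inverse \<circ> f) \<longlongrightarrow> 0) at_infinity"
    unfolding comp_def by (rule tendsto_inverse_0[THEN filterlim_compose])
  from pole_at_infinity[OF hol this] obtain a n where fa: "\<And>z. f z = (\<Sum>i\<le>n. a i * z ^ i)"
    by blast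
  define C where "C = (\<Sum>i\<le>n. cmod (a i))"
  have "exp (t powr \<epsilon>) \<le> C * t ^ n" if t: "t \<ge> 1" for t :: real
  proof -
    have "exp (t powr \<epsilon>) \<le> cmod (f (of_real t))"
      using big[of "of_real t"] t by simp
    also have "\<dots> \<le> (\<Sum>i\<le>n. cmod (a i * of_real t ^ i))"
      unfolding fa by (rule norm_sum)
    also have "\<dots> \<le> (\<Sum>i\<le>n. cmod (a i) * t ^ n)"
      using t by (intro sum_mono) (auto simp: norm_mult norm_power intro!: mult_left_mono power_increasing)
    finally show ?thesis
      by (simp add: C_def sum_distrib_right)
  qed
  moreover have "\<forall>\<^sub>F t::real in at_top. exp (t powr \<epsilon>) > C * t ^ n"
    using eps by real_asymp
  then have "\<forall>\<^sub>F t::real in at_top. exp (t powr \<epsilon>) > C * t ^ n \<and> t \<ge> 1"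
    using eventually_ge_at_top[of "1::real"] by (rule eventually_conj)
  ultimately show False
    using eventually_happens'[of "at_top :: real filter"] by fastforce
qed

text \<open>
  Powers of \<open>t = \<bar>z\<bar>\<close>: logarithmic derivatives lie between \<open>t\<^sup>-\<^sup>\<kappa>\<close> and \<open>t\<^sup>\<kappa>\<close> on a disc of radius \<open>t\<^sup>-\<^sup>L\<^sup>0\<close>,
  so that \<open>log_derivative_distortion\<close> gives near-linearity on discs of radius \<open>t\<^sup>-\<^sup>K\<close> and \<open>t\<^sup>-\<^sup>L\<close>. The product
  of the derivatives along an orbit of \<open>A\<close> up to a point \<open>w\<close> is at most \<open>\<bar>w\<bar>\<^sup>1\<^sup>+\<^sup>\<gamma>\<close>.
\<close>

definition "\<gamma> = (1 - \<tau>) / 2"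
definition "\<kappa>0 = 1 + \<bar>\<delta>1\<bar> + \<bar>\<delta>2\<bar>"
definition "\<kappa> = \<kappa>0 + 1"
definition "L0 = \<kappa> + \<bar>\<tau>\<bar> + \<bar>\<delta>1\<bar> + 2"
definition "K = 2 * \<kappa> + L0 + 2"
definition "L = K + 3"

lemma const_pos: "\<gamma> > 0" "\<kappa>0 \<ge> 1" "\<kappa> \<ge> 2" "L0 \<ge> 4" "K \<ge> 10" "L \<ge> 13"
  "L0 \<ge> \<bar>\<delta>1\<bar>" "L0 \<ge> \<bar>\<tau>\<bar> + 2" "L0 \<ge> \<kappa> + 2" "L0 \<ge> \<kappa>0 + 3" "L \<ge> \<bar>\<delta>2\<bar> + 1"
  using tau_less_1 by (auto simp: \<gamma>_def \<kappa>0_def \<kappa>_def L0_def K_def L_def)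

definition good :: "complex \<Rightarrow> bool" where
  "good z \<longleftrightarrow> ball z (cmod z powr - L0) \<subseteq> G"

lemma powr_le_half:
  fixes t a :: real
  assumes "t \<ge> 2" "a \<ge> 1"
  shows "t powr - a \<le> 1 / 2"
proof -
  have "t powr - a \<le> t powr - 1"
    using assms by (intro powr_mono) auto
  also have "\<dots> = 1 / t"
    using assms by (simp add: powr_minus_divide)
  also have "\<dots> \<le> 1 / 2"
    using assms by (intro divide_left_mono) auto
  finally show ?thesis .
qed

text \<open>One \<open>p\<close> serves the whole disc by \<open>constant_branch\<close>. Moduli on
  the disc differ from \<open>|z|\<close> by a factor at most 2, and the summand 1 in
  \<open>\<kappa>0\<close> absorbs the factor \<open>2 powr \<bar>d\<bar>\<close> for both
  exponents.\<close>

lemma good_log_derivative: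
  assumes z: "good z" "cmod z \<ge> 2" "cmod z \<ge> 2 powr \<kappa>0"
  shows "\<exists>p. (p = 0 \<and> (\<forall>x\<in>ball z (cmod z powr - L0). cmod (f x) \<ge> exp (cmod x powr \<epsilon>)) \<or>
      p \<in> A \<and> (\<forall>x\<in>ball z (cmod z powr - L0). cmod (f x - p) \<le> exp (- (cmod x powr \<epsilon>)))) \<and>
    (\<forall>x\<in>ball z (cmod z powr - L0). f x \<noteq> p \<and>
      cmod z powr - \<kappa>0 \<le> cmod (deriv f x / (f x - p)) \<and> cmod (deriv f x / (f x - p)) \<le> cmod z powr \<kappa>0)"
proof -
  let ?D = "ball z (cmod z powr - L0)"
  have R: "cmod z powr - L0 \<le> 1 / 2" "cmod z powr - L0 > 0"
    using powr_le_half[OF z(2), of L0] const_pos z by auto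
  have norm: "cmod x \<ge> cmod z / 2" "cmod x \<le> 2 * cmod z" "cmod x \<ge> 1" if "x \<in> ?D" for x
  proof -
    have "cmod (z - x) \<le> 1/2"
      using that R by (simp add: dist_norm)
    then show "cmod x \<ge> cmod z / 2" "cmod x \<le> 2 * cmod z" "cmod x \<ge> 1"
      using norm_triangle_ineq2[of z x] norm_triangle_ineq2[of x z] z(2)
      by (auto simp: norm_minus_commute)
  qed
  have D: "?D \<subseteq> G"
    using z(1) by (simp add: good_def)
  have zD: "z \<in> ?D"
    using R by simp
  have "0 \<notin> ?D"
    using norm(3)[of 0] by auto
  from constant_branch[OF D connected_ball zD this]
  obtain p where p: "p = 0 \<and> (\<forall>x\<in>?D. cmod (f x) \<ge> exp (cmod x powr \<epsilon>)) \<or>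
      p \<in> A \<and> (\<forall>x\<in>?D. cmod (f x - p) \<le> exp (- (cmod x powr \<epsilon>)))" "\<And>x. x \<in> ?D \<Longrightarrow> sbar f A \<epsilon> x = p"
    by metis
  show ?thesis
  proof (rule exI[of _ p], rule conjI[OF p(1)], rule ballI)
    fix x assume x: "x \<in> ?D"
    have xG: "x \<in> G" "x \<noteq> 0"
      using D x norm(3)[OF x] by auto
    note q = quotient_bounds[OF xG, unfolded p(2)[OF x]]
    have bound: "cmod x powr \<bar>d\<bar> \<le> cmod z powr \<kappa>0" if d: "\<bar>d\<bar> + 1 \<le> \<kappa>0" for d
    proof -
      have "cmod x powr \<bar>d\<bar> \<le> (2 * cmod z) powr \<bar>d\<bar>"
        using norm[OF x] by (intro powr_mono2) auto
      also have "\<dots> = 2 powr \<bar>d\<bar> * cmod z powr \<bar>d\<bar>"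
        by (simp add: powr_mult)
      also have "\<dots> \<le> cmod z * cmod z powr \<bar>d\<bar>"
      proof (rule mult_right_mono)
        have "2 powr \<bar>d\<bar> \<le> 2 powr \<kappa>0"
          using d by (intro powr_mono) auto
        then show "2 powr \<bar>d\<bar> \<le> cmod z"
          using z(3) by linarith
      qed simp
      also have "\<dots> = cmod z powr (1 + \<bar>d\<bar>)"
        using z(2) by (simp add: powr_add)
      also have "\<dots> \<le> cmod z powr \<kappa>0"
        using d z(2) by (intro powr_mono) auto
      finally show ?thesis .
    qed
    have "cmod x powr \<delta>2 \<le> cmod x powr \<bar>\<delta>2\<bar>"
      using norm[OF x] by (intro powr_mono) auto
    also have "\<dots> \<le> cmod z powr \<kappa>0"
      by (rule bound) (simp add: \<kappa>0_def)
    finally have up: "cmod x powr \<delta>2 \<le> cmod z powr \<kappa>0" .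
    have "cmod z powr - \<kappa>0 = 1 / cmod z powr \<kappa>0"
      by (simp add: powr_minus_divide)
    also have "\<dots> \<le> 1 / cmod x powr \<bar>\<delta>1\<bar>"
      using bound[of \<delta>1] xG(2) z(2) by (intro divide_left_mono mult_pos_pos) (auto simp: \<kappa>0_def)
    also have "\<dots> = cmod x powr - \<bar>\<delta>1\<bar>"
      by (simp add: powr_minus_divide)
    also have "\<dots> \<le> cmod x powr \<delta>1"
      using norm[OF x] by (intro powr_mono) auto
    finally have "cmod z powr - \<kappa>0 \<le> cmod x powr \<delta>1" .
    then show "f x \<noteq> p \<and> cmod z powr - \<kappa>0 \<le> cmod (deriv f x / (f x - p)) \<and> cmod (deriv f x / (f x - p)) \<le> cmod z powr \<kappa>0"
      using q up quotient_defined[OF xG(1)] p(2)[OF x] by auto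
  qed
qed

end

section \<open>Behaviour of \<open>f\<close> near the orbits of \<open>A\<close>\<close>

context escape_setting
begin

text \<open>Conditions for one step along an orbit of \<open>A\<close>. The derivative varies only
  by the relative error \<open>1 / |w|\<close> and is at least 2, so that distances to the orbit
  grow. The last inequality makes the bound \<open>|w|^(1+\<gamma>)\<close> on products of
  derivatives reproduce itself: multiplied by \<open>2 |f' w| \<le> 2 |f w| |w|^\<kappa>\<close> it
  is at most \<open>|f w|^(1+\<gamma>)\<close>.\<close>

definition tame :: "complex \<Rightarrow> bool" where
  "tame w \<longleftrightarrow> cmod w \<ge> 512 \<and> exp (cmod w powr \<epsilon>) \<le> cmod (f w) \<and> 2 * cmod w \<le> cmod (f w) \<and>
     (\<forall>v. cmod (v - w) \<le> 2 * cmod w powr - K \<longrightarrow>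
        \<not> is_pole f v \<and> cmod (deriv f v - deriv f w) \<le> cmod (deriv f w) / cmod w) \<and>
     2 \<le> cmod (deriv f w) \<and> cmod (deriv f w) \<le> cmod (f w) * cmod w powr \<kappa> \<and>
     2 * cmod w powr (1 + \<gamma> + \<kappa>) \<le> cmod (f w) powr \<gamma>"

text \<open>Since \<open>f w\<close> is far from \<open>A\<close>, the large branch holds near
  \<open>w\<close>, and \<open>exp (|w|^\<epsilon>)\<close> beats every power of \<open>|w|\<close>
  in \<open>tame\<close>.\<close>

lemma tame_of_good:
  "\<exists>M. \<forall>w. good w \<longrightarrow> cmod w \<ge> M \<longrightarrow> (\<forall>s\<in>A. cmod (f w - s) > 1) \<longrightarrow> tame w"
proof -
  note c = const_pos
  have "\<forall>\<^sub>F t::real in at_top. 2 \<le> exp (t powr \<epsilon>) * t powr - \<kappa>0"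
    using eps by real_asymp
  moreover have "\<forall>\<^sub>F t::real in at_top. 2 * t powr (1 + \<gamma> + \<kappa>) \<le> exp (\<gamma> * t powr \<epsilon>)"
    using eps c by real_asymp
  moreover have "\<forall>\<^sub>F t::real in at_top. 2 * t \<le> exp (t powr \<epsilon>)"
    using eps by real_asymp
  ultimately have "\<forall>\<^sub>F t::real in at_top. t \<ge> 512 \<and> t \<ge> 2 powr \<kappa>0 \<and> 2 \<le> exp (t powr \<epsilon>) * t powr - \<kappa>0 \<and>
      2 * t powr (1 + \<gamma> + \<kappa>) \<le> exp (\<gamma> * t powr \<epsilon>) \<and> 2 * t \<le> exp (t powr \<epsilon>)"
    using eventually_ge_at_top[of "512::real"] eventually_ge_at_top[of "2 powr \<kappa>0"]
    by eventually_elim auto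
  then obtain M where M: "\<And>t. t \<ge> M \<Longrightarrow> t \<ge> 512 \<and> t \<ge> 2 powr \<kappa>0 \<and> 2 \<le> exp (t powr \<epsilon>) * t powr - \<kappa>0 \<and>
      2 * t powr (1 + \<gamma> + \<kappa>) \<le> exp (\<gamma> * t powr \<epsilon>) \<and> 2 * t \<le> exp (t powr \<epsilon>)"
    by (auto simp: eventually_at_top_linorder)
  have "tame w" if w: "good w" "cmod w \<ge> M" "\<forall>s\<in>A. cmod (f w - s) > 1" for w
  proof -
    define t where "t = cmod w"
    note t = M[OF w(2), folded t_def]
    let ?D = "ball w (t powr - L0)"
    have tpos: "t > 0"
      using t by linarith
    have "cmod w \<ge> 2" "cmod w \<ge> 2 powr \<kappa>0"
      using t by (auto simp: t_def)
    from good_log_derivative[OF w(1) this]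
    obtain p where p: "p = 0 \<and> (\<forall>x\<in>?D. cmod (f x) \<ge> exp (cmod x powr \<epsilon>)) \<or>
        p \<in> A \<and> (\<forall>x\<in>?D. cmod (f x - p) \<le> exp (- (cmod x powr \<epsilon>)))"
      "\<And>x. x \<in> ?D \<Longrightarrow> f x \<noteq> p \<and>
        t powr - \<kappa>0 \<le> cmod (deriv f x / (f x - p)) \<and> cmod (deriv f x / (f x - p)) \<le> t powr \<kappa>0"
      unfolding t_def by blast
    have wD: "w \<in> ?D"
      using tpos by simp
    have p0: "p = 0"
    proof (rule ccontr)
      assume "p \<noteq> 0"
      then have "p \<in> A" "cmod (f w - p) \<le> exp (- (cmod w powr \<epsilon>))"
        using p(1) wD by auto
      moreover have "exp (- (cmod w powr \<epsilon>)) \<le> 1"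
        by simp
      ultimately show False
        using w(3) by fastforce
    qed
    have large: "exp (t powr \<epsilon>) \<le> cmod (f w)"
    proof (rule ccontr)
      assume "\<not> ?thesis"
      then have "p \<in> A" "cmod (f w - p) \<le> exp (- (cmod w powr \<epsilon>))"
        using p(1) wD by (auto simp: t_def)
      moreover have "exp (- (cmod w powr \<epsilon>)) \<le> 1"
        by simp
      ultimately show False
        using w(3) by fastforce
    qed
    have sub: "?D \<subseteq> G"
      using w(1) by (simp add: good_def t_def)
    have Ru: "t powr - L0 * t powr \<kappa>0 \<le> 1 / 2"
    proof -
      have "t powr - L0 * t powr \<kappa>0 = t powr - (L0 - \<kappa>0)"
        using tpos by (simp add: algebra_simps flip: powr_add)
      then show ?thesis
        using powr_le_half[of t "L0 - \<kappa>0"] t c by simp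
    qed
    have KL: "2 * t powr - K \<le> t powr - L0 / 2"
    proof -
      have "t powr - K \<le> t powr (- L0 + - 1)"
        using t c by (intro powr_mono) (auto simp: K_def)
      also have "\<dots> = t powr - L0 / t"
        using tpos by (simp only: powr_add) (simp add: powr_minus field_simps)
      also have "\<dots> \<le> t powr - L0 / 4"
        using t by (intro divide_left_mono) auto
      finally show ?thesis
        by simp
    qed
    have dist: "cmod (deriv f v - deriv f w) \<le> cmod (deriv f w) / t" if v: "cmod (v - w) \<le> 2 * t powr - K" for v
    proof -
      have "cmod (deriv f v - deriv f w) \<le>
          16 * t powr \<kappa>0 / (t powr - L0 * t powr - \<kappa>0) * cmod (v - w) * cmod (deriv f w)"
        by (rule log_derivative_distortion_deriv[OF holomorphic_on_G[OF sub]])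
          (use p(2) p0 Ru tpos v KL in auto)
      also have "\<dots> \<le> 16 * t powr \<kappa>0 / (t powr - L0 * t powr - \<kappa>0) * (2 * t powr - K) * cmod (deriv f w)"
        using v tpos by (intro mult_right_mono mult_left_mono) auto
      also have "16 * t powr \<kappa>0 / (t powr - L0 * t powr - \<kappa>0) * (2 * t powr - K) = 32 * t powr (\<kappa>0 + L0 + \<kappa>0 + - K)"
        using tpos by (simp only: powr_add) (simp add: powr_minus field_simps)
      \<comment> \<open>The exponent equals \<open>-4\<close> by the choice of \<open>K\<close>; of
        the two powers kept, one outweighs 32 and the other is the relative error
        \<open>1 / t\<close>.\<close>
      also have "\<dots> \<le> 32 * t powr (-2)"
        using t c by (intro mult_left_mono powr_mono) (auto simp: K_def \<kappa>_def)
      also have "\<dots> = 32 / t / t"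
        using tpos by (simp add: powr_minus power2_eq_square field_simps)
      also have "\<dots> \<le> 1 / t"
        using t by (intro divide_right_mono) auto
      finally show ?thesis
        by (simp add: mult_right_mono)
    qed
    have pole: "\<not> is_pole f v" if v: "cmod (v - w) \<le> 2 * t powr - K" for v
    proof -
      have "2 * t powr - K < t powr - L0"
        using KL tpos by (smt (verit) powr_gt_zero field_sum_of_halves)
      then have "v \<in> ?D"
        using v by (simp add: dist_norm norm_minus_commute)
      then show ?thesis
        using sub G_no_poles by blast
    qed
    have fw: "f w \<noteq> 0" "t powr - \<kappa>0 * cmod (f w) \<le> cmod (deriv f w)" "cmod (deriv f w) \<le> t powr \<kappa>0 * cmod (f w)"
      using p(2)[OF wD] p0 by (auto simp: norm_divide field_simps)
    have "2 \<le> t powr - \<kappa>0 * exp (t powr \<epsilon>)"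
      using t by (simp add: mult.commute)
    also have "\<dots> \<le> t powr - \<kappa>0 * cmod (f w)"
      using large by (intro mult_left_mono) auto
    finally have two: "2 \<le> cmod (deriv f w)"
      using fw by linarith
    have "t powr \<kappa>0 * cmod (f w) \<le> t powr \<kappa> * cmod (f w)"
      using t by (intro mult_right_mono powr_mono) (auto simp: \<kappa>_def)
    then have up: "cmod (deriv f w) \<le> cmod (f w) * t powr \<kappa>"
      using fw(3) by (metis mult.commute order_trans)
    have "2 * t powr (1 + \<gamma> + \<kappa>) \<le> exp (\<gamma> * t powr \<epsilon>)"
      using t by simp
    also have "\<dots> = exp (t powr \<epsilon>) powr \<gamma>"
      by (simp add: powr_def)
    also have "\<dots> \<le> cmod (f w) powr \<gamma>"
      using large c by (intro powr_mono2) auto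
    finally have "2 * t powr (1 + \<gamma> + \<kappa>) \<le> cmod (f w) powr \<gamma>" .
    then show ?thesis
      using t large dist pole two up unfolding tame_def t_def by (auto intro: order_trans)
  qed
  then show ?thesis
    by blast
qed

text \<open>Along an escaping orbit the next point is eventually farther than 1 from
  \<open>A\<close>, and the discs of (c) make the points good. Doubling of the moduli makes the
  relative errors \<open>1 / |w|\<close> summable along the orbit.\<close>

lemma orbits_eventually_tame:
  "\<exists>m0. \<forall>s\<in>A. \<forall>j\<ge>m0. tame ((f ^^ j) s) \<and> 512 * 2 ^ (j - m0) \<le> cmod ((f ^^ j) s) \<and>
      ball ((f ^^ j) s) (2 * cmod ((f ^^ j) s) powr \<tau>) \<subseteq> G"
proof -
  obtain M where M: "\<And>w. good w \<Longrightarrow> cmod w \<ge> M \<Longrightarrow> \<forall>s\<in>A. cmod (f w - s) > 1 \<Longrightarrow> tame w"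
    using tame_of_good by blast
  obtain b where b: "\<And>s'. s' \<in> A \<Longrightarrow> cmod s' \<le> b"
    using finite_imp_bounded[OF finA] bounded_iff by metis
  have "\<forall>\<^sub>F j in sequentially. \<forall>s\<in>A. tame ((f ^^ j) s) \<and>
      ball ((f ^^ j) s) (2 * cmod ((f ^^ j) s) powr \<tau>) \<subseteq> G"
  proof (rule eventually_ball_finite[OF finA], rule ballI)
    fix s assume s: "s \<in> A"
    have large: "\<forall>\<^sub>F m in sequentially. cmod ((f ^^ m) s) > b" for b
      using escape_norm[OF s] by (simp add: filterlim_at_top_dense)
    have "\<forall>\<^sub>F m in sequentially. cmod ((f ^^ Suc m) s) > b + 1"
      using large[of "b + 1"] eventually_sequentially_Suc[of "\<lambda>m. cmod ((f ^^ m) s) > b + 1"] by blast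
    then show "\<forall>\<^sub>F j in sequentially. tame ((f ^^ j) s) \<and>
      ball ((f ^^ j) s) (2 * cmod ((f ^^ j) s) powr \<tau>) \<subseteq> G"
      using discs[OF s] large[of "max M 1"]
    proof eventually_elim
      case (elim j)
      let ?w = "(f ^^ j) s"
      have "cmod ?w powr - L0 \<le> cmod ?w powr \<tau>"
        using elim(3) const_pos by (intro powr_mono) auto
      moreover have "cmod ?w powr \<tau> > 0"
        using elim(3) by auto
      ultimately have "ball ?w (cmod ?w powr - L0) \<subseteq> ball ?w (2 * cmod ?w powr \<tau>)"
        by (intro subset_ball) linarith
      then have "good ?w"
        using elim(2) by (simp add: good_def)
      moreover have "cmod (f ?w - s') > 1" if "s' \<in> A" for s'
        using elim(1) b[OF that] norm_triangle_ineq2[of "f ?w" s'] by simp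
      ultimately show ?case
        using M elim by auto
    qed
  qed
  then obtain m0 where m0: "\<And>j s. j \<ge> m0 \<Longrightarrow> s \<in> A \<Longrightarrow> tame ((f ^^ j) s) \<and>
      ball ((f ^^ j) s) (2 * cmod ((f ^^ j) s) powr \<tau>) \<subseteq> G"
    unfolding eventually_sequentially by blast
  have "512 * 2 ^ k \<le> cmod ((f ^^ (m0 + k)) s)" if s: "s \<in> A" for s k
  proof (induction k)
    case 0
    show ?case
      using m0[OF order_refl s] by (simp add: tame_def)
  next
    case (Suc k)
    then show ?case
      using m0[OF _ s, of "m0 + k"] by (simp add: tame_def)
  qed
  then have "512 * 2 ^ (j - m0) \<le> cmod ((f ^^ j) s)" if "s \<in> A" "j \<ge> m0" for s j
    using that by (metis le_add_diff_inverse)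
  then show ?thesis
    using m0 by blast
qed

lemma iterate_regular: "s \<in> A \<Longrightarrow> s \<in> regular_upto f n"
  using iter_A by (simp add: regular_upto_def iterates_defined_def)

lemma isCont_iterate: "s \<in> A \<Longrightarrow> isCont (f ^^ j) s"
  using continuous_on_interior[OF holomorphic_on_imp_continuous_on[OF regular_upto_props(2)[OF mero]]]
    iterate_regular interior_open[OF regular_upto_props(1)[OF mero]] by blast

text \<open>By the identity theorem \<open>f\<close> would otherwise be constant, and the orbit of
  \<open>s\<close> could not escape.\<close>

lemma iterate_nonconstant:
  assumes s: "s \<in> A"
  shows "\<forall>\<^sub>F u in at s. (f ^^ j) u \<noteq> (f ^^ j) s"
proof (induction j)
  case 0
  show ?case
    by (simp add: eventually_at_filter)
next
  case (Suc j)
  let ?w = "(f ^^ j) s"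
  have "\<forall>\<^sub>F v in at ?w. f v \<noteq> f ?w"
  proof (rule ccontr)
    assume "\<not> ?thesis"
    then have "\<exists>\<^sub>F v in at ?w. f v = f ?w"
      by (simp add: frequently_def)
    from frequently_eq_meromorphic_imp_constant[OF this mero] have c: "f v = f ?w" for v
      by auto
    have "\<forall>\<^sub>F n in sequentially. cmod ((f ^^ Suc n) s) > cmod (f ?w)"
      using escape_norm[OF s] eventually_sequentially_Suc[of "\<lambda>m. cmod ((f ^^ m) s) > cmod (f ?w)"]
      by (simp add: filterlim_at_top_dense)
    then obtain n where "cmod ((f ^^ Suc n) s) > cmod (f ?w)"
      using eventually_happens'[OF sequentially_bot] by blast
    then show False
      using c[of "(f ^^ n) s"] by simp
  qed
  moreover have "filterlim (f ^^ j) (at ?w) (at s)"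
    using isCont_iterate[OF s, of j] Suc by (simp add: filterlim_at isCont_def)
  ultimately have "\<forall>\<^sub>F u in at s. f ((f ^^ j) u) \<noteq> f ?w"
    by (rule eventually_compose_filterlim)
  then show ?case
    by simp
qed

text \<open>\<open>s\<close> may be a critical point of \<open>f^m\<close>, so the derivative alone
  need not be bounded below. Writing \<open>f^m u - f^m s = (u - s)^n g u\<close> with
  \<open>g s \<noteq> 0\<close>, the quotient equals \<open>n + (u - s) g' u / g u\<close>, which
  tends to the local order \<open>n \<ge> 1\<close>.\<close>

lemma iterate_local_order:
  assumes s: "s \<in> A"
  shows "\<exists>r>0. \<exists>C\<ge>1. \<forall>u. u \<noteq> s \<longrightarrow> cmod (u - s) < r \<longrightarrow>
    u \<in> regular_upto f m \<and> (f ^^ m) u \<noteq> (f ^^ m) s \<and> cmod ((f ^^ m) u - (f ^^ m) s) \<le> C * cmod (u - s) \<and>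
    1 / 2 \<le> cmod (deriv (f ^^ m) u * (u - s) / ((f ^^ m) u - (f ^^ m) s)) \<and>
    cmod (deriv (f ^^ m) u * (u - s) / ((f ^^ m) u - (f ^^ m) s)) \<le> C"
proof -
  obtain r0 where r0: "r0 > 0" "ball s r0 \<subseteq> regular_upto f m"
    using regular_upto_props(1)[OF mero] iterate_regular[OF s] open_contains_ball by blast
  define h where "h u = (f ^^ m) u - (f ^^ m) s" for u
  have hol: "h holomorphic_on ball s r0"
    unfolding h_def by (intro holomorphic_intros holomorphic_on_subset[OF regular_upto_props(2)[OF mero] r0(2)])
  have nc: "\<not> h constant_on ball s r0"
  proof
    assume "h constant_on ball s r0"
    then have "h u = h s" if "u \<in> ball s r0" for u
      using that r0(1) unfolding constant_on_def by force
    then have eq: "(f ^^ m) u = (f ^^ m) s" if "u \<in> ball s r0" for u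
      using that by (simp add: h_def)
    have "\<forall>\<^sub>F u in at s. u \<in> ball s r0"
      using r0(1) by (intro eventually_at_in_open') auto
    then have "\<forall>\<^sub>F u in at s. False"
      using iterate_nonconstant[OF s, of m] by eventually_elim (use eq in blast)
    then show False
      by simp
  qed
  obtain g r n where g: "0 < n" "0 < r" "ball s r \<subseteq> ball s r0" "g holomorphic_on ball s r"
    "\<And>w. w \<in> ball s r \<Longrightarrow> h w = (w - s) ^ n * g w" "\<And>w. w \<in> ball s r \<Longrightarrow> g w \<noteq> 0"
    using holomorphic_factor_zero_nonconstant[OF hol open_ball connected_ball _ _ nc] r0(1)
    by (metis centre_in_ball h_def diff_self)
  have sr: "s \<in> ball s r"
    using g by simp
  have contg: "isCont g s"
    using holomorphic_on_imp_continuous_on[OF g(4)] continuous_on_interior sr by (metis interior_ball)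
  have "isCont (\<lambda>u. (u - s) * deriv g u / g u) s"
  proof -
    have "isCont (deriv g) s"
      using holomorphic_on_imp_continuous_on[OF holomorphic_deriv[OF g(4) open_ball]] continuous_on_interior sr
      by (metis interior_ball)
    then show ?thesis
      using contg g(6)[OF sr] by (intro continuous_intros) auto
  qed
  then have "((\<lambda>u. (u - s) * deriv g u / g u) \<longlongrightarrow> 0) (nhds s)"
    using tendsto_at_iff_tendsto_nhds[of "\<lambda>u. (u - s) * deriv g u / g u" s] by (simp add: isCont_def)
  from tendstoD[OF this, of "1/2"] have "\<forall>\<^sub>F u in nhds s. cmod ((u - s) * deriv g u / g u) < 1 / 2"
    by (simp add: dist_norm)
  moreover have "\<forall>\<^sub>F u in nhds s. cmod (g u) < cmod (g s) + 1"
  proof -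
    have "((\<lambda>u. cmod (g u)) \<longlongrightarrow> cmod (g s)) (nhds s)"
      using contg by (intro tendsto_norm) (simp add: isCont_def tendsto_at_iff_tendsto_nhds)
    then show ?thesis
      by (rule order_tendstoD) simp
  qed
  moreover have "\<forall>\<^sub>F u in nhds s. u \<in> ball s (min r 1)"
    using g(2) by (intro eventually_nhds_in_open) auto
  ultimately have "\<forall>\<^sub>F u in nhds s. cmod ((u - s) * deriv g u / g u) < 1 / 2 \<and> cmod (g u) < cmod (g s) + 1 \<and> u \<in> ball s (min r 1)"
    by eventually_elim blast
  then obtain d where d: "d > 0" "\<And>u. dist u s < d \<Longrightarrow>
      cmod ((u - s) * deriv g u / g u) < 1 / 2 \<and> cmod (g u) < cmod (g s) + 1 \<and> u \<in> ball s (min r 1)"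
    by (auto simp: eventually_nhds_metric)
  define C where "C = max (cmod (g s) + 1) (real n + 1)"
  have C: "C \<ge> 1"
    by (simp add: C_def)
  have "u \<in> regular_upto f m \<and> (f ^^ m) u \<noteq> (f ^^ m) s \<and> cmod ((f ^^ m) u - (f ^^ m) s) \<le> C * cmod (u - s) \<and>
    1 / 2 \<le> cmod (deriv (f ^^ m) u * (u - s) / ((f ^^ m) u - (f ^^ m) s)) \<and>
    cmod (deriv (f ^^ m) u * (u - s) / ((f ^^ m) u - (f ^^ m) s)) \<le> C"
    if u: "u \<noteq> s" "cmod (u - s) < d" for u
  proof -
    have ud: "cmod ((u - s) * deriv g u / g u) < 1 / 2" "cmod (g u) < cmod (g s) + 1" "u \<in> ball s r" "cmod (u - s) < 1"
      using d(2)[of u] u by (auto simp: dist_norm norm_minus_commute)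
    have reg: "u \<in> regular_upto f m"
      using ud(3) g(3) r0(2) by blast
    have dg: "(g has_field_derivative deriv g u) (at u)"
      using g(4) ud(3) holomorphic_derivI open_ball by blast
    have hu: "(f ^^ m) u - (f ^^ m) s = (u - s) ^ n * g u"
      using g(5)[OF ud(3)] by (simp add: h_def)
    have gu: "g u \<noteq> 0"
      using g(6) ud(3) by blast
    have ne: "(f ^^ m) u \<noteq> (f ^^ m) s"
      using hu gu u(1) by auto
    have "((\<lambda>x. (x - s) ^ n * g x + (f ^^ m) s) has_field_derivative
        (of_nat n * (u - s) ^ (n - 1) * g u + (u - s) ^ n * deriv g u)) (at u)"
      by (rule derivative_eq_intros dg refl)+ (simp add: algebra_simps)
    then have "((f ^^ m) has_field_derivative
        (of_nat n * (u - s) ^ (n - 1) * g u + (u - s) ^ n * deriv g u)) (at u)"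
      by (rule has_field_derivative_transform_within_open[of _ _ _ "ball s r"])
        (use ud(3) g(5) in \<open>auto simp: h_def diff_eq_eq\<close>)
    then have df: "deriv (f ^^ m) u = of_nat n * (u - s) ^ (n - 1) * g u + (u - s) ^ n * deriv g u"
      by (rule DERIV_imp_deriv)
    have pn: "(u - s) ^ n = (u - s) * (u - s) ^ (n - 1)"
      using g(1) by (metis power_minus_mult mult.commute)
    have "deriv (f ^^ m) u * (u - s) / ((f ^^ m) u - (f ^^ m) s) = of_nat n + (u - s) * deriv g u / g u"
      unfolding df hu pn using u(1) gu by (simp add: field_simps)
    then have q: "cmod (deriv (f ^^ m) u * (u - s) / ((f ^^ m) u - (f ^^ m) s) - of_nat n) < 1 / 2"
      using ud(1) by simp
    have "real n \<ge> 1"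
      using g(1) by simp
    then have q2: "1 / 2 \<le> cmod (deriv (f ^^ m) u * (u - s) / ((f ^^ m) u - (f ^^ m) s))"
      "cmod (deriv (f ^^ m) u * (u - s) / ((f ^^ m) u - (f ^^ m) s)) \<le> real n + 1"
      using q norm_triangle_ineq3[of "deriv (f ^^ m) u * (u - s) / ((f ^^ m) u - (f ^^ m) s)" "of_nat n"]
      unfolding norm_of_nat abs_le_iff by linarith+
    have "cmod ((f ^^ m) u - (f ^^ m) s) = cmod (u - s) * (cmod (u - s) ^ (n - 1) * cmod (g u))"
      unfolding hu pn by (simp add: norm_mult norm_power)
    also have "\<dots> \<le> cmod (u - s) * (1 * C)"
      using ud by (intro mult_left_mono mult_mono power_le_one) (auto simp: C_def)
    finally show ?thesis
      using reg ne q2 by (auto simp: C_def mult.commute)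
  qed
  then show ?thesis
    using d(1) C by blast
qed

end

section \<open>Following the orbits of \<open>A\<close>\<close>

context escape_setting
begin

text \<open>With \<open>t = 1 / |w|\<close>, both \<open>|f v - f w|\<close> and
  \<open>|f' v| |v - w|\<close> lie between \<open>(1 - t) P\<close> and \<open>(1 + t) P\<close>.
  The bounds on the quotient come from \<open>(1 - t)/(1 + t) \<ge> 1 - 2t\<close> and
  \<open>(1 + t)/(1 - t) \<le> 1 + 4t\<close> for small \<open>t\<close>.\<close>

lemma tame_step:
  assumes w: "tame w" and v: "v \<noteq> w" "cmod (v - w) \<le> 2 * cmod w powr - K"
  shows "f v \<noteq> f w" "cmod (v - w) \<le> cmod (f v - f w)"
    "cmod (f v - f w) \<le> 2 * cmod (deriv f w) * cmod (v - w)"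
    "1 - 2 / cmod w \<le> cmod (deriv f v * (v - w) / (f v - f w))"
    "cmod (deriv f v * (v - w) / (f v - f w)) \<le> 1 + 4 / cmod w"
proof -
  define t where "t = 1 / cmod w"
  define a where "a = deriv f w"
  define P where "P = cmod a * cmod (v - w)"
  have w512: "cmod w \<ge> 512" and a2: "cmod a \<ge> 2"
    and near: "\<And>v. cmod (v - w) \<le> 2 * cmod w powr - K \<Longrightarrow>
        \<not> is_pole f v \<and> cmod (deriv f v - a) \<le> t * cmod a"
    using w by (auto simp: tame_def a_def t_def)
  have t: "0 < t" "t \<le> 1 / 512"
    using w512 by (auto simp: t_def divide_simps)
  have P: "P > 0"
  proof -
    have "cmod a > 0"
      using a2 by linarith
    then show ?thesis
      using v(1) by (simp add: P_def)
  qed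
  have "cmod (f v - f w - a * (v - w)) \<le> t * cmod a * cmod (v - w)"
  proof (rule nearly_linear[where S = "cball w (2 * cmod w powr - K)" and \<phi>' = "deriv f"])
    fix x assume "x \<in> cball w (2 * cmod w powr - K)"
    then have x: "cmod (x - w) \<le> 2 * cmod w powr - K"
      by (simp add: dist_norm norm_minus_commute)
    then have "(f has_field_derivative deriv f x) (at x)"
      using near[OF x] holomorphic_derivI[OF holomorphic_on_nonpoles[OF mero] open_nonpoles[OF mero]] by blast
    then show "(f has_field_derivative deriv f x) (at x within cball w (2 * cmod w powr - K))"
      by (rule has_field_derivative_at_within)
    show "cmod (deriv f x - a) \<le> t * cmod a"
      using near[OF x] by blast
  qed (use v in \<open>auto simp: dist_norm norm_minus_commute\<close>)
  then have e: "cmod (f v - f w - a * (v - w)) \<le> t * P"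
    by (simp add: P_def)
  have aP: "cmod (a * (v - w)) = P"
    by (simp add: P_def norm_mult)
  have D: "(1 - t) * P \<le> cmod (f v - f w)" "cmod (f v - f w) \<le> (1 + t) * P"
    using e aP norm_triangle_ineq3[of "f v - f w" "a * (v - w)"] by (auto simp: algebra_simps)
  have dv: "(1 - t) * cmod a \<le> cmod (deriv f v)" "cmod (deriv f v) \<le> (1 + t) * cmod a"
    using near[OF v(2)] norm_triangle_ineq3[of "deriv f v" a] by (auto simp: algebra_simps)
  have tP: "(1 - t) * P > 0"
    using t P by simp
  then show ne: "f v \<noteq> f w"
    using D(1) by auto
  have "cmod (v - w) \<le> (1 - t) * cmod a * cmod (v - w)"
  proof -
    have "1 * 1 \<le> (1 - t) * 2"
      using t by simp
    also have "\<dots> \<le> (1 - t) * cmod a"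
      using a2 t by (intro mult_left_mono) auto
    finally have "1 * cmod (v - w) \<le> (1 - t) * cmod a * cmod (v - w)"
      by (intro mult_right_mono) auto
    then show ?thesis
      by simp
  qed
  then show "cmod (v - w) \<le> cmod (f v - f w)"
    using D(1) by (simp add: P_def mult.assoc)
  have "(1 + t) * P \<le> 2 * P"
    using t P by simp
  then show "cmod (f v - f w) \<le> 2 * cmod (deriv f w) * cmod (v - w)"
    using D(2) by (simp add: P_def a_def mult.assoc)
  have q: "cmod (deriv f v * (v - w) / (f v - f w)) = cmod (deriv f v) * cmod (v - w) / cmod (f v - f w)"
    by (simp add: norm_mult norm_divide)
  have num: "(1 - t) * P \<le> cmod (deriv f v) * cmod (v - w)" "cmod (deriv f v) * cmod (v - w) \<le> (1 + t) * P"
    using dv by (auto simp: P_def mult.assoc[symmetric] intro: mult_right_mono)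
  have Dpos: "cmod (f v - f w) > 0"
    using ne by simp
  have "(1 - 2 * t) * cmod (f v - f w) \<le> (1 - 2 * t) * ((1 + t) * P)"
    using D t by (intro mult_left_mono) auto
  also have "\<dots> \<le> (1 - t) * P"
  proof -
    have "(1 - 2 * t) * (1 + t) \<le> 1 - t"
      using t by (simp add: algebra_simps)
    from mult_right_mono[OF this, of P] show ?thesis
      using P by (simp add: mult.assoc)
  qed
  finally have "(1 - 2 * t) * cmod (f v - f w) \<le> cmod (deriv f v) * cmod (v - w)"
    using num by linarith
  then show "1 - 2 / cmod w \<le> cmod (deriv f v * (v - w) / (f v - f w))"
    unfolding q using Dpos by (simp add: t_def pos_le_divide_eq)
  have "(1 + t) * P \<le> (1 + 4 * t) * ((1 - t) * P)"
  proof -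
    have "t * t \<le> t * (1 / 512)"
      using t by (intro mult_left_mono) auto
    then have "1 + t \<le> (1 + 4 * t) * (1 - t)"
      using t by (simp add: algebra_simps)
    from mult_right_mono[OF this, of P] show ?thesis
      using P by (simp add: mult.assoc)
  qed
  also have "\<dots> \<le> (1 + 4 * t) * cmod (f v - f w)"
    using D t by (intro mult_left_mono) auto
  finally have "cmod (deriv f v) * cmod (v - w) \<le> (1 + 4 * t) * cmod (f v - f w)"
    using num by linarith
  then show "cmod (deriv f v * (v - w) / (f v - f w)) \<le> 1 + 4 / cmod w"
    unfolding q using Dpos by (simp add: t_def pos_divide_le_eq)
qed

end

text \<open>\<open>m0\<close> is a time from which all orbits of \<open>A\<close> are tame; before
  it no tameness is known, and \<open>local_order\<close> stands in for it. The constants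
  \<open>r0\<close> and \<open>C0\<close> are common to all points of the finite set
  \<open>A\<close>.\<close>

locale tracked_setting = escape_setting f A \<epsilon> G \<delta>1 \<delta>2 B \<beta> \<tau>
  for f A \<epsilon> G \<delta>1 \<delta>2 B \<beta> \<tau> +
  fixes m0 :: nat and r0 C0 :: real
  assumes orbit: "\<And>s j. s \<in> A \<Longrightarrow> m0 \<le> j \<Longrightarrow> tame ((f ^^ j) s) \<and>
      512 * 2 ^ (j - m0) \<le> cmod ((f ^^ j) s) \<and>
      ball ((f ^^ j) s) (2 * cmod ((f ^^ j) s) powr \<tau>) \<subseteq> G"
    and r0: "r0 > 0" and C0: "C0 \<ge> 1"
    and local_order: "\<And>s u. s \<in> A \<Longrightarrow> u \<noteq> s \<Longrightarrow> cmod (u - s) < r0 \<Longrightarrow>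
      u \<in> regular_upto f m0 \<and> (f ^^ m0) u \<noteq> (f ^^ m0) s \<and>
      cmod ((f ^^ m0) u - (f ^^ m0) s) \<le> C0 * cmod (u - s) \<and>
      1 / 2 \<le> cmod (deriv (f ^^ m0) u * (u - s) / ((f ^^ m0) u - (f ^^ m0) s)) \<and>
      cmod (deriv (f ^^ m0) u * (u - s) / ((f ^^ m0) u - (f ^^ m0) s)) \<le> C0"

lemma (in escape_setting) tracked_setting_exists:
  "\<exists>m0 r0 C0. tracked_setting f A \<epsilon> G \<delta>1 \<delta>2 B \<beta> \<tau> m0 r0 C0"
proof -
  obtain m0 where m0: "\<And>s j. s \<in> A \<Longrightarrow> m0 \<le> j \<Longrightarrow> tame ((f ^^ j) s) \<and>
      512 * 2 ^ (j - m0) \<le> cmod ((f ^^ j) s) \<and>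
      ball ((f ^^ j) s) (2 * cmod ((f ^^ j) s) powr \<tau>) \<subseteq> G"
    using orbits_eventually_tame by blast
  obtain r C where rC: "\<And>s. s \<in> A \<Longrightarrow> r s > 0 \<and> C s \<ge> 1 \<and> (\<forall>u. u \<noteq> s \<longrightarrow> cmod (u - s) < r s \<longrightarrow>
    u \<in> regular_upto f m0 \<and> (f ^^ m0) u \<noteq> (f ^^ m0) s \<and> cmod ((f ^^ m0) u - (f ^^ m0) s) \<le> C s * cmod (u - s) \<and>
    1 / 2 \<le> cmod (deriv (f ^^ m0) u * (u - s) / ((f ^^ m0) u - (f ^^ m0) s)) \<and>
    cmod (deriv (f ^^ m0) u * (u - s) / ((f ^^ m0) u - (f ^^ m0) s)) \<le> C s)"
    using iterate_local_order[of _ m0] by metis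
  define r0 where "r0 = Min (insert 1 (r ` A))"
  define C0 where "C0 = Max (insert 1 (C ` A))"
  have r0: "r0 > 0" "\<And>s. s \<in> A \<Longrightarrow> r0 \<le> r s"
    using finA rC by (auto simp: r0_def)
  have C0: "C0 \<ge> 1" "\<And>s. s \<in> A \<Longrightarrow> C s \<le> C0"
    using finA by (auto simp: C0_def)
  have "tracked_setting f A \<epsilon> G \<delta>1 \<delta>2 B \<beta> \<tau> m0 r0 C0"
  proof (unfold_locales)
    fix s u assume su: "s \<in> A" "u \<noteq> s" "cmod (u - s) < r0"
    have "C s * cmod (u - s) \<le> C0 * cmod (u - s)"
      using C0(2)[OF su(1)] by (intro mult_right_mono) auto
    moreover have "cmod (u - s) < r s"
      using r0(2)[OF su(1)] su(3) by linarith
    ultimately show "u \<in> regular_upto f m0 \<and> (f ^^ m0) u \<noteq> (f ^^ m0) s \<and>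
      cmod ((f ^^ m0) u - (f ^^ m0) s) \<le> C0 * cmod (u - s) \<and>
      1 / 2 \<le> cmod (deriv (f ^^ m0) u * (u - s) / ((f ^^ m0) u - (f ^^ m0) s)) \<and>
      cmod (deriv (f ^^ m0) u * (u - s) / ((f ^^ m0) u - (f ^^ m0) s)) \<le> C0"
      using rC[OF su(1)] su(2) C0(2)[OF su(1)] by (meson order_trans)
  qed (use m0 r0 C0 in blast)+
  then show ?thesis
    by blast
qed

context tracked_setting
begin

text \<open>The factor 2 is slack: the orbit of the centre of a disc stays within the tolerance
  without this factor until escape, and the logarithmic derivative then keeps the whole disc within
  twice the tolerance.\<close>

definition tracks :: "complex \<Rightarrow> complex \<Rightarrow> nat \<Rightarrow> bool" where
  "tracks s u m \<longleftrightarrow> (\<forall>j. m0 \<le> j \<and> j < m \<longrightarrow>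
     cmod ((f ^^ j) u - (f ^^ j) s) \<le> 2 * cmod ((f ^^ j) s) powr - K)"

text \<open>
  The term \<open>(1/2) ^ (m - m0)\<close> in both bounds leaves room for the distortion of the next step, which makes
  the induction close.
\<close>

lemma tracking:
  assumes s: "s \<in> A" and u: "u \<noteq> s" "cmod (u - s) < r0"
    and m: "m0 \<le> m" and tr: "tracks s u m"
  shows "u \<in> regular_upto f m \<and> (f ^^ m) u \<noteq> (f ^^ m) s \<and>
    cmod ((f ^^ m) u - (f ^^ m) s) \<le> C0 * cmod (u - s) * cmod ((f ^^ m) s) powr (1 + \<gamma>) \<and>
    1 / 4 + (1 / 2) ^ (m - m0) / 4 \<le> cmod (deriv (f ^^ m) u * (u - s) / ((f ^^ m) u - (f ^^ m) s)) \<and>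
    cmod (deriv (f ^^ m) u * (u - s) / ((f ^^ m) u - (f ^^ m) s)) \<le> (2 - (1 / 2) ^ (m - m0)) * C0"
  using m tr
proof (induction m rule: dec_induct)
  case base
  have "cmod ((f ^^ m0) s) powr (1 + \<gamma>) \<ge> 1"
    using orbit[OF s order_refl] const_pos by (intro ge_one_powr_ge_zero) (auto simp: tame_def)
  then have "C0 * cmod (u - s) * 1 \<le> C0 * cmod (u - s) * cmod ((f ^^ m0) s) powr (1 + \<gamma>)"
    using C0 by (intro mult_left_mono) auto
  then have "cmod ((f ^^ m0) u - (f ^^ m0) s) \<le> C0 * cmod (u - s) * cmod ((f ^^ m0) s) powr (1 + \<gamma>)"
    using local_order[OF s u] by linarith
  then show ?case
    using local_order[OF s u] by simp
next
  case (step m)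
  define v where "v = (f ^^ m) u"
  define w where "w = (f ^^ m) s"
  define \<theta> :: real where "\<theta> = (1 / 2) ^ (m - m0)"
  have "tracks s u m"
    using step.prems by (auto simp: tracks_def)
  from step.IH[OF this] have IH: "u \<in> regular_upto f m" "v \<noteq> w"
    "cmod (v - w) \<le> C0 * cmod (u - s) * cmod w powr (1 + \<gamma>)"
    "1 / 4 + \<theta> / 4 \<le> cmod (deriv (f ^^ m) u * (u - s) / (v - w))"
    "cmod (deriv (f ^^ m) u * (u - s) / (v - w)) \<le> (2 - \<theta>) * C0"
    by (auto simp: v_def w_def \<theta>_def)
  have near: "cmod (v - w) \<le> 2 * cmod w powr - K"
    using step.prems step.hyps by (simp add: tracks_def v_def w_def)
  have tame: "tame w" and wlarge: "512 * 2 ^ (m - m0) \<le> cmod w"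
    using orbit[OF s step.hyps(1)] by (auto simp: w_def)
  note ts = tame_step[OF tame IH(2) near]
  have \<theta>: "0 < \<theta>" "\<theta> \<le> 1"
    by (auto simp: \<theta>_def power_le_one)
  have Suc_\<theta>: "(1 / 2) ^ (Suc m - m0) = \<theta> / 2"
    using step.hyps(1) by (simp add: \<theta>_def Suc_diff_le)
  have "cmod w > 0"
    using tame by (auto simp: tame_def)
  \<comment> \<open>The doubling from time \<open>m0\<close> on bounds the error
    \<open>1 / |w|\<close> by a multiple of \<open>\<theta>\<close>; the values of
    \<open>\<theta>\<close> at successive steps form a geometric series.\<close>
  have \<theta>w: "1 / cmod w \<le> \<theta> / 512"
  proof -
    have "1 / cmod w \<le> 1 / (512 * 2 ^ (m - m0))"
      using wlarge \<open>cmod w > 0\<close> by (intro divide_left_mono mult_pos_pos) auto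
    then show ?thesis
      by (simp add: \<theta>_def power_divide)
  qed
  have notpole: "\<not> is_pole f v"
    using tame near by (auto simp: tame_def)
  have reg: "u \<in> regular_upto f (Suc m)"
    using IH(1) notpole by (simp add: regular_upto_Suc v_def)
  have "((f ^^ m) has_field_derivative deriv (f ^^ m) u) (at u)"
    using holomorphic_derivI[OF regular_upto_props(2,1)[OF mero]] IH(1) by blast
  moreover have "(f has_field_derivative deriv f v) (at v)"
    using holomorphic_derivI[OF holomorphic_on_nonpoles[OF mero] open_nonpoles[OF mero]] notpole by blast
  ultimately have "(f \<circ> (f ^^ m) has_field_derivative deriv f v * deriv (f ^^ m) u) (at u)"
    unfolding v_def by (intro DERIV_chain)
  then have "deriv (f ^^ Suc m) u = deriv f v * deriv (f ^^ m) u"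
    by (simp add: DERIV_imp_deriv)
  then have "deriv (f ^^ Suc m) u * (u - s) / (f v - f w) =
      (deriv (f ^^ m) u * (u - s) / (v - w)) * (deriv f v * (v - w) / (f v - f w))"
    using IH(2) by simp
  then have q: "cmod (deriv (f ^^ Suc m) u * (u - s) / (f v - f w)) =
      cmod (deriv (f ^^ m) u * (u - s) / (v - w)) * cmod (deriv f v * (v - w) / (f v - f w))"
    by (simp only: norm_mult)
  have th2: "\<theta> * \<theta> \<le> \<theta> * 1"
    using \<theta> by (intro mult_left_mono) auto
  have "(1 / 4 + \<theta> / 4) * (1 - \<theta> / 256) \<le> cmod (deriv (f ^^ m) u * (u - s) / (v - w)) * cmod (deriv f v * (v - w) / (f v - f w))"
    using IH(4) ts(4) \<theta>w \<theta> by (intro mult_mono) auto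
  moreover have "1 / 4 + \<theta> / 2 / 4 \<le> (1 / 4 + \<theta> / 4) * (1 - \<theta> / 256)"
    using th2 \<theta> by (simp add: algebra_simps)
  ultimately have low: "1 / 4 + \<theta> / 2 / 4 \<le> cmod (deriv (f ^^ Suc m) u * (u - s) / (f v - f w))"
    using q by linarith
  have "cmod (deriv (f ^^ m) u * (u - s) / (v - w)) * cmod (deriv f v * (v - w) / (f v - f w)) \<le>
      ((2 - \<theta>) * C0) * (1 + \<theta> / 128)"
    using IH(5) ts(5) \<theta>w \<theta> C0 by (intro mult_mono) auto
  also have "\<dots> = ((2 - \<theta>) * (1 + \<theta> / 128)) * C0"
    by simp
  also have "\<dots> \<le> (2 - \<theta> / 2) * C0"
    using \<theta> C0 th2 by (intro mult_right_mono) (auto simp: algebra_simps)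
  finally have up: "cmod (deriv (f ^^ Suc m) u * (u - s) / (f v - f w)) \<le> (2 - \<theta> / 2) * C0"
    using q by simp
  \<comment> \<open>The last clause of \<open>tame\<close> pays for the factor
    \<open>2 |f' w|\<close>.\<close>
  have "cmod (f v - f w) \<le> 2 * cmod (deriv f w) * cmod (v - w)"
    by (rule ts(3))
  also have "\<dots> \<le> 2 * (cmod (f w) * cmod w powr \<kappa>) * (C0 * cmod (u - s) * cmod w powr (1 + \<gamma>))"
    using tame IH(3) by (intro mult_mono) (auto simp: tame_def)
  also have "\<dots> = C0 * cmod (u - s) * (cmod (f w) * (2 * cmod w powr (1 + \<gamma> + \<kappa>)))"
    by (simp add: powr_add)
  also have "\<dots> \<le> C0 * cmod (u - s) * (cmod (f w) * cmod (f w) powr \<gamma>)"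
    using tame C0 by (intro mult_left_mono) (auto simp: tame_def)
  also have "cmod (f w) * cmod (f w) powr \<gamma> = cmod (f w) powr (1 + \<gamma>)"
    by (simp add: powr_add)
  finally have dist: "cmod (f v - f w) \<le> C0 * cmod (u - s) * cmod (f w) powr (1 + \<gamma>)" .
  have eqs: "(f ^^ Suc m) u = f v" "(f ^^ Suc m) s = f w"
    by (simp_all add: v_def w_def)
  show ?case
    unfolding Suc_\<theta> eqs using reg ts(1) dist low up by blast
qed

end

lemma regular_upto_Suc': "x \<in> regular_upto f (Suc n) \<longleftrightarrow> \<not> is_pole f x \<and> f x \<in> regular_upto f n"
  by (auto simp: regular_upto_def less_Suc_eq_0_disj funpow_swap1)

lemma powr_comparable:
  fixes a b c :: real
  assumes "b > 0" "b / 2 \<le> a" "a \<le> 2 * b"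
  shows "a powr c \<le> 2 powr \<bar>c\<bar> * b powr c"
proof (cases "c \<ge> 0")
  case True
  then have "a powr c \<le> (2 * b) powr c"
    using assms by (intro powr_mono2) auto
  then show ?thesis
    using True by (simp add: powr_mult)
next
  case False
  then have "a powr c \<le> (b / 2) powr c"
    using assms by (intro powr_mono2') auto
  also have "\<dots> = 2 powr \<bar>c\<bar> * b powr c"
    using False by (simp add: powr_divide powr_minus_divide)
  finally show ?thesis .
qed

section \<open>Renormalizing small discs along the orbits of \<open>A\<close>\<close>

context tracked_setting
begin

text \<open>By the chain rule the logarithmic derivative of \<open>f^(j+1) - w\<close> is that of
  \<open>f - s\<close> times the quotient of \<open>tracking\<close>, which lies between
  \<open>1/4\<close> and \<open>2 * C0\<close>; the step from \<open>\<kappa>0\<close> to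
  \<open>\<kappa>\<close> absorbs both. The factor 2 in the last claim holds because
  \<open>|z|^(\<kappa> - L0) \<le> 1/2\<close>; it allows tracking to be continued by one more step
  on the whole disc.\<close>

lemma pulled_back_log_derivative:
  assumes z: "good z" "cmod z \<ge> 4" "cmod z \<ge> 2 * C0" and s: "s \<in> A" and j: "m0 \<le> j"
    and D: "D = ball z (cmod z powr - L0)"
    and fx: "\<And>x. x \<in> D \<Longrightarrow> f x \<noteq> s \<and> cmod (f x - s) < r0 \<and>
      cmod z powr - \<kappa>0 \<le> cmod (deriv f x / (f x - s)) \<and> cmod (deriv f x / (f x - s)) \<le> cmod z powr \<kappa>0"
    and tr: "\<And>x. x \<in> D \<Longrightarrow> tracks s (f x) j"
  defines "w \<equiv> (f ^^ j) s"
  shows "D \<subseteq> regular_upto f (Suc j)"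
    "\<And>x. x \<in> D \<Longrightarrow> (f ^^ Suc j) x \<noteq> w \<and>
      cmod z powr - \<kappa> \<le> cmod (deriv (f ^^ Suc j) x / ((f ^^ Suc j) x - w)) \<and>
      cmod (deriv (f ^^ Suc j) x / ((f ^^ Suc j) x - w)) \<le> cmod z powr \<kappa>"
    "\<And>x. x \<in> D \<Longrightarrow> cmod ((f ^^ Suc j) x - w) \<le> 2 * cmod ((f ^^ Suc j) z - w)"
proof -
  define t where "t = cmod z"
  have t: "t \<ge> 4" "t \<ge> 2 * C0"
    using z by (auto simp: t_def)
  have DG: "D \<subseteq> G"
    using z(1) by (simp add: good_def D)
  have zD: "z \<in> D"
    using z(2) by (auto simp: D)
  have tk: "\<And>x. x \<in> D \<Longrightarrow> f x \<in> regular_upto f j \<and> (f ^^ j) (f x) \<noteq> w \<and>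
      1 / 4 \<le> cmod (deriv (f ^^ j) (f x) * (f x - s) / ((f ^^ j) (f x) - w)) \<and>
      cmod (deriv (f ^^ j) (f x) * (f x - s) / ((f ^^ j) (f x) - w)) \<le> 2 * C0"
  proof -
    fix x assume x: "x \<in> D"
    have pos: "(0::real) < (1 / 2) ^ (j - m0)"
      by simp
    have le: "(2 - (1 / 2) ^ (j - m0)) * C0 \<le> 2 * C0"
      using C0 pos by (intro mult_right_mono) auto
    have fx': "f x \<noteq> s" "cmod (f x - s) < r0"
      using fx[OF x] by auto
    show "f x \<in> regular_upto f j \<and> (f ^^ j) (f x) \<noteq> w \<and>
      1 / 4 \<le> cmod (deriv (f ^^ j) (f x) * (f x - s) / ((f ^^ j) (f x) - w)) \<and>
      cmod (deriv (f ^^ j) (f x) * (f x - s) / ((f ^^ j) (f x) - w)) \<le> 2 * C0"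
      using tracking[OF s fx' j tr[OF x], folded w_def] pos le
      by - (elim conjE, (intro conjI; (assumption | linarith)))
  qed
  have fS: "(f ^^ Suc j) x = (f ^^ j) (f x)" for x
    by (simp add: funpow_swap1)
  show reg: "D \<subseteq> regular_upto f (Suc j)"
    using tk DG G_no_poles by (auto simp: regular_upto_Suc')
  show bounds: "(f ^^ Suc j) x \<noteq> w \<and>
      cmod z powr - \<kappa> \<le> cmod (deriv (f ^^ Suc j) x / ((f ^^ Suc j) x - w)) \<and>
      cmod (deriv (f ^^ Suc j) x / ((f ^^ Suc j) x - w)) \<le> cmod z powr \<kappa>" if x: "x \<in> D" for x
  proof -
    have "((f ^^ j) has_field_derivative deriv (f ^^ j) (f x)) (at (f x))"
      using holomorphic_derivI[OF regular_upto_props(2,1)[OF mero]] tk[OF x] by blast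
    moreover have "(f has_field_derivative deriv f x) (at x)"
      using holomorphic_derivI[OF holomorphic_on_nonpoles[OF mero] open_nonpoles[OF mero]] DG G_no_poles x by blast
    ultimately have "((f ^^ j) \<circ> f has_field_derivative deriv (f ^^ j) (f x) * deriv f x) (at x)"
      by (intro DERIV_chain)
    moreover have "(f ^^ j) \<circ> f = f ^^ Suc j"
      by (simp add: fun_eq_iff funpow_swap1)
    ultimately have "deriv (f ^^ Suc j) x = deriv (f ^^ j) (f x) * deriv f x"
      by (metis DERIV_imp_deriv)
    then have "deriv (f ^^ Suc j) x / ((f ^^ Suc j) x - w) =
        (deriv (f ^^ j) (f x) * (f x - s) / ((f ^^ j) (f x) - w)) * (deriv f x / (f x - s))"
      using fx[OF x] by (simp add: fS del: funpow.simps)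
    then have q: "cmod (deriv (f ^^ Suc j) x / ((f ^^ Suc j) x - w)) =
        cmod (deriv (f ^^ j) (f x) * (f x - s) / ((f ^^ j) (f x) - w)) * cmod (deriv f x / (f x - s))"
      by (simp only: norm_mult)
    have tk0: "t powr \<kappa> = t powr \<kappa>0 * t" "t powr - \<kappa> = t powr - \<kappa>0 / t"
      using t by (simp add: \<kappa>_def powr_add)
        (use t in \<open>simp only: \<kappa>_def minus_add_distrib powr_add, simp add: powr_minus divide_inverse\<close>)
    have "t powr - \<kappa>0 / t \<le> t powr - \<kappa>0 / 4"
      using t by (intro divide_left_mono) auto
    also have "\<dots> = 1 / 4 * t powr - \<kappa>0"
      by simp
    also have "\<dots> \<le> cmod (deriv (f ^^ j) (f x) * (f x - s) / ((f ^^ j) (f x) - w)) * cmod (deriv f x / (f x - s))"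
      using tk[OF x] fx[OF x] by (intro mult_mono) (auto simp: t_def)
    finally have 1: "t powr - \<kappa> \<le> cmod (deriv (f ^^ Suc j) x / ((f ^^ Suc j) x - w))"
      using q tk0 by simp
    have "cmod (deriv (f ^^ j) (f x) * (f x - s) / ((f ^^ j) (f x) - w)) * cmod (deriv f x / (f x - s)) \<le>
        (2 * C0) * t powr \<kappa>0"
      using tk[OF x] fx[OF x] C0 by (intro mult_mono) (auto simp: t_def)
    also have "\<dots> \<le> t * t powr \<kappa>0"
      using t by (intro mult_right_mono) auto
    finally have 2: "cmod (deriv (f ^^ Suc j) x / ((f ^^ Suc j) x - w)) \<le> t powr \<kappa>"
      using q tk0 by (simp add: mult.commute)
    show ?thesis
      using 1 2 tk[OF x] by (simp add: fS t_def del: funpow.simps)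
  qed
  show "cmod ((f ^^ Suc j) x - w) \<le> 2 * cmod ((f ^^ Suc j) z - w)" if x: "x \<in> D" for x
  proof -
    let ?F = "\<lambda>x. (f ^^ Suc j) x - w"
    have hol: "(f ^^ Suc j) holomorphic_on D"
      by (rule holomorphic_on_subset[OF regular_upto_props(2)[OF mero] reg])
    have dF: "deriv ?F x = deriv (f ^^ Suc j) x" if "x \<in> D" for x
      using holomorphic_on_imp_differentiable_at[OF hol _ that] D by (simp add: deriv_diff del: funpow.simps)
    have Ru: "t powr - L0 * t powr \<kappa> \<le> 1 / 2"
    proof -
      have "t powr - L0 * t powr \<kappa> = t powr - (L0 - \<kappa>)"
        using t by (simp add: algebra_simps flip: powr_add)
      then show ?thesis
        using powr_le_half[of t "L0 - \<kappa>"] t const_pos by simp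
    qed
    have "cmod (?F x - ?F z) \<le> 2 * t powr \<kappa> * cmod (x - z) * cmod (?F z)"
    proof (rule log_derivative_distortion_value[where R = "t powr - L0" and l = "t powr - \<kappa>"])
      show "?F holomorphic_on ball z (t powr - L0)"
        using hol unfolding D t_def by (intro holomorphic_intros)
    qed (use bounds dF D Ru t x in \<open>auto simp: t_def simp del: funpow.simps\<close>)
    also have "\<dots> \<le> 1 * cmod (?F z)"
    proof (rule mult_right_mono)
      have "cmod (x - z) \<le> t powr - L0"
        using x by (simp add: D t_def dist_norm norm_minus_commute)
      then have "t powr \<kappa> * cmod (x - z) \<le> t powr \<kappa> * t powr - L0"
        by (intro mult_left_mono) auto
      then show "2 * t powr \<kappa> * cmod (x - z) \<le> 1"
        using Ru by (simp add: mult.commute)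
    qed simp
    finally show ?thesis
      using norm_triangle_ineq2[of "?F x" "?F z"] by simp
  qed
qed

text \<open>Distances to a tame orbit do not decrease as long as they are within the tolerance
  \<open>|f^j s|^(-K)\<close>, which tends to 0, so it is exceeded at some time; \<open>m\<close> is
  the first such time from \<open>m0\<close> on.\<close>

lemma escape_time:
  assumes s: "s \<in> A" and u: "u \<noteq> s" "cmod (u - s) < r0"
  obtains m where "m0 \<le> m" "cmod ((f ^^ m) s) powr - K \<le> cmod ((f ^^ m) u - (f ^^ m) s)"
    "\<And>j. m0 \<le> j \<Longrightarrow> j < m \<Longrightarrow> cmod ((f ^^ j) u - (f ^^ j) s) < cmod ((f ^^ j) s) powr - K"
proof -
  define d where "d j = cmod ((f ^^ j) u - (f ^^ j) s)" for j
  have "\<exists>m\<ge>m0. cmod ((f ^^ m) s) powr - K \<le> d m"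
  proof (rule ccontr)
    assume "\<not> ?thesis"
    then have small: "d j < cmod ((f ^^ j) s) powr - K" if "j \<ge> m0" for j
      using that by (meson not_le)
    have d0: "d m0 > 0"
      using local_order[OF s u] by (simp add: d_def)
    have mono: "d m0 \<le> d j" if "m0 \<le> j" for j
      using that
    proof (induction j rule: dec_induct)
      case (step j)
      have "(f ^^ j) u \<noteq> (f ^^ j) s"
        using step.IH d0 by (auto simp: d_def)
      moreover have "cmod ((f ^^ j) u - (f ^^ j) s) \<le> 2 * cmod ((f ^^ j) s) powr - K"
        using small[OF step.hyps(1)] powr_ge_zero[of "cmod ((f ^^ j) s)" "- K"] unfolding d_def by linarith
      ultimately have "d j \<le> d (Suc j)"
        using tame_step(2)[of "(f ^^ j) s" "(f ^^ j) u"] orbit[OF s step.hyps(1)] by (simp add: d_def)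
      then show ?case
        using step.IH by simp
    qed simp
    have "\<forall>\<^sub>F j in sequentially. 2 * cmod ((f ^^ j) s) powr - K < 1 / (1 / d m0)"
      using eventually_tolerance[OF s, of "1 / d m0"] d0 const_pos by simp
    then have "\<forall>\<^sub>F j in sequentially. 2 * cmod ((f ^^ j) s) powr - K < d m0 \<and> j \<ge> m0"
      using eventually_ge_at_top[of m0] by eventually_elim simp
    then obtain j where j: "2 * cmod ((f ^^ j) s) powr - K < d m0" "j \<ge> m0"
      using eventually_happens'[OF sequentially_bot] by blast
    have "cmod ((f ^^ j) s) powr - K \<ge> 0"
      by simp
    then show False
      using j small[OF j(2)] mono[OF j(2)] by linarith
  qed
  define m where "m = (LEAST m. m0 \<le> m \<and> cmod ((f ^^ m) s) powr - K \<le> d m)"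
  have m: "m0 \<le> m \<and> cmod ((f ^^ m) s) powr - K \<le> d m"
    unfolding m_def by (rule LeastI_ex) (use \<open>\<exists>m\<ge>m0. _\<close> in blast)
  show ?thesis
  proof (rule that)
    fix j assume "m0 \<le> j" "j < m"
    then show "cmod ((f ^^ j) u - (f ^^ j) s) < cmod ((f ^^ j) s) powr - K"
      using not_less_Least[of j "\<lambda>m. m0 \<le> m \<and> cmod ((f ^^ m) s) powr - K \<le> d m"]
      by (simp add: m_def d_def not_le)
  qed (use m in \<open>auto simp: d_def\<close>)
qed

text \<open>The first entry comes from the large branch, where the lost proportion is governed by
  \<open>|y|^(\<beta> - 1)\<close> with \<open>|y| \<ge> exp (|z|^\<epsilon>)\<close>; the second
  comes from passages along an orbit of \<open>A\<close>. \<open>C1\<close> collects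
  \<open>C0\<close> and the comparison of \<open>|y|\<close> with \<open>|w|\<close>.\<close>

definition "\<eta>1 = min (1 - \<beta>) ((\<tau> - \<beta>) / (1 + \<gamma> - \<tau>))"
definition "C1 = max 1 (2 powr \<bar>\<beta>\<bar> * C0 powr ((\<tau> - \<beta>) / (1 + \<gamma> - \<tau>)))"

text \<open>\<open>p\<close> is a value omitted by \<open>f^k\<close> on the disc: 0 in the large
  branch, otherwise the orbit point at which the passage ends. \<open>|f^k z - p|\<close> is the
  scale of the image. The exponent \<open>K + 1\<close> instead of \<open>K\<close> absorbs the
  factor between \<open>|f^k z|\<close> and \<open>|p|\<close>. By the last clause either no point
  near \<open>f^k z\<close> is lost, or the proportion lost at this scale is exponentially
  small.\<close>

definition renormalizes :: "real \<Rightarrow> complex \<Rightarrow> nat \<Rightarrow> complex \<Rightarrow> bool" where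
  "renormalizes N z k p \<longleftrightarrow>
     ball z (cmod z powr - L0) \<subseteq> regular_upto f k \<and>
     (\<forall>x\<in>ball z (cmod z powr - L0). passage f A \<epsilon> m0 K x k \<and> (f ^^ k) x \<noteq> p \<and>
        cmod z powr - \<kappa> \<le> cmod (deriv (f ^^ k) x / ((f ^^ k) x - p)) \<and>
        cmod (deriv (f ^^ k) x / ((f ^^ k) x - p)) \<le> cmod z powr \<kappa>) \<and>
     cmod z powr N \<le> cmod ((f ^^ k) z) \<and>
     cmod ((f ^^ k) z - p) \<le> cmod ((f ^^ k) z) \<and>
     cmod ((f ^^ k) z) powr - (K + 1) \<le> cmod ((f ^^ k) z - p) \<and>
     ((\<forall>x. cmod (x - (f ^^ k) z) \<le> cmod ((f ^^ k) z - p) / 2 \<longrightarrow> good x) \<or>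
      cmod ((f ^^ k) z) powr \<beta> / cmod ((f ^^ k) z - p) \<le> C1 * exp (- (\<eta>1 * cmod z powr \<epsilon>)))"

lemma exists_renormalization:
  assumes N: "N \<ge> 1"
  shows "\<exists>M. \<forall>z. good z \<longrightarrow> cmod z \<ge> M \<longrightarrow> (\<exists>k p. renormalizes N z k p)"
proof -
  note c = const_pos
  \<comment> \<open>At the escape time \<open>|w|^(-K) \<le> d \<le> C0 exp (-t^\<epsilon>)
    |w|^(1+\<gamma>)\<close>, that is \<open>exp (t^\<epsilon>) \<le> C0 |w|^e\<close>.\<close>
  define e where "e = K + 1 + \<gamma>"
  have e: "e > 0"
    using c by (simp add: e_def)
  define W where "W = Max (insert 1 ((\<lambda>s. cmod ((f ^^ m0) s) powr e) ` A))"
  have W: "\<And>s. s \<in> A \<Longrightarrow> cmod ((f ^^ m0) s) powr e \<le> W"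
    using finA by (auto simp: W_def)
  have "\<forall>\<^sub>F t::real in at_top. 2 * t \<le> exp (t powr \<epsilon>)"
    using eps by real_asymp
  moreover have "\<forall>\<^sub>F t::real in at_top. t powr N \<le> exp (t powr \<epsilon>)"
    using eps N by real_asymp
  moreover have "\<forall>\<^sub>F t::real in at_top. exp (- (t powr \<epsilon>)) < r0"
    using eps r0 by real_asymp
  moreover have "\<forall>\<^sub>F t::real in at_top. W * C0 < exp (t powr \<epsilon>)"
    using eps by real_asymp
  moreover have "\<forall>\<^sub>F t::real in at_top. C0 * (8 * t powr N) powr e \<le> exp (t powr \<epsilon>)"
    using eps e N by real_asymp
  moreover have "\<forall>\<^sub>F t::real in at_top. t \<ge> Max {4, 2 powr \<kappa>0, 2 * C0, 2 powr K, 2 powr (L0 + 1)}"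
    by (rule eventually_ge_at_top)
  ultimately have "\<forall>\<^sub>F t::real in at_top. 2 * t \<le> exp (t powr \<epsilon>) \<and> t powr N \<le> exp (t powr \<epsilon>) \<and>
      exp (- (t powr \<epsilon>)) < r0 \<and> W * C0 < exp (t powr \<epsilon>) \<and> C0 * (8 * t powr N) powr e \<le> exp (t powr \<epsilon>) \<and>
      t \<ge> 4 \<and> t \<ge> 2 powr \<kappa>0 \<and> t \<ge> 2 * C0 \<and> t \<ge> 2 powr K \<and> t \<ge> 2 powr (L0 + 1)"
    by eventually_elim simp
  then obtain M where M: "\<And>t. t \<ge> M \<Longrightarrow> 2 * t \<le> exp (t powr \<epsilon>) \<and> t powr N \<le> exp (t powr \<epsilon>) \<and>
      exp (- (t powr \<epsilon>)) < r0 \<and> W * C0 < exp (t powr \<epsilon>) \<and> C0 * (8 * t powr N) powr e \<le> exp (t powr \<epsilon>) \<and>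
      t \<ge> 4 \<and> t \<ge> 2 powr \<kappa>0 \<and> t \<ge> 2 * C0 \<and> t \<ge> 2 powr K \<and> t \<ge> 2 powr (L0 + 1)"
    unfolding eventually_at_top_linorder by blast
  \<comment> \<open>The disc has radius at most \<open>1/2\<close>, so with \<open>M + 1\<close> all
    its points satisfy the estimates for moduli at least \<open>M\<close>.\<close>
  have "\<exists>k p. renormalizes N z k p" if z: "good z" "cmod z \<ge> M + 1" for z
  proof -
    define t where "t = cmod z"
    define D where "D = ball z (t powr - L0)"
    have tM: "t \<ge> M"
      using z(2) by (simp add: t_def)
    note t = M[OF tM]
    have DG: "D \<subseteq> G"
      using z(1) by (simp add: good_def D_def t_def)
    have zD: "z \<in> D"
      using t by (simp add: D_def)
    have R: "t powr - L0 \<le> 1 / 2"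
      using powr_le_half[of t L0] t c by simp
    have normx: "cmod x \<ge> M" "cmod x \<le> 2 * t" if "x \<in> D" for x
    proof -
      have "cmod (z - x) \<le> 1/2"
        using that R by (simp add: D_def dist_norm)
      then show "cmod x \<ge> M" "cmod x \<le> 2 * t"
        using norm_triangle_ineq2[of z x] norm_triangle_ineq2[of x z] z(2) t
        unfolding t_def by (simp_all add: norm_minus_commute)
    qed
    have "cmod z \<ge> 2" "cmod z \<ge> 2 powr \<kappa>0"
      using t by (auto simp: t_def)
    from good_log_derivative[OF z(1) this]
    obtain p where p: "p = 0 \<and> (\<forall>x\<in>D. cmod (f x) \<ge> exp (cmod x powr \<epsilon>)) \<or>
        p \<in> A \<and> (\<forall>x\<in>D. cmod (f x - p) \<le> exp (- (cmod x powr \<epsilon>)))"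
      and pq: "\<And>x. x \<in> D \<Longrightarrow> f x \<noteq> p \<and>
        t powr - \<kappa>0 \<le> cmod (deriv f x / (f x - p)) \<and> cmod (deriv f x / (f x - p)) \<le> t powr \<kappa>0"
      unfolding t_def D_def by blast
    have \<kappa>0\<kappa>: "t powr \<kappa>0 \<le> t powr \<kappa>" "t powr - \<kappa> \<le> t powr - \<kappa>0"
      using t by (auto simp: \<kappa>_def intro!: powr_mono)
    from p show ?thesis
    proof
      assume p: "p = 0 \<and> (\<forall>x\<in>D. cmod (f x) \<ge> exp (cmod x powr \<epsilon>))"
      define y where "y = f z"
      have y: "cmod y \<ge> exp (t powr \<epsilon>)"
        using p zD by (auto simp: y_def t_def)
      have y1: "cmod y \<ge> 1"
        using y t by linarith
      have pass: "passage f A \<epsilon> m0 K x 1" if x: "x \<in> D" for x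
      proof -
        have "2 * cmod x \<le> exp (cmod x powr \<epsilon>)"
          using M[OF normx(1)[OF x]] by simp
        also have "\<dots> \<le> cmod (f x)"
          using p x by blast
        finally show ?thesis
          using DG G_no_poles x by (auto simp: passage_def regular_upto_def)
      qed
      have "cmod y powr \<beta> / cmod y = cmod y powr (\<beta> - 1)"
        using y1 by (simp add: powr_diff)
      also have "\<dots> \<le> exp (t powr \<epsilon>) powr (\<beta> - 1)"
        using beta y by (intro powr_mono2') auto
      also have "\<dots> = exp (- ((1 - \<beta>) * t powr \<epsilon>))"
        by (simp add: powr_def algebra_simps)
      also have "\<dots> \<le> exp (- (\<eta>1 * t powr \<epsilon>))"
        by (simp add: \<eta>1_def mult_right_mono)
      also have "\<dots> \<le> C1 * exp (- (\<eta>1 * t powr \<epsilon>))"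
        by (simp add: C1_def)
      finally have frac: "cmod y powr \<beta> / cmod y \<le> C1 * exp (- (\<eta>1 * t powr \<epsilon>))" .
      have "cmod y powr - (K + 1) \<le> cmod y powr 1"
        using y1 c by (intro powr_mono) auto
      then have low: "cmod y powr - (K + 1) \<le> cmod y"
        using y1 by simp
      have ge: "t powr N \<le> cmod y"
        using t y by linarith
      have "renormalizes N z 1 0"
        unfolding renormalizes_def t_def[symmetric] D_def[symmetric]
        using pass pq p DG G_no_poles \<kappa>0\<kappa> frac low ge
        by (auto simp: y_def[symmetric] regular_upto_def intro: order_trans)
      then show ?thesis
        by blast
    next
      assume ps: "p \<in> A \<and> (\<forall>x\<in>D. cmod (f x - p) \<le> exp (- (cmod x powr \<epsilon>)))"
      then have s: "p \<in> A"
        by blast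
      define u where "u = f z"
      have fx: "f x \<noteq> p \<and> cmod (f x - p) < r0 \<and>
          cmod z powr - \<kappa>0 \<le> cmod (deriv f x / (f x - p)) \<and> cmod (deriv f x / (f x - p)) \<le> cmod z powr \<kappa>0"
        if x: "x \<in> D" for x
        using pq[OF x] ps x M[OF normx(1)[OF x]] by (fastforce simp: t_def)
      have u: "u \<noteq> p" "cmod (u - p) < r0"
        using fx[OF zD] by (auto simp: u_def)
      have uexp: "cmod (u - p) \<le> exp (- (t powr \<epsilon>))"
        using ps zD by (auto simp: u_def t_def)
      obtain m where m: "m0 \<le> m" "cmod ((f ^^ m) p) powr - K \<le> cmod ((f ^^ m) u - (f ^^ m) p)"
        and before: "\<And>j. m0 \<le> j \<Longrightarrow> j < m \<Longrightarrow> cmod ((f ^^ j) u - (f ^^ j) p) < cmod ((f ^^ j) p) powr - K"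
        using escape_time[OF s u] by blast
      have zz: "good z" "cmod z \<ge> 4" "cmod z \<ge> 2 * C0"
        using z t by (auto simp: t_def)
      have D': "D = ball z (cmod z powr - L0)"
        by (simp add: D_def t_def)
      have fS: "(f ^^ Suc j) x = (f ^^ j) (f x)" for x j
        by (simp add: funpow_swap1)
      \<comment> \<open>Induction on time for the whole disc at once: tracking up to
        \<open>j\<close> gives the factor 2 between any point and the centre, and the centre is
        still within the tolerance at time \<open>j\<close> because \<open>j < m\<close>.\<close>
      have tr: "\<forall>x\<in>D. tracks p (f x) m"
        using m(1) order_refl[of m]
      proof (induction m rule: dec_induct[consumes 1, case_names base step])
        case base
        show ?case
          by (simp add: tracks_def)
      next
        case (step j)
        then have tr: "\<And>x. x \<in> D \<Longrightarrow> tracks p (f x) j"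
          by auto
        have near: "cmod ((f ^^ j) (f x) - (f ^^ j) p) \<le> 2 * cmod ((f ^^ j) p) powr - K" if x: "x \<in> D" for x
        proof -
          have "cmod ((f ^^ j) (f x) - (f ^^ j) p) \<le> 2 * cmod ((f ^^ j) u - (f ^^ j) p)"
            using pulled_back_log_derivative(3)[OF zz s step.hyps(1) D' fx tr x] by (simp only: fS u_def)
          then show ?thesis
            using before[OF step.hyps(1)] step.hyps(2) by simp
        qed
        show ?case
        proof
          fix x assume x: "x \<in> D"
          show "tracks p (f x) (Suc j)"
            using tr[OF x] near[OF x] by (auto simp: tracks_def less_Suc_eq)
        qed
      qed
      then have trx: "\<And>x. x \<in> D \<Longrightarrow> tracks p (f x) m"
        by blast
      define w where "w = (f ^^ m) p"
      define y where "y = (f ^^ m) u"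
      define d where "d = cmod (y - w)"
      have pb1: "D \<subseteq> regular_upto f (Suc m)"
        by (rule pulled_back_log_derivative(1)[OF zz s m(1) D' fx trx])
      have pb2: "(f ^^ Suc m) x \<noteq> w \<and>
          cmod z powr - \<kappa> \<le> cmod (deriv (f ^^ Suc m) x / ((f ^^ Suc m) x - w)) \<and>
          cmod (deriv (f ^^ Suc m) x / ((f ^^ Suc m) x - w)) \<le> cmod z powr \<kappa>" if "x \<in> D" for x
        unfolding w_def by (rule pulled_back_log_derivative(2)[OF zz s m(1) D' fx trx that])
      have pb3: "cmod ((f ^^ Suc m) x - w) \<le> 2 * cmod ((f ^^ Suc m) z - w)" if "x \<in> D" for x
        unfolding w_def by (rule pulled_back_log_derivative(3)[OF zz s m(1) D' fx trx that])
      have fz: "(f ^^ Suc m) z = y"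
        by (simp only: fS y_def u_def)
      have "tracks p u m"
        using trx[OF zD] by (simp add: u_def)
      from tracking[OF s u m(1) this]
      have d_le: "d \<le> C0 * cmod (u - p) * cmod w powr (1 + \<gamma>)"
        by (simp add: d_def y_def w_def)
      have d_ge: "cmod w powr - K \<le> d"
        using m(2) by (simp add: d_def y_def w_def)
      have w: "tame w" "ball w (2 * cmod w powr \<tau>) \<subseteq> G"
        using orbit[OF s m(1)] by (auto simp: w_def)
      have wpos: "cmod w \<ge> 512" "cmod w > 0"
        using w(1) by (auto simp: tame_def)
      have upper: "d \<le> C0 * exp (- (t powr \<epsilon>)) * cmod w powr (1 + \<gamma>)"
      proof -
        have "C0 * cmod (u - p) * cmod w powr (1 + \<gamma>) \<le> C0 * exp (- (t powr \<epsilon>)) * cmod w powr (1 + \<gamma>)"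
          using uexp C0 by (intro mult_right_mono mult_left_mono) auto
        then show ?thesis
          using d_le by linarith
      qed
      \<comment> \<open>A lower bound \<open>|w|^a\<close> for \<open>d\<close> becomes a lower
        bound for \<open>|w|\<close>; used with \<open>a = -K\<close> at escape and with
        \<open>a = \<tau>\<close> when \<open>d\<close> exceeds \<open>|w|^\<tau>\<close>.\<close>
      have transfer: "exp (t powr \<epsilon>) \<le> C0 * cmod w powr (1 + \<gamma> - a)" if "cmod w powr a \<le> d" for a
      proof -
        have "cmod w powr a \<le> C0 * exp (- (t powr \<epsilon>)) * cmod w powr (1 + \<gamma>)"
          using that upper by linarith
        then have "exp (t powr \<epsilon>) * cmod w powr a \<le> C0 * cmod w powr (1 + \<gamma>)"
          by (simp add: exp_minus field_simps)
        moreover have "cmod w powr (1 + \<gamma>) = cmod w powr (1 + \<gamma> - a) * cmod w powr a"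
          by (simp flip: powr_add)
        ultimately have "exp (t powr \<epsilon>) * cmod w powr a \<le> (C0 * cmod w powr (1 + \<gamma> - a)) * cmod w powr a"
          by simp
        moreover have "cmod w powr a > 0"
          using wpos by simp
        ultimately show ?thesis
          by (simp only: mult_le_cancel_right_pos)
      qed
      have we: "exp (t powr \<epsilon>) \<le> C0 * cmod w powr e"
        using transfer[OF d_ge] by (simp add: e_def add_ac)
      have w8: "8 * t powr N \<le> cmod w"
      proof (rule ccontr)
        assume "\<not> ?thesis"
        then have "cmod w powr e < (8 * t powr N) powr e"
          using e by (intro powr_less_mono2) auto
        then have "C0 * cmod w powr e < C0 * (8 * t powr N) powr e"
          using C0 by (intro mult_strict_left_mono) auto
        then show False
          using we t by linarith
      qed
      have tN: "t \<le> t powr N"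
        using powr_mono[of 1 N t] N t by simp
      \<comment> \<open>Escape at \<open>m0\<close> itself would bound \<open>|w|\<close> by a
        constant; so there is a previous time at which the tolerance still holds.\<close>
      have "m \<noteq> m0"
      proof
        assume "m = m0"
        then have "cmod w powr e \<le> W"
          using W[OF s] by (simp add: w_def)
        then have "C0 * cmod w powr e \<le> W * C0"
          using C0 by (simp add: mult.commute)
        then show False
          using we t by linarith
      qed
      \<comment> \<open>One step before escape the distance is below \<open>|v|^(-K)\<close>, and a
        step multiplies it by at most \<open>2 |w| |v|^\<kappa>\<close>; \<open>K\<close> exceeds
        \<open>\<kappa>\<close> by more than 1, so \<open>d\<close> is small compared with
        \<open>|w|\<close>.\<close>
      have d10: "d \<le> cmod w / 10"
      proof -
        obtain n where n: "m = Suc n" "m0 \<le> n"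
          using m(1) \<open>m \<noteq> m0\<close> by (cases m) auto
        define v where "v = (f ^^ n) p"
        define x where "x = (f ^^ n) u"
        have v: "tame v"
          using orbit[OF s n(2)] by (simp add: v_def)
        have fv: "f v = w" "f x = y"
          by (simp_all add: v_def x_def w_def y_def n)
        have small: "cmod (x - v) < cmod v powr - K"
          using before[OF n(2)] n(1) by (simp add: v_def x_def)
        have xv: "x \<noteq> v"
          using d_ge wpos fv by (auto simp: d_def)
        have near: "cmod (x - v) \<le> 2 * cmod v powr - K"
          using small powr_ge_zero[of "cmod v" "- K"] by linarith
        have "d \<le> 2 * cmod (deriv f v) * cmod (x - v)"
          using tame_step(3)[OF v xv near] by (simp only: fv d_def)
        also have "\<dots> \<le> 2 * (cmod w * cmod v powr \<kappa>) * cmod v powr - K"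
          using v small fv by (intro mult_mono) (auto simp: tame_def)
        also have "\<dots> = 2 * cmod w * cmod v powr (\<kappa> + - K)"
          by (simp only: powr_add mult.assoc)
        also have "\<dots> \<le> 2 * cmod w * cmod v powr (-1)"
          using v c by (intro mult_left_mono powr_mono) (auto simp: tame_def K_def)
        also have "\<dots> = 2 * cmod w / cmod v"
          using v by (simp add: tame_def powr_minus divide_inverse)
        also have "\<dots> \<le> 2 * cmod w / 20"
          using v by (intro divide_left_mono) (auto simp: tame_def)
        finally show ?thesis
          by simp
      qed
      have yw: "cmod y \<ge> cmod w / 2" "cmod y \<le> 2 * cmod w" "0.9 * cmod w \<le> cmod y"
        using d10 norm_triangle_ineq3[of y w] unfolding d_def by linarith+
      have y_ge: "t powr N \<le> cmod y"
        using w8 yw tN by linarith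
      have d_y: "d \<le> cmod y"
        using d10 yw norm_ge_zero[of w] by linarith
      have low: "cmod y powr - (K + 1) \<le> d"
      proof -
        have ypos: "cmod y > 0" "cmod y \<ge> 2 powr K"
          using y_ge tN t by linarith+
        have "cmod y powr - (K + 1) = cmod y powr - K / cmod y"
          using ypos by (simp add: powr_diff powr_minus field_simps)
        also have "\<dots> \<le> cmod y powr - K / 2 powr K"
          using ypos by (intro divide_left_mono) auto
        also have "\<dots> = (2 * cmod y) powr - K"
          by (simp add: powr_mult powr_minus_divide)
        also have "\<dots> \<le> cmod w powr - K"
          using wpos yw c by (intro powr_mono2') auto
        finally show ?thesis
          using d_ge by linarith
      qed
      have pass: "passage f A \<epsilon> m0 K x (Suc m)" if x: "x \<in> D" for x
      proof -
        have "cmod ((f ^^ Suc m) x - w) \<le> 2 * d"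
          using pb3[OF x] by (simp only: fz d_def)
        then have "cmod w - 2 * d \<le> cmod ((f ^^ Suc m) x)"
          using norm_triangle_ineq3[of "(f ^^ Suc m) x" w] by linarith
        then have grow: "2 * cmod x \<le> cmod ((f ^^ Suc m) x)"
          using normx(2)[OF x] w8 tN d10 t by linarith
        have follow: "\<forall>j. m0 \<le> j \<and> Suc j < Suc m \<longrightarrow> cmod ((f ^^ j) (f x) - (f ^^ j) p) \<le> 2 * cmod ((f ^^ j) p) powr - K"
          using trx[OF x] by (simp add: tracks_def)
        have close: "cmod (f x - p) \<le> exp (- (cmod x powr \<epsilon>))"
          using ps x by blast
        have reg: "x \<in> regular_upto f (Suc m)"
          using pb1 x by blast
        show ?thesis
          unfolding passage_def
          by (intro conjI disjI2 bexI[OF _ s] reg grow follow close) simp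
      qed
      have frac: "(\<forall>x. cmod (x - y) \<le> d / 2 \<longrightarrow> good x) \<or>
          cmod y powr \<beta> / d \<le> C1 * exp (- (\<eta>1 * t powr \<epsilon>))"
      proof (cases "d \<le> cmod w powr \<tau>")
        case True
        \<comment> \<open>Such points are within \<open>1.5 d\<close> of \<open>w\<close>; the
          margin \<open>|w|^\<tau> / 2\<close> left in the disc of (c) has room for the discs of
          radius \<open>|x|^(-L0)\<close>.\<close>
        have "good x" if x: "cmod (x - y) \<le> d / 2" for x
        proof -
          have xw: "cmod (x - w) \<le> 1.5 * d"
            using x norm_triangle_ineq[of "x - y" "y - w"] by (simp add: d_def)
          then have "cmod x \<ge> cmod w / 2"
            using norm_triangle_ineq3[of x w] d10 by linarith
          then have "cmod x powr - L0 \<le> (cmod w / 2) powr - L0"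
            using wpos c by (intro powr_mono2') auto
          also have "\<dots> = cmod w powr - L0 * 2 powr L0"
            by (simp add: powr_divide powr_minus_divide)
          also have "\<dots> \<le> cmod w powr - L0 * (cmod w / 2)"
          proof (rule mult_left_mono)
            have "2 powr (L0 + 1) \<le> cmod w"
              using t w8 tN by linarith
            then show "2 powr L0 \<le> cmod w / 2"
              by (simp add: powr_add)
          qed simp
          also have "\<dots> = cmod w powr (- L0 + 1) / 2"
            using wpos by (simp only: powr_add) simp
          also have "\<dots> \<le> cmod w powr \<tau> / 2"
            using wpos c by (intro divide_right_mono powr_mono) auto
          finally have rad: "cmod x powr - L0 \<le> cmod w powr \<tau> / 2" .
          have "ball x (cmod x powr - L0) \<subseteq> ball w (2 * cmod w powr \<tau>)"
          proof
            fix v assume "v \<in> ball x (cmod x powr - L0)"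
            then have "dist x v < cmod w powr \<tau> / 2"
              using rad by simp
            moreover have "dist w x \<le> 1.5 * cmod w powr \<tau>"
              using xw True by (simp add: dist_norm norm_minus_commute)
            ultimately show "v \<in> ball w (2 * cmod w powr \<tau>)"
              using dist_triangle[of w v x] by simp
          qed
          then show ?thesis
            using w(2) by (auto simp: good_def)
        qed
        then show ?thesis
          by blast
      next
        case False
        define e2 where "e2 = 1 + \<gamma> - \<tau>"
        have e2: "e2 > 0"
          using tau_less_1 by (simp add: e2_def \<gamma>_def field_simps)
        define r where "r = (\<tau> - \<beta>) / e2"
        have r: "r > 0"
          using tau e2 by (simp add: r_def)
        have big: "exp (t powr \<epsilon>) / C0 \<le> cmod w powr e2"
          using transfer[of \<tau>] False C0 by (simp add: e2_def field_simps)
        have ypow: "cmod y powr \<beta> \<le> 2 powr \<bar>\<beta>\<bar> * cmod w powr \<beta>"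
          using powr_comparable[OF wpos(2) yw(1,2)] .
        have "cmod y powr \<beta> / d \<le> (2 powr \<bar>\<beta>\<bar> * cmod w powr \<beta>) / cmod w powr \<tau>"
          using ypow False wpos by (intro frac_le) auto
        also have "\<dots> = 2 powr \<bar>\<beta>\<bar> * cmod w powr (- (e2 * r))"
          using e2 by (simp add: r_def powr_diff)
        also have "cmod w powr (- (e2 * r)) = (cmod w powr e2) powr - r"
          by (simp add: powr_powr)
        also have "2 powr \<bar>\<beta>\<bar> * (cmod w powr e2) powr - r \<le> 2 powr \<bar>\<beta>\<bar> * (exp (t powr \<epsilon>) / C0) powr - r"
          using big r C0 by (intro mult_left_mono powr_mono2') auto
        also have "\<dots> = (2 powr \<bar>\<beta>\<bar> * C0 powr r) * exp (- (r * t powr \<epsilon>))"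
        proof -
          have "(exp (t powr \<epsilon>) / C0) powr - r = exp (t powr \<epsilon>) powr - r * C0 powr r"
            using C0 by (simp add: powr_divide powr_minus_divide)
          moreover have "exp (t powr \<epsilon>) powr - r = exp (- (r * t powr \<epsilon>))"
            by (simp add: exp_powr_real mult.commute)
          ultimately show ?thesis
            by simp
        qed
        also have "\<dots> \<le> C1 * exp (- (\<eta>1 * t powr \<epsilon>))"
        proof (rule mult_mono)
          have "\<eta>1 \<le> r"
            by (simp add: \<eta>1_def r_def e2_def)
          then show "exp (- (r * t powr \<epsilon>)) \<le> exp (- (\<eta>1 * t powr \<epsilon>))"
            by (simp add: mult_right_mono)
        qed (auto simp: C1_def r_def e2_def)
        finally show ?thesis
          by blast
      qed
      have "renormalizes N z (Suc m) w"
        unfolding renormalizes_def t_def[symmetric] D_def[symmetric] fz d_def[symmetric]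
        using pb1 pb2 pass frac d_y low y_ge unfolding t_def[symmetric] by blast
      then show ?thesis
        by blast
    qed
  qed
  then show ?thesis
    by blast
qed

end

section \<open>Density of the surviving points\<close>

context escape_setting
begin

lemma open_not_good: "open {x. x \<noteq> 0 \<and> \<not> good x}"
proof -
  have "{x. x \<noteq> 0 \<and> \<not> good x} = (\<Union>w\<in>- G. {x. x \<in> - {0} \<and> dist x w < cmod x powr - L0})"
    by (auto simp: good_def subset_eq)
  moreover have "open {x. x \<in> - {0} \<and> dist x w < cmod x powr - L0}" for w
  proof -
    have "continuous_on (- {0}) (\<lambda>x. cmod x powr - L0 - dist x w)"
      by (intro continuous_intros continuous_on_powr') auto
    then have "open (- {0} \<inter> (\<lambda>x. cmod x powr - L0 - dist x w) -` {0<..})"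
      by (rule continuous_open_preimage) auto
    moreover have "- {0} \<inter> (\<lambda>x. cmod x powr - L0 - dist x w) -` {0<..} = {x. x \<in> - {0} \<and> dist x w < cmod x powr - L0}"
      by auto
    ultimately show ?thesis
      by simp
  qed
  ultimately show ?thesis
    by auto
qed

definition "C2 = 2 * B * 2 powr \<bar>\<beta>\<bar>"

lemma C2_pos: "C2 > 0"
  using B by (simp add: C2_def)

text \<open>About a point that is not good there is a point outside \<open>G\<close> at distance
  less than \<open>|x|^(-L0) \<le> |x|^(-\<delta>1)\<close>, so (b) applies; the diameter is at most
  \<open>2 * \<rho>\<close> and the moduli differ from \<open>|y|\<close> by a factor at most 2,
  whence \<open>C2\<close>.\<close>

lemma not_good_measure:
  assumes y: "cmod y \<ge> 2" and \<rho>: "0 < \<rho>" "\<rho> \<le> cmod y / 2"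
  shows "{x \<in> cball y \<rho>. \<not> good x} \<in> lmeasurable"
    "measure lebesgue {x \<in> cball y \<rho>. \<not> good x} \<le> C2 * \<rho> * cmod y powr \<beta>"
proof -
  let ?D = "{x \<in> cball y \<rho>. \<not> good x}"
  have norm: "cmod y / 2 \<le> cmod x" "cmod x \<le> 2 * cmod y" "cmod x \<ge> 1" if "x \<in> cball y \<rho>" for x
    using that \<rho> y norm_triangle_ineq3[of y x] by (auto simp: dist_norm abs_le_iff)
  have "?D = cball y \<rho> \<inter> {x. x \<noteq> 0 \<and> \<not> good x}"
    using norm(3) by fastforce
  then show D: "?D \<in> lmeasurable"
    using open_not_good by (simp add: fmeasurable_Int_fmeasurable)
  have "?D \<subseteq> {z. edist_set z (- G) \<le> 2 * epowr (cmod z) (- \<delta>1)}"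
  proof
    fix x assume x: "x \<in> ?D"
    then obtain w where w: "dist x w < cmod x powr - L0" "w \<in> - G"
      by (auto simp: good_def subset_eq)
    have x1: "cmod x \<ge> 1"
      using norm(3) x by blast
    have "edist_set x (- G) \<le> ennreal (dist x w)"
      unfolding edist_set_def by (rule INF_lower[OF w(2)])
    also have "\<dots> \<le> ennreal (cmod x powr - \<delta>1)"
    proof (rule ennreal_leI)
      have "cmod x powr - L0 \<le> cmod x powr - \<delta>1"
        using x1 const_pos by (intro powr_mono) auto
      then show "dist x w \<le> cmod x powr - \<delta>1"
        using w(1) by linarith
    qed
    also have "\<dots> = 1 * epowr (cmod x) (- \<delta>1)"
    proof -
      have "x \<noteq> 0"
        using x1 by auto
      then show ?thesis
        by (simp add: epowr_def)
    qed
    also have "\<dots> \<le> 2 * epowr (cmod x) (- \<delta>1)"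
      by (rule mult_right_mono) auto
    finally show "x \<in> {z. edist_set z (- G) \<le> 2 * epowr (cmod z) (- \<delta>1)}"
      by simp
  qed
  from meas_D[OF fmeasurableD[OF D] this]
  have "emeasure lebesgue ?D \<le> ennreal B * ediam ?D * (SUP z\<in>?D. epowr (cmod z) \<beta>)" .
  also have "\<dots> \<le> ennreal B * ennreal (2 * \<rho>) * ennreal (2 powr \<bar>\<beta>\<bar> * cmod y powr \<beta>)"
  proof (intro mult_mono)
    show "ediam ?D \<le> ennreal (2 * \<rho>)"
      unfolding ediam_def
    proof (intro SUP_least ennreal_leI)
      fix z w assume "z \<in> ?D" "w \<in> ?D"
      then show "dist z w \<le> 2 * \<rho>"
        using dist_triangle2[of z w y] by (simp add: dist_commute)
    qed
    show "(SUP z\<in>?D. epowr (cmod z) \<beta>) \<le> ennreal (2 powr \<bar>\<beta>\<bar> * cmod y powr \<beta>)"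
    proof (rule SUP_least)
      fix x assume "x \<in> ?D"
      then have x: "x \<in> cball y \<rho>"
        by blast
      then show "epowr (cmod x) \<beta> \<le> ennreal (2 powr \<bar>\<beta>\<bar> * cmod y powr \<beta>)"
        using norm[OF x] y powr_comparable[of "cmod y" "cmod x" \<beta>] by (auto simp: epowr_def intro!: ennreal_leI)
    qed
  qed auto
  also have "\<dots> = ennreal (C2 * \<rho> * cmod y powr \<beta>)"
    using B \<rho> by (simp add: C2_def mult_ac flip: ennreal_mult)
  finally show "measure lebesgue ?D \<le> C2 * \<rho> * cmod y powr \<beta>"
    unfolding measure_def using B \<rho> by (intro enn2real_leI) (auto simp: C2_def)
qed

definition "\<eta> = (\<tau> - \<beta>) / max 1 (2 - 2 * \<tau>)"

lemma \<eta>_pos: "\<eta> > 0"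
  using tau by (simp add: \<eta>_def)

end

context tracked_setting
begin

text \<open>With \<open>\<gamma> = (1 - \<tau>)/2\<close> the denominator
  \<open>1 + \<gamma> - \<tau>\<close> is \<open>3/2 (1 - \<tau>)\<close>, strictly below
  \<open>2 - 2 \<tau>\<close>; the other entry of the minimum exceeds \<open>\<eta>\<close> because
  \<open>\<eta> \<le> \<tau> - \<beta> < 1 - \<beta>\<close>.\<close>

lemma \<eta>_less: "\<eta> < \<eta>1"
proof -
  have "0 < 1 + \<gamma> - \<tau>" "1 + \<gamma> - \<tau> < 2 - 2 * \<tau>"
    using tau_less_1 by (simp_all add: \<gamma>_def field_simps)
  then have e2: "0 < 1 + \<gamma> - \<tau>" "1 + \<gamma> - \<tau> < max 1 (2 - 2 * \<tau>)"
    by auto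
  have "(\<tau> - \<beta>) / max 1 (2 - 2 * \<tau>) < (\<tau> - \<beta>) / (1 + \<gamma> - \<tau>)"
    using e2 tau by (intro divide_strict_left_mono mult_pos_pos) auto
  moreover have "(\<tau> - \<beta>) / max 1 (2 - 2 * \<tau>) \<le> (\<tau> - \<beta>) / 1"
    using tau by (intro divide_left_mono) auto
  ultimately show ?thesis
    using tau_less_1 by (simp add: \<eta>_def \<eta>1_def)
qed

text \<open>The midpoint leaves two gaps: \<open>\<eta>1 - \<eta>2\<close> absorbs powers of
  \<open>|z|\<close> and constants in each passage, \<open>\<eta>2 - \<eta>\<close> absorbs the
  covering constant for squares.\<close>

definition "\<eta>2 = (\<eta> + \<eta>1) / 2"
definition "rad z = cmod z powr - L"
definition "bound t = exp (- (\<eta>2 * t powr \<epsilon>))"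

lemma \<eta>2: "\<eta> < \<eta>2" "\<eta>2 < \<eta>1" "\<eta>2 > 0"
  using \<eta>_less \<eta>_pos by (auto simp: \<eta>2_def)

lemma bound_mono: "0 \<le> a \<Longrightarrow> a \<le> b \<Longrightarrow> bound b \<le> bound a"
  using \<eta>2 eps by (auto simp: bound_def intro!: mult_left_mono powr_mono2)

abbreviation "surv \<equiv> survivors f A \<epsilon> m0 K"

lemma surv_sets [measurable]: "surv n \<in> sets lebesgue"
  using borel_survivors by simp

lemma lmeasurable_diff_surv: "cball z r - surv n \<in> lmeasurable"
  by (intro fmeasurable_Diff) auto

text \<open>All points of the disc have a passage of the same time \<open>k\<close>, so
  \<open>f^k\<close> sends points lost at stage \<open>n + 1\<close> to points lost at stage
  \<open>n\<close>, with expansion at least \<open>|a| / 2\<close>. The image lies in a disc of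
  radius \<open>\<rho>\<close> about \<open>y\<close>; there the points that are not good are absent
  or few by (b), and near each good one the induction hypothesis applies, at modulus at least
  \<open>2 t\<close>.\<close>

lemma density_step:
  assumes IH: "\<And>x. good x \<Longrightarrow> cmod x \<ge> M \<Longrightarrow>
      measure lebesgue (cball x (rad x) - surv n) \<le> bound (cmod x) * measure lebesgue (cball x (rad x))"
    and z: "good z" and t: "t = cmod z" "t \<ge> M" "t \<ge> 4" "t \<ge> 2 powr L"
    and ren: "renormalizes (\<kappa> + L) z k p"
    and c: "1600 * C2 * C1 * t powr (\<kappa> + L) * exp (- (\<eta>1 * t powr \<epsilon>)) \<le> bound t / 2"
    and d: "160000 * bound (2 * t) \<le> bound t / 2"
  shows "measure lebesgue (cball z (rad z) - surv (Suc n)) \<le> bound t * measure lebesgue (cball z (rad z))"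
proof -
  note cp = const_pos
  define D where "D = ball z (t powr - L0)"
  define \<phi> where "\<phi> = f ^^ k"
  define y where "y = \<phi> z"
  define a where "a = deriv \<phi> z"
  define r where "r = rad z"
  define \<rho> where "\<rho> = 2 * cmod a * r"
  define dd where "dd = cmod (y - p)"
  have ren': "D \<subseteq> regular_upto f k"
    "\<And>x. x \<in> D \<Longrightarrow> passage f A \<epsilon> m0 K x k" "\<And>x. x \<in> D \<Longrightarrow> \<phi> x \<noteq> p"
    "\<And>x. x \<in> D \<Longrightarrow> t powr - \<kappa> \<le> cmod (deriv \<phi> x / (\<phi> x - p))"
    "\<And>x. x \<in> D \<Longrightarrow> cmod (deriv \<phi> x / (\<phi> x - p)) \<le> t powr \<kappa>"
    "t powr (\<kappa> + L) \<le> cmod y" "dd \<le> cmod y" "cmod y powr - (K + 1) \<le> dd"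
    "(\<forall>x. cmod (x - y) \<le> dd / 2 \<longrightarrow> good x) \<or>
      cmod y powr \<beta> / dd \<le> C1 * exp (- (\<eta>1 * t powr \<epsilon>))"
    using ren unfolding renormalizes_def t(1)[symmetric] D_def y_def \<phi>_def dd_def by blast+
  have tpos: "t > 0"
    using t by linarith
  have zD: "z \<in> D"
    using tpos by (simp add: D_def)
  have dd: "dd > 0"
    using ren'(3)[OF zD] by (simp add: dd_def y_def)
  have r: "r > 0" "r = t powr - L"
    using tpos t(1) by (auto simp: r_def rad_def)
  \<comment> \<open>\<open>L = 2 \<kappa> + L0 + 5\<close>, so the distortion bound on the disc of
    radius \<open>t^(-L)\<close> is \<open>16 t^(-5)\<close>; \<open>t \<ge> 4\<close> makes it at
    most \<open>1/2\<close>.\<close>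
  have small: "t powr - 5 \<le> 1 / 1024"
  proof -
    have "t powr - 5 \<le> 4 powr - 5"
      using t by (intro powr_mono2') auto
    also have "(4::real) powr - 5 = 1 / 1024"
      by (simp add: powr_minus_divide)
    finally show ?thesis .
  qed
  have Leq: "L = 2 * \<kappa> + L0 + 5"
    by (simp add: L_def K_def)
  have rR: "r \<le> t powr - L0 / 2"
  proof -
    have "r \<le> t powr (- L0 + - 5)"
      unfolding r(2) using t cp by (intro powr_mono) (auto simp: Leq)
    also have "\<dots> = t powr - L0 * t powr - 5"
      by (simp only: powr_add)
    also have "\<dots> \<le> t powr - L0 * (1 / 2)"
      using small by (intro mult_left_mono) auto
    finally show ?thesis
      by simp
  qed
  have cD: "cball z r \<subseteq> D"
  proof -
    have "r < t powr - L0"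
      using rR r(1) by linarith
    then show ?thesis
      by (auto simp: D_def)
  qed
  have hol: "\<phi> holomorphic_on D"
    unfolding \<phi>_def by (rule holomorphic_on_subset[OF regular_upto_props(2)[OF mero] ren'(1)])
  have openD: "open D"
    by (simp add: D_def)
  have dF: "deriv (\<lambda>x. \<phi> x - p) x = deriv \<phi> x" if "x \<in> D" for x
    using holomorphic_on_imp_differentiable_at[OF hol openD that] by (simp add: deriv_diff)
  have Ru: "t powr - L0 * t powr \<kappa> \<le> 1 / 2"
  proof -
    have "t powr - L0 * t powr \<kappa> = t powr - (L0 - \<kappa>)"
      using tpos by (simp add: algebra_simps flip: powr_add)
    then show ?thesis
      using powr_le_half[of t "L0 - \<kappa>"] t cp by simp
  qed
  have lin: "cmod (deriv \<phi> x - a) \<le> cmod a / 2" if x: "x \<in> cball z r" for x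
  proof -
    have xr: "cmod (x - z) \<le> r"
      using x by (simp add: dist_norm norm_minus_commute)
    have xD: "x \<in> D"
      using x cD by blast
    have "cmod (deriv (\<lambda>x. \<phi> x - p) x - deriv (\<lambda>x. \<phi> x - p) z) \<le>
        16 * t powr \<kappa> / (t powr - L0 * t powr - \<kappa>) * cmod (x - z) * cmod (deriv (\<lambda>x. \<phi> x - p) z)"
    proof (rule log_derivative_distortion_deriv)
      show "(\<lambda>x. \<phi> x - p) holomorphic_on ball z (t powr - L0)"
        using hol unfolding D_def by (intro holomorphic_intros)
      show "cmod (x - z) \<le> t powr - L0 / 2"
        using xr rR by linarith
    qed (use ren' dF Ru tpos in \<open>auto simp: D_def\<close>)
    then have "cmod (deriv \<phi> x - a) \<le> 16 * t powr \<kappa> / (t powr - L0 * t powr - \<kappa>) * cmod (x - z) * cmod a"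
      by (simp only: dF[OF xD] dF[OF zD] a_def)
    also have "\<dots> \<le> 16 * t powr \<kappa> / (t powr - L0 * t powr - \<kappa>) * t powr - L * cmod a"
      using xr r(2) by (intro mult_right_mono mult_left_mono) auto
    also have "16 * t powr \<kappa> / (t powr - L0 * t powr - \<kappa>) * t powr - L = 16 * t powr (\<kappa> + L0 + \<kappa> + - L)"
      using tpos by (simp only: powr_add) (simp add: powr_minus field_simps)
    also have "\<kappa> + L0 + \<kappa> + - L = - 5"
      by (simp add: Leq)
    also have "16 * t powr - 5 * cmod a \<le> 1 / 2 * cmod a"
      using small by (intro mult_right_mono) auto
    finally show ?thesis
      by simp
  qed
  have nl: "cmod (\<phi> x - \<phi> v - a * (x - v)) \<le> cmod a / 2 * cmod (x - v)"
    if "x \<in> cball z r" "v \<in> cball z r" for x v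
  proof (rule nearly_linear[where S = "cball z r" and \<phi>' = "deriv \<phi>"])
    fix x assume "x \<in> cball z r"
    then have "x \<in> D"
      using cD by blast
    then show "(\<phi> has_field_derivative deriv \<phi> x) (at x within cball z r)"
      using hol openD by (blast intro: has_field_derivative_at_within holomorphic_derivI)
  qed (use lin that in auto)
  have q: "t powr - \<kappa> * dd \<le> cmod a" "cmod a \<le> t powr \<kappa> * dd"
    using ren'(4,5)[OF zD] dd by (auto simp: norm_divide a_def dd_def y_def field_simps)
  have apos: "cmod a > 0"
  proof -
    have "0 < t powr - \<kappa> * dd"
      using tpos dd by simp
    then show ?thesis
      using q(1) by linarith
  qed
  have \<rho>: "\<rho> > 0"
    using apos r by (simp add: \<rho>_def)
  have \<rho>_low: "2 * (dd / t powr (\<kappa> + L)) \<le> \<rho>"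
  proof -
    have "dd / t powr (\<kappa> + L) = t powr - \<kappa> * dd * t powr - L"
      by (simp add: powr_add powr_minus_divide)
    also have "\<dots> \<le> cmod a * t powr - L"
      using q(1) by (intro mult_right_mono) auto
    finally show ?thesis
      by (simp add: \<rho>_def r(2))
  qed
  have \<rho>_up: "\<rho> \<le> dd / 4"
  proof -
    have "cmod a * r \<le> t powr \<kappa> * dd * t powr - L"
      unfolding r(2) using q(2) by (intro mult_right_mono) auto
    also have "\<dots> = t powr (\<kappa> + - L) * dd"
      by (simp only: powr_add) simp
    also have "\<dots> \<le> t powr - 5 * dd"
      using t cp dd by (intro mult_right_mono powr_mono) (auto simp: Leq)
    also have "\<dots> \<le> 1 / 8 * dd"
      using small dd by (intro mult_right_mono) auto
    finally show ?thesis
      by (simp add: \<rho>_def)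
  qed
  have im: "\<phi> ` cball z r \<subseteq> cball y \<rho>"
  proof
    fix v assume "v \<in> \<phi> ` cball z r"
    then obtain x where x: "x \<in> cball z r" "v = \<phi> x"
      by blast
    have "cmod (\<phi> x - \<phi> z) \<le> cmod (a * (x - z)) + cmod a / 2 * cmod (x - z)"
      using nl[OF x(1), of z] r(1) norm_triangle_sub[of "\<phi> x - \<phi> z" "a * (x - z)"] by simp
    also have "\<dots> = 3 / 2 * cmod a * cmod (x - z)"
      by (simp add: norm_mult)
    also have "\<dots> \<le> 3 / 2 * cmod a * r"
      using x by (intro mult_left_mono) (auto simp: dist_norm norm_minus_commute)
    also have "\<dots> \<le> \<rho>"
      using apos r by (simp add: \<rho>_def)
    finally show "v \<in> cball y \<rho>"
      by (simp add: x y_def dist_norm norm_minus_commute)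
  qed
  have expand: "cmod a / 2 * cmod (x - v) \<le> cmod (\<phi> x - \<phi> v)" if "x \<in> cball z r" "v \<in> cball z r" for x v
    using nl[OF that] norm_triangle_ineq3[of "\<phi> x - \<phi> v" "a * (x - v)"] by (simp add: norm_mult)
  let ?E = "cball z r - surv (Suc n)"
  let ?N = "cball y \<rho> - surv n"
  let ?Bad = "{x \<in> cball y \<rho>. \<not> good x}"
  let ?Ng = "?N - ?Bad"
  have E1: "measure lebesgue ?E \<le> 100 / (cmod a / 2)\<^sup>2 * measure lebesgue ?N"
  proof (rule measure_le_of_expanding_map)
    show "\<phi> ` ?E \<subseteq> ?N"
    proof
      fix v assume "v \<in> \<phi> ` ?E"
      then obtain x where x: "x \<in> cball z r" "x \<notin> surv (Suc n)" "v = \<phi> x"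
        by blast
      then have "passage f A \<epsilon> m0 K x k"
        using ren'(2) cD by blast
      then have "\<phi> x \<notin> surv n"
        using x(2) by (auto simp: \<phi>_def)
      then show "v \<in> ?N"
        using x im by blast
    qed
    show "?E \<in> sets lebesgue"
      using lmeasurable_diff_surv by blast
  qed (use apos expand lmeasurable_diff_surv in auto)
  have y4t: "4 * t \<le> cmod y"
  proof -
    have "4 * t \<le> t * t"
      using t by (intro mult_right_mono) auto
    also have "\<dots> = t powr 2"
      using tpos by (simp add: power2_eq_square)
    also have "\<dots> \<le> t powr (\<kappa> + L)"
      using t cp by (intro powr_mono) auto
    finally show ?thesis
      using ren'(6) by linarith
  qed
  have ybig: "cmod y \<ge> 2" "cmod y > 0"
    using y4t t by linarith+
  have \<rho>y: "2 * \<rho> \<le> cmod y / 2"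
    using \<rho>_up ren'(7) by linarith
  note bad = not_good_measure[OF ybig(1) \<rho>, OF order_trans[OF _ \<rho>y]]
  have Badm: "?Bad \<in> lmeasurable" "measure lebesgue ?Bad \<le> C2 * \<rho> * cmod y powr \<beta>"
    using bad \<rho> by auto
  have Bad: "measure lebesgue ?Bad \<le> C2 * \<rho>\<^sup>2 * (t powr (\<kappa> + L) * (C1 * exp (- (\<eta>1 * t powr \<epsilon>))))"
    using ren'(9)
  proof
    assume "\<forall>x. cmod (x - y) \<le> dd / 2 \<longrightarrow> good x"
    moreover have "cmod (x - y) \<le> dd / 2" if "x \<in> cball y \<rho>" for x
      using that \<rho>_up \<rho> by (simp add: dist_norm norm_minus_commute)
    ultimately have "?Bad = {}"
      by blast
    then have "measure lebesgue ?Bad = 0"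
      by (simp only: measure_empty)
    also have "0 \<le> C2 * \<rho>\<^sup>2 * (t powr (\<kappa> + L) * (C1 * exp (- (\<eta>1 * t powr \<epsilon>))))"
      using C2_pos by (simp add: C1_def)
    finally show ?thesis .
  next
    assume fr: "cmod y powr \<beta> / dd \<le> C1 * exp (- (\<eta>1 * t powr \<epsilon>))"
    have "cmod y powr \<beta> = (cmod y powr \<beta> / dd) * dd"
      using dd by simp
    also have "\<dots> \<le> (C1 * exp (- (\<eta>1 * t powr \<epsilon>))) * dd"
      using fr dd by (intro mult_right_mono) auto
    also have "\<dots> \<le> (C1 * exp (- (\<eta>1 * t powr \<epsilon>))) * (\<rho> * t powr (\<kappa> + L))"
    proof (rule mult_left_mono)
      have "2 * dd \<le> \<rho> * t powr (\<kappa> + L)"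
        using \<rho>_low tpos by (simp add: field_simps)
      then show "dd \<le> \<rho> * t powr (\<kappa> + L)"
        using dd by linarith
    qed (simp add: C1_def)
    finally have "C2 * \<rho> * cmod y powr \<beta> \<le> C2 * \<rho> * ((C1 * exp (- (\<eta>1 * t powr \<epsilon>))) * (\<rho> * t powr (\<kappa> + L)))"
      using C2_pos \<rho> by (intro mult_left_mono) auto
    then show ?thesis
      using Badm(2) by (simp add: power2_eq_square mult_ac)
  qed
  have Ng: "measure lebesgue ?Ng \<le> 25 * bound (2 * t) * measure lebesgue (cball y (2 * \<rho>))"
  proof (rule measure_le_of_local_density[where r = rad and b = \<rho>])
    show "?Ng \<in> sets lebesgue"
      using lmeasurable_diff_surv Badm(1) by (intro sets.Diff) auto
    fix x assume x: "x \<in> ?Ng"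
    then have xy: "cmod (y - x) \<le> \<rho>" and xg: "good x"
      by (auto simp: dist_norm)
    have nx: "cmod y / 2 \<le> cmod x"
      using xy \<rho>y \<rho> norm_triangle_ineq3[of y x] by linarith
    have x2t: "2 * t \<le> cmod x"
      using nx y4t by linarith
    have "rad x \<le> (cmod y / 2) powr - L"
      unfolding rad_def using nx ybig cp by (intro powr_mono2') auto
    also have "\<dots> = 2 powr L * cmod y powr - L"
      by (simp add: powr_divide powr_minus_divide)
    also have "\<dots> \<le> cmod y * cmod y powr - L"
    proof (rule mult_right_mono)
      show "2 powr L \<le> cmod y"
        using t y4t by linarith
    qed simp
    \<comment> \<open>\<open>L = K + 3\<close>: one power of \<open>|y|\<close> has just absorbed
      \<open>2^L\<close>, another is traded for \<open>|y| \<ge> t^(\<kappa>+L)\<close>, and the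
      rest is the lower bound for \<open>dd\<close>. So the discs of the induction hypothesis have
      radius at most \<open>\<rho>\<close>.\<close>
    also have "\<dots> = cmod y powr - (K + 1) / cmod y"
    proof -
      have "- L = - (K + 1) + - 1 + - 1"
        by (simp add: L_def)
      then have "cmod y powr - L = cmod y powr - (K + 1) * cmod y powr - 1 * cmod y powr - 1"
        by (simp only: powr_add)
      then show ?thesis
        using ybig by (simp add: powr_minus divide_inverse)
    qed
    also have "\<dots> \<le> dd / t powr (\<kappa> + L)"
      using ren'(6,8) dd tpos by (intro frac_le) auto
    also have "\<dots> \<le> \<rho>"
    proof -
      have "0 \<le> dd / t powr (\<kappa> + L)"
        using dd by simp
      then show ?thesis
        using \<rho>_low by linarith
    qed
    finally have rx: "rad x \<le> \<rho>" .
    have "cmod x > 0"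
      using x2t tpos by linarith
    then show "0 < rad x \<and> rad x \<le> \<rho>"
      using rx by (auto simp: rad_def)
    show "cball x (rad x) \<subseteq> cball y (2 * \<rho>)"
    proof
      fix v assume "v \<in> cball x (rad x)"
      then show "v \<in> cball y (2 * \<rho>)"
        using rx xy dist_triangle[of y v x] by (simp add: dist_norm)
    qed
    have "measure lebesgue (?Ng \<inter> cball x (rad x)) \<le> measure lebesgue (cball x (rad x) - surv n)"
      using lmeasurable_diff_surv Badm(1) by (intro measure_mono_fmeasurable sets.Int sets.Diff) auto
    also have "\<dots> \<le> bound (cmod x) * measure lebesgue (cball x (rad x))"
      using IH[OF xg] x2t t by simp
    also have "\<dots> \<le> bound (2 * t) * measure lebesgue (cball x (rad x))"
      using x2t tpos by (intro mult_right_mono bound_mono) auto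
    finally show "measure lebesgue (?Ng \<inter> cball x (rad x)) \<le> bound (2 * t) * measure lebesgue (cball x (rad x))" .
  qed (auto simp: bound_def)
  have "measure lebesgue ?N \<le> measure lebesgue (?Bad \<union> ?Ng)"
  proof (rule measure_mono_fmeasurable)
    have "?Ng \<in> lmeasurable"
      by (rule fmeasurable_Diff[OF lmeasurable_diff_surv fmeasurableD[OF Badm(1)]])
    then show "?Bad \<union> ?Ng \<in> lmeasurable"
      using Badm(1) by (rule fmeasurable.Un[rotated])
    show "?N \<in> sets lebesgue"
      using lmeasurable_diff_surv by blast
  qed blast
  also have "\<dots> \<le> measure lebesgue ?Bad + measure lebesgue ?Ng"
    using lmeasurable_diff_surv Badm(1) by (intro measure_Un_le sets.Diff) auto
  also have "\<dots> \<le> C2 * \<rho>\<^sup>2 * (t powr (\<kappa> + L) * (C1 * exp (- (\<eta>1 * t powr \<epsilon>)))) +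
      25 * bound (2 * t) * (pi * (2 * \<rho>)\<^sup>2)"
    using Bad Ng \<rho> by (simp add: measure_cball_complex)
  also have "\<dots> = \<rho>\<^sup>2 * (C2 * C1 * t powr (\<kappa> + L) * exp (- (\<eta>1 * t powr \<epsilon>)) + 100 * pi * bound (2 * t))"
    by (simp add: power_mult_distrib algebra_simps)
  finally have N: "measure lebesgue ?N \<le> \<rho>\<^sup>2 * (C2 * C1 * t powr (\<kappa> + L) * exp (- (\<eta>1 * t powr \<epsilon>)) + 100 * pi * bound (2 * t))" .
  have "measure lebesgue ?E \<le> 100 / (cmod a / 2)\<^sup>2 *
      (\<rho>\<^sup>2 * (C2 * C1 * t powr (\<kappa> + L) * exp (- (\<eta>1 * t powr \<epsilon>)) + 100 * pi * bound (2 * t)))"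
    using E1 mult_left_mono[OF N, of "100 / (cmod a / 2)\<^sup>2"] by simp
  \<comment> \<open>Since \<open>\<rho> = 2 |a| r\<close>, the factor
    \<open>400 \<rho>^2 / |a|^2\<close> is \<open>1600 r^2\<close>, whence the constants in the
    hypotheses \<open>c\<close> and \<open>d\<close>.\<close>
  also have "\<dots> = r\<^sup>2 * (1600 * C2 * C1 * t powr (\<kappa> + L) * exp (- (\<eta>1 * t powr \<epsilon>)) + pi * (160000 * bound (2 * t)))"
    using apos by (simp add: \<rho>_def power_mult_distrib power_divide field_simps)
  also have "\<dots> \<le> r\<^sup>2 * (pi * (bound t / 2) + pi * (bound t / 2))"
  proof (intro mult_left_mono add_mono)
    have "1 * (bound t / 2) \<le> pi * (bound t / 2)"
      using pi_gt3 by (intro mult_right_mono) (auto simp: bound_def)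
    then show "1600 * C2 * C1 * t powr (\<kappa> + L) * exp (- (\<eta>1 * t powr \<epsilon>)) \<le> pi * (bound t / 2)"
      using c by linarith
  qed (use d in auto)
  also have "\<dots> = bound t * measure lebesgue (cball z r)"
    using r by (simp add: measure_cball_complex algebra_simps)
  finally show ?thesis
    by (simp add: r_def)
qed

text \<open>\<open>bound (2 * t)\<close> is \<open>bound t\<close> times
  \<open>exp (-\<eta>2 (2^\<epsilon> - 1) t^\<epsilon>)\<close>, so doubling the modulus outweighs
  the covering constants, and the losses of all later passages cost at most half of
  \<open>bound t\<close>. Thus the induction on the stage closes with one threshold
  \<open>M\<close>.\<close>

lemma survivor_density:
  "\<exists>M\<ge>4. \<forall>n z. good z \<longrightarrow> cmod z \<ge> M \<longrightarrow>
     measure lebesgue (cball z (rad z) - surv n) \<le> bound (cmod z) * measure lebesgue (cball z (rad z))"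
proof -
  obtain M1 where M1: "\<And>z. good z \<Longrightarrow> cmod z \<ge> M1 \<Longrightarrow> \<exists>k p. renormalizes (\<kappa> + L) z k p"
    using exists_renormalization[of "\<kappa> + L"] const_pos by auto
  define q where "q = 2 powr \<epsilon> - 1"
  have q: "q > 0"
    using eps by (simp add: q_def)
  define h where "h = \<eta>1 - \<eta>2"
  have h: "h > 0" "\<eta>2 > 0"
    using \<eta>2 by (simp_all add: h_def)
  have "\<forall>\<^sub>F t::real in at_top. 1600 * C2 * C1 * t powr (\<kappa> + L) * exp (- (h * t powr \<epsilon>)) \<le> 1 / 2"
    using h eps by real_asymp
  moreover have "\<forall>\<^sub>F t::real in at_top. 160000 * exp (- (\<eta>2 * q * t powr \<epsilon>)) \<le> 1 / 2"
    using h q eps by real_asymp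
  ultimately have "\<forall>\<^sub>F t::real in at_top. 1600 * C2 * C1 * t powr (\<kappa> + L) * exp (- (h * t powr \<epsilon>)) \<le> 1 / 2 \<and>
      160000 * exp (- (\<eta>2 * q * t powr \<epsilon>)) \<le> 1 / 2 \<and> t \<ge> Max {M1, 4, 2 powr L}"
    using eventually_ge_at_top[of "Max {M1, 4, 2 powr L}"] by eventually_elim blast
  then obtain M where M: "\<And>t. t \<ge> M \<Longrightarrow> 1600 * C2 * C1 * t powr (\<kappa> + L) * exp (- (h * t powr \<epsilon>)) \<le> 1 / 2 \<and>
      160000 * exp (- (\<eta>2 * q * t powr \<epsilon>)) \<le> 1 / 2 \<and> t \<ge> M1 \<and> t \<ge> 4 \<and> t \<ge> 2 powr L"
    unfolding eventually_at_top_linorder by auto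
  have "\<forall>z. good z \<longrightarrow> cmod z \<ge> M \<longrightarrow>
     measure lebesgue (cball z (rad z) - surv n) \<le> bound (cmod z) * measure lebesgue (cball z (rad z))" for n
  proof (induction n)
    case 0
    show ?case
      by (simp add: bound_def)
  next
    case (Suc n)
    show ?case
    proof (intro allI impI)
      fix z assume z: "good z" "cmod z \<ge> M"
      define t where "t = cmod z"
      have t: "t \<ge> M"
        using z by (simp add: t_def)
      note Mt = M[OF t]
      obtain k p where kp: "renormalizes (\<kappa> + L) z k p"
      proof -
        have "M1 \<le> cmod z"
          using Mt by (simp add: t_def)
        then show ?thesis
          using M1[OF z(1)] that by blast
      qed
      have "measure lebesgue (cball z (rad z) - surv (Suc n)) \<le> bound t * measure lebesgue (cball z (rad z))"
      proof (rule density_step[OF _ z(1) t_def t _ _ kp])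
        have "exp (- (\<eta>1 * t powr \<epsilon>)) = exp (- (h * t powr \<epsilon>)) * bound t"
          by (simp add: bound_def h_def algebra_simps flip: exp_add)
        then have "1600 * C2 * C1 * t powr (\<kappa> + L) * exp (- (\<eta>1 * t powr \<epsilon>)) =
            (1600 * C2 * C1 * t powr (\<kappa> + L) * exp (- (h * t powr \<epsilon>))) * bound t"
          by simp
        also have "\<dots> \<le> 1 / 2 * bound t"
          using Mt by (intro mult_right_mono) (auto simp: bound_def)
        finally show "1600 * C2 * C1 * t powr (\<kappa> + L) * exp (- (\<eta>1 * t powr \<epsilon>)) \<le> bound t / 2"
          by simp
        have "(2 * t) powr \<epsilon> = q * t powr \<epsilon> + t powr \<epsilon>"
          by (simp add: q_def powr_mult algebra_simps)
        then have "bound (2 * t) = exp (- (\<eta>2 * q * t powr \<epsilon>)) * bound t"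
          by (simp add: bound_def algebra_simps flip: exp_add)
        then have "160000 * bound (2 * t) = (160000 * exp (- (\<eta>2 * q * t powr \<epsilon>))) * bound t"
          by simp
        also have "\<dots> \<le> 1 / 2 * bound t"
          using Mt by (intro mult_right_mono) (auto simp: bound_def)
        finally show "160000 * bound (2 * t) \<le> bound t / 2"
          by simp
      qed (use Suc Mt in auto)
      then show "measure lebesgue (cball z (rad z) - surv (Suc n)) \<le> bound (cmod z) * measure lebesgue (cball z (rad z))"
        by (simp only: t_def)
    qed
  qed
  moreover have "max M 4 \<ge> 4" "max M 4 \<ge> M"
    by auto
  ultimately show ?thesis
    by (intro exI[of _ "max M 4"]) auto
qed

end

lemma square_props:
  assumes "is_square Q"
  obtains c l where "l > 0" "cball c l \<subseteq> Q" "Q \<subseteq> cball c (2 * l)" "compact Q"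
proof -
  obtain c u l where q: "cmod u = 1" "l > 0" "Q = {c + u * Complex x y | x y. \<bar>x\<bar> \<le> l \<and> \<bar>y\<bar> \<le> l}"
    using assms by (auto simp: is_square_def)
  have u: "u \<noteq> 0"
    using q(1) by auto
  show thesis
  proof (rule that[OF q(2)])
    show "cball c l \<subseteq> Q"
    proof
      fix w assume w: "w \<in> cball c l"
      define v where "v = (w - c) / u"
      have "cmod v \<le> l"
        using w q(1) by (simp add: v_def norm_divide dist_norm norm_minus_commute)
      then have "\<bar>Re v\<bar> \<le> l" "\<bar>Im v\<bar> \<le> l"
        using abs_Re_le_cmod[of v] abs_Im_le_cmod[of v] by linarith+
      moreover have "w = c + u * Complex (Re v) (Im v)"
        using u by (simp add: v_def)
      ultimately show "w \<in> Q"
        unfolding q(3) by blast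
    qed
    show "Q \<subseteq> cball c (2 * l)"
    proof
      fix w assume "w \<in> Q"
      then obtain x y where xy: "w = c + u * Complex x y" "\<bar>x\<bar> \<le> l" "\<bar>y\<bar> \<le> l"
        unfolding q(3) by blast
      have "cmod (Complex x y) \<le> 2 * l"
        using cmod_le[of "Complex x y"] xy(2,3) by simp
      then show "w \<in> cball c (2 * l)"
        using q(1) by (simp add: xy(1) dist_norm norm_mult)
    qed
    have "Q = (\<lambda>v. c + u * v) ` cbox (Complex (- l) (- l)) (Complex l l)" (is "_ = ?I")
    proof (intro set_eqI iffI)
      fix w assume "w \<in> Q"
      then obtain x y where xy: "w = c + u * Complex x y" "\<bar>x\<bar> \<le> l" "\<bar>y\<bar> \<le> l"
        unfolding q(3) by blast
      then have "Complex x y \<in> cbox (Complex (- l) (- l)) (Complex l l)"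
        by (auto simp: in_cbox_complex_iff)
      then show "w \<in> ?I"
        using xy(1) by blast
    next
      fix w assume "w \<in> ?I"
      then obtain v where v: "v \<in> cbox (Complex (- l) (- l)) (Complex l l)" "w = c + u * Complex (Re v) (Im v)"
        by auto
      then have "\<bar>Re v\<bar> \<le> l" "\<bar>Im v\<bar> \<le> l"
        by (auto simp: in_cbox_complex_iff)
      then show "w \<in> Q"
        unfolding q(3) using v(2) by blast
    qed
    then show "compact Q"
      by (simp add: compact_continuous_image continuous_intros)
  qed
qed

section \<open>Positive measure and density in squares\<close>

context tracked_setting
begin

abbreviation "Sh \<equiv> {x. shadowing f A x}"

lemma Sh_sets: "Sh \<in> sets lebesgue"
  using borel_shadowing[OF mero] by simp

text \<open>The survivors decrease, so the lost parts increase to the set of points that drop out at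
  some stage, and a uniform bound passes to this union; the remaining points shadow by
  \<open>shadowing_of_survivors\<close>.\<close>

lemma lost_measure:
  assumes X: "X \<in> lmeasurable" "\<And>x. x \<in> X \<Longrightarrow> cmod x \<ge> 1"
    and c: "\<And>n. measure lebesgue (X - surv n) \<le> c"
  shows "measure lebesgue (X - Sh) \<le> c"
proof -
  let ?U = "\<Union>n. X - surv n"
  have sub: "?U \<subseteq> X"
    by blast
  have Um: "?U \<in> lmeasurable"
    by (rule fmeasurableI2[OF X(1) sub]) (use X(1) in \<open>auto intro!: sets.Diff\<close>)
  have "(\<lambda>n. measure lebesgue (X - surv n)) \<longlonglongrightarrow> measure lebesgue ?U"
  proof (rule Lim_measure_incseq)
    show "range (\<lambda>n. X - surv n) \<subseteq> sets lebesgue"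
      using X(1) by (auto intro!: sets.Diff)
    show "incseq (\<lambda>n. X - surv n)"
      using decseq_survivors[of f A \<epsilon> m0 K] unfolding incseq_def decseq_def by blast
    show "emeasure lebesgue ?U \<noteq> \<infinity>"
      using fmeasurableD2[OF Um] by simp
  qed
  then have "measure lebesgue ?U \<le> c"
    by (rule LIMSEQ_le_const2) (use c in auto)
  moreover have "X - Sh \<subseteq> ?U"
  proof
    fix x assume x: "x \<in> X - Sh"
    then have "\<exists>n. x \<notin> surv n"
      using shadowing_of_survivors[of K x m0] X(2)[of x] const_pos by auto
    then show "x \<in> ?U"
      using x by blast
  qed
  then have "measure lebesgue (X - Sh) \<le> measure lebesgue ?U"
    using Um X(1) Sh_sets by (intro measure_mono_fmeasurable sets.Diff) auto
  ultimately show ?thesis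
    by linarith
qed

text \<open>If all points beyond \<open>M\<close> failed to be good, a disc of radius
  \<open>R / 2\<close> about the point \<open>R\<close> would have area at most of order
  \<open>R^(1+\<beta>)\<close> by (b), which \<open>\<beta> < 1\<close> excludes for large
  \<open>R\<close>.\<close>

lemma exists_good: "\<exists>z. good z \<and> cmod z \<ge> M"
proof (rule ccontr)
  assume none: "\<not> ?thesis"
  have "\<forall>\<^sub>F R::real in at_top. C2 * (R / 2) * R powr \<beta> < pi * (R / 2)\<^sup>2"
    using beta C2_pos by real_asymp
  then have "\<forall>\<^sub>F R::real in at_top. C2 * (R / 2) * R powr \<beta> < pi * (R / 2)\<^sup>2 \<and> R \<ge> max 2 (2 * M)"
    using eventually_ge_at_top[of "max 2 (2 * M)"] by eventually_elim blast
  then obtain R :: real where R: "C2 * (R / 2) * R powr \<beta> < pi * (R / 2)\<^sup>2" "R \<ge> 2" "R \<ge> 2 * M"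
    using eventually_happens'[of "at_top :: real filter"] by force
  define y :: complex where "y = of_real R"
  have y: "cmod y = R"
    using R by (simp add: y_def)
  have "{x \<in> cball y (R / 2). \<not> good x} = cball y (R / 2)"
  proof -
    have "\<not> good x" if "x \<in> cball y (R / 2)" for x
    proof -
      have "cmod x \<ge> M"
        using that R y norm_triangle_ineq2[of y x] by (simp add: dist_norm)
      then show ?thesis
        using none by blast
    qed
    then show ?thesis
      by blast
  qed
  then have "pi * (R / 2)\<^sup>2 \<le> C2 * (R / 2) * R powr \<beta>"
    using not_good_measure(2)[of y "R / 2"] R y by (simp add: measure_cball_complex)
  then show False
    using R by linarith
qed

lemma T_set_eq: "T_set f A = Sh"
  using T_set_eq_shadowing escape_A by blast

lemma T_set_emeasure_pos: "emeasure lebesgue (T_set f A) > 0"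
proof -
  obtain M where M: "M \<ge> 4" "\<And>n z. good z \<Longrightarrow> cmod z \<ge> M \<Longrightarrow>
     measure lebesgue (cball z (rad z) - surv n) \<le> bound (cmod z) * measure lebesgue (cball z (rad z))"
    using survivor_density by blast
  obtain z where z: "good z" "cmod z \<ge> M"
    using exists_good by blast
  have t: "cmod z \<ge> 4"
    using z M by linarith
  let ?X = "cball z (rad z)"
  have rad: "rad z > 0" "rad z \<le> 1 / 2"
    using t powr_le_half[of "cmod z" L] const_pos by (auto simp: rad_def)
  have Xpos: "measure lebesgue ?X > 0"
    using rad by (simp add: measure_cball_complex)
  have "measure lebesgue (?X - Sh) \<le> bound (cmod z) * measure lebesgue ?X"
  proof (rule lost_measure)
    show "cmod x \<ge> 1" if "x \<in> ?X" for x
      using that rad t norm_triangle_ineq2[of z x] by (simp add: dist_norm)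
  qed (use M(2)[OF z] in auto)
  also have "\<dots> < 1 * measure lebesgue ?X"
  proof (rule mult_strict_right_mono[OF _ Xpos])
    have "0 < \<eta>2 * cmod z powr \<epsilon>"
      using \<eta>2 t by (auto intro!: mult_pos_pos)
    then show "bound (cmod z) < 1"
      by (simp add: bound_def)
  qed
  finally have lt: "measure lebesgue (?X - Sh) < measure lebesgue ?X"
    by simp
  have "emeasure lebesgue Sh \<noteq> 0"
  proof
    assume "emeasure lebesgue Sh = 0"
    then have "Sh \<in> null_sets lebesgue"
      using Sh_sets by (simp add: null_sets_def)
    then have "measure lebesgue (?X - Sh) = measure lebesgue ?X"
      by (intro measure_Diff_null_set) auto
    then show False
      using lt by simp
  qed
  then show ?thesis
    by (simp add: T_set_eq zero_less_iff_neq_zero)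
qed

text \<open>\<open>L0 \<ge> |\<delta>1|\<close> makes all points of the square good, and
  \<open>L \<ge> |\<delta>2| + 1\<close> makes the radii of their discs at most \<open>l\<close>,
  since the diameter of the square is at least \<open>M0^(-\<delta>2)\<close>. Covering by these
  discs inside \<open>cball c (3 * l)\<close>, while the square contains \<open>cball c l\<close>,
  costs \<open>25 * 9 = 225\<close>; the gap \<open>\<eta>2 - \<eta>\<close> absorbs it.\<close>

lemma T_set_density:
  "\<exists>M>0. \<forall>T0. is_square T0 \<longrightarrow> T0 \<subseteq> {z. edist_set z (- G) > epowr (cmod z) (- \<delta>1)} \<longrightarrow>
     (INF z\<in>T0. cmod z) > M \<longrightarrow> diameter T0 \<ge> (INF z\<in>T0. cmod z) powr - \<delta>2 \<longrightarrow>
     measure lebesgue (T_set f A \<inter> T0) / measure lebesgue T0 \<ge> 1 - exp (- \<eta> * (INF z\<in>T0. cmod z) powr \<epsilon>)"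
proof -
  obtain M1 where M1: "M1 \<ge> 4" "\<And>n z. good z \<Longrightarrow> cmod z \<ge> M1 \<Longrightarrow>
     measure lebesgue (cball z (rad z) - surv n) \<le> bound (cmod z) * measure lebesgue (cball z (rad z))"
    using survivor_density by blast
  define h where "h = \<eta>2 - \<eta>"
  have h: "h > 0"
    using \<eta>2 by (simp add: h_def)
  have "\<forall>\<^sub>F t::real in at_top. 225 * exp (- (h * t powr \<epsilon>)) \<le> 1"
    using h eps by real_asymp
  then obtain M2 where M2: "\<And>t. t \<ge> M2 \<Longrightarrow> 225 * exp (- (h * t powr \<epsilon>)) \<le> 1"
    unfolding eventually_at_top_linorder by blast
  show ?thesis
  proof (intro exI[of _ "max M1 M2"] conjI allI impI)
    show "0 < max M1 M2"
      using M1 by simp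
    fix T0 assume sq: "is_square T0" and T0: "T0 \<subseteq> {z. edist_set z (- G) > epowr (cmod z) (- \<delta>1)}"
      and large: "(INF z\<in>T0. cmod z) > max M1 M2" and diam: "diameter T0 \<ge> (INF z\<in>T0. cmod z) powr - \<delta>2"
    define t where "t = (INF z\<in>T0. cmod z)"
    have t: "t > M1" "t > M2" "t \<ge> 4"
      using large M1 by (auto simp: t_def)
    obtain c l where cl: "l > 0" "cball c l \<subseteq> T0" "T0 \<subseteq> cball c (2 * l)" "compact T0"
      by (rule square_props[OF sq])
    have ge_t: "cmod x \<ge> t" if "x \<in> T0" for x
      unfolding t_def by (rule cINF_lower[OF _ that]) (auto intro: bdd_belowI2[of _ 0])
    have good: "good x" if x: "x \<in> T0" for x
    proof (rule ccontr)
      assume "\<not> good x"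
      then obtain w where w: "dist x w < cmod x powr - L0" "w \<in> - G"
        by (auto simp: good_def subset_eq)
      have x1: "cmod x \<ge> 1"
        using ge_t[OF x] t by linarith
      then have x0: "x \<noteq> 0"
        by auto
      have "epowr (cmod x) (- \<delta>1) < edist_set x (- G)"
        using T0 x by blast
      also have "\<dots> \<le> ennreal (dist x w)"
        unfolding edist_set_def by (rule INF_lower[OF w(2)])
      also have "\<dots> \<le> ennreal (cmod x powr - \<delta>1)"
      proof (rule ennreal_leI)
        have "cmod x powr - L0 \<le> cmod x powr - \<delta>1"
          using x1 const_pos by (intro powr_mono) auto
        then show "dist x w \<le> cmod x powr - \<delta>1"
          using w(1) by linarith
      qed
      also have "\<dots> = epowr (cmod x) (- \<delta>1)"
        using x0 by (simp add: epowr_def)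
      finally show False
        by simp
    qed
    have "diameter T0 \<le> diameter (cball c (2 * l))"
      using cl(3) by (intro diameter_subset) auto
    also have "\<dots> = 4 * l"
      using cl(1) by simp
    finally have l4: "t powr - \<delta>2 \<le> 4 * l"
      using diam by (simp add: t_def)
    have rad: "0 < rad x" "rad x \<le> l" if x: "x \<in> T0" for x
    proof -
      have x0: "cmod x > 0"
        using ge_t[OF x] t by linarith
      then show "0 < rad x"
        by (auto simp: rad_def)
      have "rad x \<le> t powr - L"
        unfolding rad_def using ge_t[OF x] t const_pos by (intro powr_mono2') auto
      also have "\<dots> \<le> t powr (- \<delta>2 + - 1)"
        using t const_pos by (intro powr_mono) auto
      also have "\<dots> = t powr - \<delta>2 / t"
        using t by (simp only: powr_add) (simp add: powr_minus_divide)
      also have "\<dots> \<le> t powr - \<delta>2 / 4"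
        using t by (intro divide_left_mono) auto
      finally show "rad x \<le> l"
        using l4 by linarith
    qed
    have T0m: "T0 \<in> lmeasurable"
      using cl(4) by (rule lmeasurable_compact)
    have T0pos: "measure lebesgue T0 \<ge> pi * l\<^sup>2"
    proof -
      have "measure lebesgue (cball c l) \<le> measure lebesgue T0"
        using cl(2) T0m by (intro measure_mono_fmeasurable) auto
      then show ?thesis
        using cl(1) by (simp add: measure_cball_complex)
    qed
    have pos: "measure lebesgue T0 > 0"
    proof -
      have "pi * l\<^sup>2 > 0"
        using cl(1) by simp
      then show ?thesis
        using T0pos by linarith
    qed
    have "measure lebesgue (T0 - Sh) \<le> 225 * bound t * measure lebesgue T0"
    proof (rule lost_measure[OF T0m])
      show "1 \<le> cmod x" if "x \<in> T0" for x
        using ge_t[OF that] t by linarith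
      fix n
      have "measure lebesgue (T0 - surv n) \<le> 25 * bound t * measure lebesgue (cball c (3 * l))"
      proof (rule measure_le_of_local_density[where r = rad and b = l])
        show "T0 - surv n \<in> sets lebesgue"
          using T0m by (intro sets.Diff) auto
        fix x assume "x \<in> T0 - surv n"
        then have x: "x \<in> T0"
          by blast
        show "0 < rad x \<and> rad x \<le> l"
          using rad[OF x] by blast
        show "cball x (rad x) \<subseteq> cball c (3 * l)"
        proof
          fix v assume "v \<in> cball x (rad x)"
          moreover have "dist c x \<le> 2 * l"
            using cl(3) x by auto
          ultimately show "v \<in> cball c (3 * l)"
            using rad[OF x] dist_triangle[of c v x] by simp
        qed
        have "measure lebesgue ((T0 - surv n) \<inter> cball x (rad x)) \<le> measure lebesgue (cball x (rad x) - surv n)"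
          using T0m lmeasurable_diff_surv by (intro measure_mono_fmeasurable sets.Int sets.Diff) auto
        also have "\<dots> \<le> bound (cmod x) * measure lebesgue (cball x (rad x))"
          using M1(2)[OF good[OF x]] ge_t[OF x] t by simp
        also have "\<dots> \<le> bound t * measure lebesgue (cball x (rad x))"
          using ge_t[OF x] t by (intro mult_right_mono bound_mono) auto
        finally show "measure lebesgue ((T0 - surv n) \<inter> cball x (rad x)) \<le> bound t * measure lebesgue (cball x (rad x))" .
      qed (auto simp: bound_def)
      also have "\<dots> = 225 * bound t * (pi * l\<^sup>2)"
        using cl(1) by (simp add: measure_cball_complex power_mult_distrib)
      also have "\<dots> \<le> 225 * bound t * measure lebesgue T0"
        using T0pos by (intro mult_left_mono) (auto simp: bound_def)
      finally show "measure lebesgue (T0 - surv n) \<le> 225 * bound t * measure lebesgue T0" .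
    qed
    also have "\<dots> \<le> exp (- \<eta> * t powr \<epsilon>) * measure lebesgue T0"
    proof (rule mult_right_mono)
      have "bound t = exp (- (h * t powr \<epsilon>)) * exp (- \<eta> * t powr \<epsilon>)"
        by (simp add: bound_def h_def algebra_simps flip: exp_add)
      then have "225 * bound t = (225 * exp (- (h * t powr \<epsilon>))) * exp (- \<eta> * t powr \<epsilon>)"
        by simp
      also have "\<dots> \<le> 1 * exp (- \<eta> * t powr \<epsilon>)"
        using M2[of t] t by (intro mult_right_mono) auto
      finally show "225 * bound t \<le> exp (- \<eta> * t powr \<epsilon>)"
        by simp
    qed simp
    finally have lost: "measure lebesgue (T0 - Sh) \<le> exp (- \<eta> * t powr \<epsilon>) * measure lebesgue T0" .
    have "measure lebesgue T0 \<le> measure lebesgue ((Sh \<inter> T0) \<union> (T0 - Sh))"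
      using T0m Sh_sets by (intro measure_mono_fmeasurable) (auto intro: fmeasurable_Int_fmeasurable simp: Un_Diff_cancel2 Int_commute Int_Diff_Un)
    also have "\<dots> \<le> measure lebesgue (Sh \<inter> T0) + measure lebesgue (T0 - Sh)"
      using T0m Sh_sets by (intro measure_Un_le) auto
    finally have "(1 - exp (- \<eta> * t powr \<epsilon>)) * measure lebesgue T0 \<le> measure lebesgue (Sh \<inter> T0)"
      using lost by (simp add: algebra_simps)
    then show "measure lebesgue (T_set f A \<inter> T0) / measure lebesgue T0 \<ge> 1 - exp (- \<eta> * (INF z\<in>T0. cmod z) powr \<epsilon>)"
      unfolding t_def[symmetric] T_set_eq using pos by (simp add: pos_le_divide_eq)
  qed
qed

end

theorem theorem3p1:
  fixes f :: "complex \<Rightarrow> complex" and A G :: "complex set"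
    and \<epsilon> \<delta>1 \<delta>2 B \<beta> \<tau> :: real
  assumes merom: "f nicely_meromorphic_on UNIV"
    and finA: "finite A"
    \<comment> \<open>condition (a)\<close>
    and eps: "\<epsilon> > 0"
    and G_no_poles: "\<And>z. z \<in> G \<Longrightarrow> \<not> is_pole f z"
    and sbar_wd: "sbar_well_defined f A \<epsilon> G"
    and quotient_defined: "\<And>z. z \<in> G \<Longrightarrow> f z \<noteq> sbar f A \<epsilon> z"
    and quotient_lower: "\<And>z. z \<in> G \<Longrightarrow>
          epowr (cmod z) \<delta>1 \<le> ennreal (cmod (deriv f z / (f z - sbar f A \<epsilon> z)))"
    and quotient_upper: "\<And>z. z \<in> G \<Longrightarrow>
          ennreal (cmod (deriv f z / (f z - sbar f A \<epsilon> z))) \<le> epowr (cmod z) \<delta>2"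
    \<comment> \<open>condition (b)\<close>
    and B: "B > 1"
    and beta: "\<beta> < 1"
    and meas_D: "\<And>D. D \<in> sets lebesgue \<Longrightarrow>
          D \<subseteq> {z. edist_set z (- G) \<le> 2 * epowr (cmod z) (- \<delta>1)} \<Longrightarrow>
          emeasure lebesgue D \<le> ennreal B * ediam D * (SUP z\<in>D. epowr (cmod z) \<beta>)"
    \<comment> \<open>condition (c)\<close>
    and iter_A: "\<And>s. s \<in> A \<Longrightarrow> iterates_defined f s"
    and escape_A: "\<And>s. s \<in> A \<Longrightarrow> filterlim (\<lambda>m. (f ^^ m) s) at_infinity sequentially"
    and tau: "\<tau> > \<beta>"
    and discs: "\<And>s. s \<in> A \<Longrightarrow>
          \<forall>\<^sub>F m in sequentially. ball ((f ^^ m) s) (2 * cmod ((f ^^ m) s) powr \<tau>) \<subseteq> G"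
    \<comment> \<open>for nonempty \<open>A\<close> this follows from the other hypotheses\<close>
    and tau_empty: "A = {} \<Longrightarrow> \<tau> < 1"
  shows "emeasure lebesgue (T_set f A) > 0 \<and>
    (let \<eta> = (\<tau> - \<beta>) / max 1 (2 - 2 * \<tau>) in
       \<eta> > 0 \<and>
       (\<exists>M>0. \<forall>T0. is_square T0 \<longrightarrow>
          T0 \<subseteq> {z. edist_set z (- G) > epowr (cmod z) (- \<delta>1)} \<longrightarrow>
          (let M0 = (INF z\<in>T0. cmod z) in
             M0 > M \<longrightarrow>
             diameter T0 \<ge> M0 powr (- \<delta>2) \<longrightarrow>
             measure lebesgue (T_set f A \<inter> T0) / measure lebesgue T0
               \<ge> 1 - exp (- \<eta> * M0 powr \<epsilon>))))"
proof -
  interpret escape_setting f A \<epsilon> G \<delta>1 \<delta>2 B \<beta> \<tau>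
    by unfold_locales (fact assms)+
  obtain m0 r0 C0 where "tracked_setting f A \<epsilon> G \<delta>1 \<delta>2 B \<beta> \<tau> m0 r0 C0"
    using tracked_setting_exists by blast
  then interpret tracked_setting f A \<epsilon> G \<delta>1 \<delta>2 B \<beta> \<tau> m0 r0 C0 .
  show ?thesis
    unfolding Let_def \<eta>_def[symmetric]
    by (intro conjI T_set_emeasure_pos \<eta>_pos T_set_density)
qed

end
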